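(* Let $d=2$ and $\mathbf{k}(x)=1\wedge\frac{1}{|x|^{\alpha}}$ for $x\in\mathbb{R}^2$, for some fixed $\alpha\in(0,2)$. Then the killed Brownian motion conditioned to survive does not make sense. More precisely, there exist two exhaustions $\Lambda^1=(\Lambda^1_R)_{R\in\mathbb{N}}$ and $\Lambda^2=(\Lambda^2_R)_{R\in\mathbb{N}}$ of $\mathbb{R}^2$ and points $x,y\in\mathbb{R}^2$ such that $$\lim_{R\to\infty}\frac{\mathbb{P}_x[\tau((\Lambda^1_R)^c)<\tau(\Delta)]}{\mathbb{P}_y[\tau((\Lambda^1_R)^c)<\tau(\Delta)]}\neq\lim_{R\to\infty}\frac{\mathbb{P}_x[\tau((\Lambda^2_R)^c)<\tau(\Delta)]}{\mathbb{P}_y[\tau((\Lambda^2_R)^c)<\tau(\Delta)]},$$ in the sense that either at least one of these limits does not exist, or both exist and they are different.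
   Context: $|\cdot|$ is the Euclidean norm, and $\mathbf{k}(0)=1$. Under $\mathbb{P}_x$, $B=(B_t)_{t\ge0}$ is a standard two-dimensional Brownian motion started at $x$ and $\xi$ is an independent exponential random variable of parameter $1$. The killing time is $\tau(\Delta)=\inf\{t\ge0:\int_0^t\mathbf{k}(B_s)\,ds\ge\xi\}$ (the killed Brownian motion, KBM, is $B$ sent to a cemetery state $\Delta$ at time $\tau(\Delta)$). For $A\subset\mathbb{R}^2$, $\tau(A)=\inf\{t\ge0:B_t\in A\}$ and $A^c=\mathbb{R}^2\setminus A$. An exhaustion of $\mathbb{R}^2$ is an increasing sequence $(\Lambda_R)_{R\in\mathbb{N}}$ of strict bounded subsets of $\mathbb{R}^2$ such that for every $r>0$ there is $R\in\mathbb{N}$ with $B(r)\subset\Lambda_R$, where $B(r)$ is the Euclidean ball of radius $r$ centred at $0$. The phrase "the KBM conditioned to survive does not make sense" is given its precise meaning by the "more precisely" part of the statement. *)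

theory Defs
  imports "HOL-Probability.Probability"
begin

section \<open>Brownian motion killed at a space-dependent rate\<close>

text \<open>
  The process is indexed by all reals, but only its values at times \<open>t \<ge> 0\<close> are constrained or
  used.  Paths are continuous everywhere; the starting point is prescribed almost surely, so that
  a single process on a single sample space can be a Brownian motion from \<open>x\<close> under \<open>P x\<close> for
  every \<open>x\<close> at once.  The increment over \<open>[s, t]\<close> is \<open>N(0, (t - s) I)\<close>; its density is a product
  over the standard basis, and \<open>normal_density\<close> takes the standard deviation as its argument.
\<close>

locale brownian_motion = prob_space M
  for M :: "'w measure" +
  fixes B :: "real \<Rightarrow> 'w \<Rightarrow> 'b :: euclidean_space"
    and x :: 'b
  assumes measurable_position: "\<And>t. 0 \<le> t \<Longrightarrow> random_variable borel (B t)"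
    and start: "AE \<omega> in M. B 0 \<omega> = x"
    and continuous_paths: "\<And>\<omega>. \<omega> \<in> space M \<Longrightarrow> continuous_on {0..} (\<lambda>t. B t \<omega>)"
    and gaussian_increments:
      "\<And>s t. 0 \<le> s \<Longrightarrow> s < t \<Longrightarrow>
         distributed M lborel (\<lambda>\<omega>. B t \<omega> - B s \<omega>)
           (\<lambda>z. ennreal (\<Prod>b\<in>Basis. normal_density 0 (sqrt (t - s)) (z \<bullet> b)))"
    and independent_increments:
      "\<And>(n :: nat) (t :: nat \<Rightarrow> real). 0 \<le> t 0 \<Longrightarrow> mono t \<Longrightarrow>
         indep_vars (\<lambda>_. borel) (\<lambda>i \<omega>. B (t (Suc i)) \<omega> - B (t i) \<omega>) {..<n}"

text \<open>
  \<open>\<xi>\<close> is independent of the whole path, viewed as a random element of the product space over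
  the time set \<open>{0..}\<close>; \<^const>\<open>prob_space.indep_var\<close> would need both to have the same value type.
\<close>

locale brownian_motion_with_clock = brownian_motion M B x
  for M :: "'w measure" and B :: "real \<Rightarrow> 'w \<Rightarrow> 'b :: euclidean_space" and x :: 'b +
  fixes \<xi> :: "'w \<Rightarrow> real"
  assumes exponential_clock: "distributed M lborel \<xi> (exponential_density 1)"
    and clock_independent:
      "indep_set
         (sets (vimage_algebra (space M) (\<lambda>\<omega>. \<lambda>t\<in>{0..}. B t \<omega>) (\<Pi>\<^sub>M t\<in>{0..}. borel)))
         (sets (vimage_algebra (space M) \<xi> borel))"

text \<open>Infima of times are taken in \<^typ>\<open>ereal\<close>, where the infimum of the empty set is \<open>\<infinity>\<close>.\<close>

definition hitting_time :: "(real \<Rightarrow> 'w \<Rightarrow> 'b) \<Rightarrow> 'b set \<Rightarrow> 'w \<Rightarrow> ereal"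
  where "hitting_time B A \<omega> = Inf (ereal ` {t. 0 \<le> t \<and> B t \<omega> \<in> A})"

definition killing_time ::
    "('b \<Rightarrow> real) \<Rightarrow> (real \<Rightarrow> 'w \<Rightarrow> 'b) \<Rightarrow> ('w \<Rightarrow> real) \<Rightarrow> 'w \<Rightarrow> ereal"
  where "killing_time k B \<xi> \<omega> =
    Inf (ereal ` {t. 0 \<le> t \<and> (LINT s:{0..t}|lborel. k (B s \<omega>)) \<ge> \<xi> \<omega>})"

definition exit_before_killing ::
    "'w measure \<Rightarrow> ('b \<Rightarrow> real) \<Rightarrow> (real \<Rightarrow> 'w \<Rightarrow> 'b) \<Rightarrow> ('w \<Rightarrow> real) \<Rightarrow> 'b set \<Rightarrow> 'w set"
  where "exit_before_killing M k B \<xi> \<Lambda> =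
    {\<omega> \<in> space M. hitting_time B (- \<Lambda>) \<omega> < killing_time k B \<xi> \<omega>}"

text \<open>The value at the origin is explicit because \<open>1 / 0 = 0\<close> in HOL.\<close>

definition polynomial_killing_rate :: "real \<Rightarrow> 'b :: real_normed_vector \<Rightarrow> real"
  where "polynomial_killing_rate \<alpha> x = (if x = 0 then 1 else min 1 (1 / norm x powr \<alpha>))"

definition exhaustion :: "(nat \<Rightarrow> 'b :: real_normed_vector set) \<Rightarrow> bool"
  where "exhaustion \<Lambda> \<longleftrightarrow>
    incseq \<Lambda> \<and> (\<forall>R. bounded (\<Lambda> R) \<and> \<Lambda> R \<subset> UNIV) \<and> (\<forall>r>0. \<exists>R. ball 0 r \<subseteq> \<Lambda> R)"

text \<open>
  An exhaustion may consist of arbitrary sets, and \<^const>\<open>measure\<close> is \<open>0\<close> on non-measurable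
  sets, so whenever probabilities of exit events are used the events have to be required to be
  measurable.  They then contain, up to a null set, the event of leaving a large ball before being
  killed, hence have positive probability when the rate is bounded, and the quotients
  below never have denominator \<open>0\<close>.
\<close>

definition exits_measurable ::
    "'w measure \<Rightarrow> ('b \<Rightarrow> real) \<Rightarrow> (real \<Rightarrow> 'w \<Rightarrow> 'b) \<Rightarrow> ('w \<Rightarrow> real) \<Rightarrow> (nat \<Rightarrow> 'b set) \<Rightarrow> bool"
  where "exits_measurable M k B \<xi> \<Lambda> \<longleftrightarrow> (\<forall>R. exit_before_killing M k B \<xi> (\<Lambda> R) \<in> sets M)"

definition exit_ratio ::
    "('b \<Rightarrow> 'w measure) \<Rightarrow> ('b \<Rightarrow> real) \<Rightarrow> (real \<Rightarrow> 'w \<Rightarrow> 'b) \<Rightarrow> ('w \<Rightarrow> real) \<Rightarrow>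
      (nat \<Rightarrow> 'b set) \<Rightarrow> 'b \<Rightarrow> 'b \<Rightarrow> nat \<Rightarrow> real"
  where "exit_ratio P k B \<xi> \<Lambda> x y R =
    measure (P x) (exit_before_killing (P x) k B \<xi> (\<Lambda> R)) /
    measure (P y) (exit_before_killing (P y) k B \<xi> (\<Lambda> R))"

end

theory Submission
  imports Defs
begin

text \<open>
  A function \<open>G\<close> with \<open>\<Delta>G / 2 = k G\<close>, \<open>G > 0\<close> and bounded sublevel sets determines the exit
  probabilities of its own sublevel sets: \<open>G (B t) exp (- \<integral> k)\<close> is a martingale, so \<open>{G < c}\<close> is left
  before killing with probability \<open>G x / c\<close> exactly.  Along the exhaustion by sublevel sets the
  ratio is therefore eventually constant, equal to \<open>G x / G y\<close>, and it suffices to find two such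
  functions that are not proportional.  Let \<open>h r\<close> be the radial solution and \<open>h1 r cos \<theta>\<close> the solution
  in the first angular mode.  For \<open>\<alpha> < 2\<close> the quotient \<open>h1 / h\<close> is bounded (for \<open>\<alpha> \<ge> 2\<close> it is not),
  so that \<open>h\<close> and \<open>h + \<epsilon> h1 cos \<theta>\<close> are both positive and tend to infinity.
  In the variable \<open>s = r\<^sup>2\<close>, with \<open>h r = H s\<close> and \<open>h1 r = r P s\<close>, both solve
  \<open>(n + 1) f' + s f'' = \<kappa> f / 2\<close>, with \<open>n = 0\<close> for \<open>H\<close> and \<open>n = 1\<close> for \<open>P\<close>.
  The martingale argument is carried out for the walk \<open>B (i / n)\<close>, with \<open>n\<close> tending to infinity,
  so no stochastic calculus is needed.
\<close>

section \<open>Radial solutions\<close>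

text \<open>Let \<open>D\<close> and \<open>x\<close> be the derivatives of log (h1 / h) and of log
  h with respect to log r. The two equations combine to the Riccati equation t D' = 1/2 - D^2 / 2 -
  D x in t = r^2. For r >= 1 the damping \<open>x\<close> is at least a multiple of r^(1 -
  \<alpha>/2), which presses \<open>D\<close> down to order 1 / x, and 1 / x is integrable against
  dr / r because \<alpha> < 2. In s = r^2 the candidates are functions of the polynomial |z|^2, so
  smoothness at the origin reduces to one-sided smoothness at s = 0; there the rate is constant.
  Discretising creates three errors. The walk overshoots its level, so G is cut off at c + d. The
  o(h) errors of single steps add up over many steps, and the positive lower bound of k on a compact
  sublevel set pays for them. The grid sees hitting and clock only approximately, so the exit event
  is enclosed between a limsup and a liminf of grid events, with slack in the clock or in the level.
  All slacks are removed only at the end.\<close>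

context
  fixes n :: nat and \<kappa> :: "real \<Rightarrow> real"
  assumes \<kappa>_cont: "continuous_on UNIV \<kappa>"
    and \<kappa>_nonneg: "\<And>s. 0 \<le> \<kappa> s"
    and \<kappa>_le_1: "\<And>s. \<kappa> s \<le> 1"
    and \<kappa>_eq_1: "\<And>s. s \<le> 1 \<Longrightarrow> \<kappa> s = 1"
begin

text \<open>The equation says (s^(n+1) f')' = s^n \<kappa> f / 2. Integrating from 0 and
  substituting t = s u turns the quotient singular at 0 into this average, which is continuous
  there; for a solution it equals 2 f'.\<close>

definition radial_avg :: "(real \<Rightarrow> real) \<Rightarrow> real \<Rightarrow> real"
  where "radial_avg f s = integral {0..1} (\<lambda>u. u ^ n * \<kappa> (s * u) * f (s * u))"

lemma radial_avg_integrable: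
  assumes "continuous_on UNIV f"
  shows "(\<lambda>u. u ^ n * \<kappa> (s * u) * f (s * u)) integrable_on {0..1}"
  by (intro integrable_continuous_real continuous_intros
      continuous_on_compose2[OF \<kappa>_cont] continuous_on_compose2[OF assms]) auto

lemma continuous_radial_avg:
  assumes "continuous_on UNIV f"
  shows "continuous_on UNIV (radial_avg f)"
proof -
  have "continuous_on (UNIV \<times> cbox 0 1) (\<lambda>(s, u). u ^ n * \<kappa> (s * u) * f (s * u))"
    unfolding split_beta
    by (intro continuous_intros continuous_on_compose2[OF \<kappa>_cont] continuous_on_compose2[OF assms]) auto
  from integral_continuous_on_param[OF this] show ?thesis
    by (simp add: radial_avg_def[abs_def])
qed

lemma radial_avg_nonneg:
  assumes "continuous_on UNIV f" "\<And>s. 0 \<le> f s"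
  shows "0 \<le> radial_avg f s"
  unfolding radial_avg_def
  by (rule integral_nonneg[OF radial_avg_integrable[OF assms(1)]]) (auto simp: assms \<kappa>_nonneg)

lemma radial_avg_bound:
  assumes f: "continuous_on UNIV f" and b: "\<And>u. 0 \<le> u \<Longrightarrow> u \<le> s \<Longrightarrow> \<bar>f u\<bar> \<le> b" and s: "0 \<le> s"
  shows "\<bar>radial_avg f s\<bar> \<le> b"
proof -
  have "norm (radial_avg f s) \<le> integral {0..1} (\<lambda>u::real. b)"
    unfolding radial_avg_def
  proof (rule Henstock_Kurzweil_Integration.integral_norm_bound_integral)
    show "(\<lambda>u. u ^ n * \<kappa> (s * u) * f (s * u)) integrable_on {0..1}" by (rule radial_avg_integrable[OF f])
    fix u :: real assume u: "u \<in> {0..1}"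
    have su: "0 \<le> s * u" "s * u \<le> s" using u s by (auto simp: mult_left_le)
    have "u ^ n * \<kappa> (s * u) * \<bar>f (s * u)\<bar> \<le> 1 * 1 * b"
      using b[OF su] u \<kappa>_nonneg \<kappa>_le_1 by (intro mult_mono power_le_one mult_nonneg_nonneg) auto
    then show "norm (u ^ n * \<kappa> (s * u) * f (s * u)) \<le> b"
      using u \<kappa>_nonneg by (simp add: abs_mult)
  qed auto
  then show ?thesis by simp
qed

lemma radial_avg_diff:
  assumes "continuous_on UNIV f" "continuous_on UNIV g"
  shows "radial_avg f s - radial_avg g s = radial_avg (\<lambda>s. f s - g s) s"
  using integral_diff[OF radial_avg_integrable[OF assms(1)] radial_avg_integrable[OF assms(2)]]
  by (simp add: radial_avg_def right_diff_distrib)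

text \<open>The integrated equation with f 0 = 1. Cutting at \<open>max 0 s\<close> continues it as
  a constant to negative arguments, so that it acts on functions on the whole line.\<close>

definition volterra :: "(real \<Rightarrow> real) \<Rightarrow> real \<Rightarrow> real"
  where "volterra f s = 1 + integral {0..max 0 s} (radial_avg f) / 2"

lemma continuous_volterra:
  assumes "continuous_on UNIV f"
  shows "continuous_on UNIV (volterra f)"
proof -
  note c = continuous_radial_avg[OF assms]
  have "continuous_on {0..} (\<lambda>s. integral {0..s} (radial_avg f))"
    unfolding continuous_on_eq_continuous_within
    proof
      fix s :: real assume "s \<in> {0..}"
      then have s: "0 \<le> s" by simp
      have "continuous_on {0..s+1} (\<lambda>s. integral {0..s} (radial_avg f))"
        by (intro indefinite_integral_continuous_1 integrable_continuous_real continuous_on_subset[OF c]) auto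
      then have "continuous (at s within {0..s+1}) (\<lambda>s. integral {0..s} (radial_avg f))"
        using s by (auto simp: continuous_on_eq_continuous_within)
      moreover have "at s within {0..s+1} = at s within {0..}"
        by (rule at_within_nhd[of _ "{..<s+1}"]) auto
      ultimately show "continuous (at s within {0..}) (\<lambda>s. integral {0..s} (radial_avg f))" by simp
    qed
  then have "continuous_on UNIV (\<lambda>s. integral {0..max 0 s} (radial_avg f))"
    by (rule continuous_on_compose2[where f = "\<lambda>s. max 0 s"]) (auto intro!: continuous_intros)
  then show ?thesis
    unfolding volterra_def[abs_def] by (intro continuous_intros) auto
qed

text \<open>Averages over [0, s] of a function below b exp stay below b exp since exp increases, and
  exp is its own primitive. So integration costs no constant, and the 1/2 in \<open>volterra\<close>
  becomes the contraction factor.\<close>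

lemma volterra_bound:
  assumes f: "continuous_on UNIV f" and b: "\<And>u. 0 \<le> u \<Longrightarrow> \<bar>f u\<bar> \<le> b * exp u" and s: "0 \<le> s"
  shows "\<bar>integral {0..s} (radial_avg f)\<bar> \<le> b * exp s"
proof -
  have b0: "0 \<le> b" using b[of 0] by simp
  have i: "(exp has_integral exp s - exp 0) {0..s}"
    by (rule fundamental_theorem_of_calculus)
       (use s in \<open>auto intro!: derivative_eq_intros simp: has_real_derivative_iff_has_vector_derivative[symmetric]\<close>)
  have ib: "((\<lambda>u. b * exp u) has_integral b * (exp s - exp 0)) {0..s}"
    by (rule has_integral_mult_right[OF i])
  have "norm (integral {0..s} (radial_avg f)) \<le> integral {0..s} (\<lambda>u. b * exp u)"
  proof (rule Henstock_Kurzweil_Integration.integral_norm_bound_integral)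
    show "radial_avg f integrable_on {0..s}"
      by (intro integrable_continuous_real continuous_on_subset[OF continuous_radial_avg[OF f]]) auto
    show "(\<lambda>u. b * exp u) integrable_on {0..s}" using ib by blast
    fix u assume u: "u \<in> {0..s}"
    have "\<bar>radial_avg f u\<bar> \<le> b * exp u"
    proof (rule radial_avg_bound[OF f])
      fix v assume v: "0 \<le> v" "v \<le> u"
      have "\<bar>f v\<bar> \<le> b * exp v" using b v by simp
      also have "\<dots> \<le> b * exp u" using b0 v by (intro mult_left_mono) auto
      finally show "\<bar>f v\<bar> \<le> b * exp u" .
    qed (use u in auto)
    then show "norm (radial_avg f u) \<le> b * exp u" by simp
  qed
  also have "\<dots> = b * (exp s - exp 0)" using ib by (rule integral_unique)
  also have "\<dots> \<le> b * exp s" using b0 by (intro mult_left_mono) auto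
  finally show ?thesis by simp
qed

text \<open>In the sup norm weighted by \<open>exp\<close> the Volterra operator is a contraction.\<close>

lemma volterra_fixed_point:
  obtains f where "continuous_on UNIV f" "\<And>s. 0 \<le> f s" "\<And>s. 0 \<le> s \<Longrightarrow> f s = volterra f s"
proof -
  define w where "w = (\<lambda>s::real. exp (max 0 s))"
  have w_cont: "continuous_on UNIV w" unfolding w_def by (intro continuous_intros)
  have w_pos: "0 < w s" for s by (simp add: w_def)
  \<comment> \<open>\<open>lift\<close> identifies bounded continuous functions with functions of
    growth at most \<open>w\<close>; \<open>T\<close> below is \<open>volterra\<close> transported
    along it.\<close>
  define lift where "lift = (\<lambda>\<phi> :: real \<Rightarrow>\<^sub>C real. \<lambda>s. w s * apply_bcontfun \<phi> s)"
  have lift_cont: "continuous_on UNIV (lift \<phi>)" for \<phi>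
    unfolding lift_def by (intro continuous_intros w_cont continuous_on_apply_bcontfun)
  have nb: "\<bar>apply_bcontfun \<phi> u\<bar> \<le> norm \<phi>" for \<phi> :: "real \<Rightarrow>\<^sub>C real" and u using norm_bounded[of \<phi> u] by simp
  define T where "T = (\<lambda>\<phi>. Bcontfun (\<lambda>s. volterra (lift \<phi>) s / w s))"
  have T_in: "(\<lambda>s. volterra (lift \<phi>) s / w s) \<in> bcontfun" for \<phi>
  proof (rule bcontfun_normI)
    show "continuous_on UNIV (\<lambda>s. volterra (lift \<phi>) s / w s)"
      using w_pos by (intro continuous_intros w_cont continuous_volterra lift_cont) (metis less_irrefl)
    fix s
    have "\<bar>integral {0..max 0 s} (radial_avg (lift \<phi>))\<bar> \<le> norm \<phi> * exp (max 0 s)"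
      by (rule volterra_bound[OF lift_cont]) (auto simp: lift_def w_def abs_mult nb mult.commute)
    then have "\<bar>volterra (lift \<phi>) s\<bar> \<le> 1 + norm \<phi> * w s / 2"
      unfolding volterra_def w_def by linarith
    also have "\<dots> \<le> (1 + norm \<phi>) * w s"
    proof -
      have "1 \<le> w s" by (simp add: w_def)
      then show ?thesis by (simp add: algebra_simps add_mono)
    qed
    finally show "norm (volterra (lift \<phi>) s / w s) \<le> 1 + norm \<phi>"
      using w_pos[of s] by (simp add: pos_divide_le_eq)
  qed
  have T_apply: "apply_bcontfun (T \<phi>) s = volterra (lift \<phi>) s / w s" for \<phi> s
    unfolding T_def by (simp add: Bcontfun_inverse[OF T_in])
  \<comment> \<open>Working in the closed set of nonnegative functions yields a nonnegative fixed
    point directly.\<close>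
  define S where "S = PiC (UNIV::real set) (\<lambda>_. {0::real..})"
  have "\<exists>!\<phi>\<in>S. T \<phi> = \<phi>"
  proof (rule Banach_fix[where c = "1/2"])
    show "Topological_Spaces.complete S" unfolding S_def by (simp add: complete_eq_closed closed_PiC)
    have "0 \<in> S" by (auto simp: S_def mem_PiC_iff)
    then show "S \<noteq> {}" by auto
    show "T ` S \<subseteq> S"
    proof
      fix \<psi> assume "\<psi> \<in> T ` S"
      then obtain \<phi> where \<phi>: "\<phi> \<in> S" "\<psi> = T \<phi>" by auto
      have p: "0 \<le> lift \<phi> s" for s using \<phi> w_pos[of s] by (auto simp: S_def mem_PiC_iff lift_def Pi_iff)
      have "0 \<le> volterra (lift \<phi>) s" for s
        unfolding volterra_def
        by (intro add_nonneg_nonneg divide_nonneg_nonneg integral_nonneg integrable_continuous_real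
            continuous_on_subset[OF continuous_radial_avg[OF lift_cont]] radial_avg_nonneg lift_cont p) auto
      then show "\<psi> \<in> S" using w_pos by (auto simp: S_def mem_PiC_iff \<phi>(2) T_apply Pi_iff less_imp_le)
    qed
    fix \<phi> \<psi> assume "\<phi> \<in> S" "\<psi> \<in> S"
    show "dist (T \<phi>) (T \<psi>) \<le> 1/2 * dist \<phi> \<psi>"
    proof (rule dist_bound)
      fix s
      have "integral {0..max 0 s} (radial_avg (lift \<phi>)) - integral {0..max 0 s} (radial_avg (lift \<psi>))
          = integral {0..max 0 s} (radial_avg (\<lambda>s. lift \<phi> s - lift \<psi> s))"
        by (subst integral_diff[symmetric])
           (auto simp: radial_avg_diff lift_cont
             intro!: integrable_continuous_real continuous_on_subset[OF continuous_radial_avg[OF lift_cont]])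
      moreover have "\<bar>integral {0..max 0 s} (radial_avg (\<lambda>s. lift \<phi> s - lift \<psi> s))\<bar> \<le> dist \<phi> \<psi> * exp (max 0 s)"
      proof (rule volterra_bound)
        show "continuous_on UNIV (\<lambda>s. lift \<phi> s - lift \<psi> s)" by (intro continuous_intros lift_cont)
        fix u :: real assume "0 \<le> u"
        then show "\<bar>lift \<phi> u - lift \<psi> u\<bar> \<le> dist \<phi> \<psi> * exp u"
          using dist_bounded[of \<phi> u \<psi>]
          by (simp add: lift_def w_def right_diff_distrib[symmetric] abs_mult dist_real_def mult.commute)
      qed simp
      ultimately have "\<bar>volterra (lift \<phi>) s - volterra (lift \<psi>) s\<bar> \<le> 1/2 * dist \<phi> \<psi> * w s"
        unfolding volterra_def w_def by (simp add: field_simps)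
      then show "dist (apply_bcontfun (T \<phi>) s) (apply_bcontfun (T \<psi>) s) \<le> 1/2 * dist \<phi> \<psi>"
        using w_pos[of s] by (simp add: T_apply dist_real_def diff_divide_distrib[symmetric] pos_divide_le_eq)
    qed
  qed auto
  then obtain \<phi> where \<phi>: "\<phi> \<in> S" "T \<phi> = \<phi>" by auto
  show thesis
  proof
    show "continuous_on UNIV (lift \<phi>)" by (rule lift_cont)
    show "0 \<le> lift \<phi> s" for s using \<phi> w_pos[of s] by (auto simp: S_def mem_PiC_iff lift_def Pi_iff)
    show "lift \<phi> s = volterra (lift \<phi>) s" for s
      using T_apply[of \<phi> s] \<phi>(2) w_pos[of s] by (simp add: lift_def field_simps)
  qed
qed

lemma radial_avg_eq:
  assumes f: "continuous_on UNIV f" and s: "0 < s"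
  shows "radial_avg f s = integral {0..s} (\<lambda>t. t ^ n * \<kappa> t * f t) / s ^ Suc n"
proof -
  have "(\<lambda>t. t ^ n * \<kappa> t * f t) integrable_on {0..s}"
    by (intro integrable_continuous_real continuous_intros
      continuous_on_subset[OF \<kappa>_cont] continuous_on_subset[OF f]) auto
  then have "((\<lambda>t. t ^ n * \<kappa> t * f t) has_integral integral {0..s} (\<lambda>t. t ^ n * \<kappa> t * f t)) (cbox 0 s)"
    by (simp add: has_integral_integral)
  from has_integral_affinity'[OF this s, of 0]
  have "((\<lambda>u. s ^ n * (u ^ n * \<kappa> (s * u) * f (s * u))) has_integral
      integral {0..s} (\<lambda>t. t ^ n * \<kappa> t * f t) / s) {0..1}"
    using s by (simp add: power_mult_distrib mult_ac divide_inverse)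
  then have "s ^ n * radial_avg f s = integral {0..s} (\<lambda>t. t ^ n * \<kappa> t * f t) / s"
    unfolding radial_avg_def by (simp add: integral_unique flip: integral_mult_right)
  then show ?thesis using s by (simp add: field_simps)
qed

lemma deriv_radial_avg:
  assumes f: "continuous_on UNIV f" and s: "0 < s"
  shows "(radial_avg f has_real_derivative (\<kappa> s * f s - real (Suc n) * radial_avg f s) / s) (at s)"
proof -
  define J where "J = (\<lambda>s. integral {0..s} (\<lambda>t. t ^ n * \<kappa> t * f t))"
  have "(J has_real_derivative s ^ n * \<kappa> s * f s) (at s within {0..s+1})"
    unfolding J_def using s
    by (intro integral_has_real_derivative continuous_intros
      continuous_on_subset[OF \<kappa>_cont] continuous_on_subset[OF f]) auto
  moreover have "at s within {0..s+1} = at s" using s by (intro at_within_interior) auto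
  ultimately have J: "(J has_real_derivative s ^ n * \<kappa> s * f s) (at s)" by simp
  have "((\<lambda>s. J s / s ^ Suc n) has_real_derivative
      (s ^ n * \<kappa> s * f s * s ^ Suc n - J s * (real (Suc n) * s ^ n)) / (s ^ Suc n * s ^ Suc n)) (at s)"
    by (rule derivative_eq_intros J refl)+ (use s in auto)
  moreover have "(s ^ n * \<kappa> s * f s * s ^ Suc n - J s * (real (Suc n) * s ^ n)) / (s ^ Suc n * s ^ Suc n)
     = (\<kappa> s * f s - real (Suc n) * radial_avg f s) / s"
    using s by (simp add: radial_avg_eq[OF f s] J_def field_simps)
  ultimately have "((\<lambda>s. J s / s ^ Suc n) has_real_derivative (\<kappa> s * f s - real (Suc n) * radial_avg f s) / s) (at s)"
    by simp
  then show ?thesis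
    by (rule has_field_derivative_transform_within_open[of _ _ _ "{0<..}"])
       (use s in \<open>auto simp: radial_avg_eq[OF f] J_def\<close>)
qed

lemma at_within_atLeast: "0 \<le> s \<Longrightarrow> s < b \<Longrightarrow> at s within {0..b} = at s within {0::real..}"
  by (rule at_within_nhd[of _ "{..<b}"]) auto

text \<open>Away from 0 the equation can be solved for the second derivative, but at 0 this gives 0
  / 0. Near 0 the constancy of \<kappa> helps: the average can be differentiated under the integral
  sign without differentiating \<kappa>.\<close>

lemma radial_solution:
  obtains f f1 f2 :: "real \<Rightarrow> real" where
    "f 0 = 1" "\<And>s. 0 \<le> s \<Longrightarrow> 1 \<le> f s" "\<And>s. 0 \<le> s \<Longrightarrow> 0 \<le> f1 s"
    "\<And>s. 0 \<le> s \<Longrightarrow> (f has_real_derivative f1 s) (at s within {0..})"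
    "\<And>s. 0 \<le> s \<Longrightarrow> (f1 has_real_derivative f2 s) (at s within {0..})"
    "continuous_on {0..} f2"
    "\<And>s. 0 \<le> s \<Longrightarrow> real (Suc n) * f1 s + s * f2 s = \<kappa> s * f s / 2"
proof -
  obtain f where f: "continuous_on UNIV f" "\<And>s. 0 \<le> f s" "\<And>s. 0 \<le> s \<Longrightarrow> f s = volterra f s"
    using volterra_fixed_point by blast
  define f1 where "f1 = (\<lambda>s. radial_avg f s / 2)"
  have f1_cont: "continuous_on UNIV f1"
    unfolding f1_def by (intro continuous_intros continuous_radial_avg f) auto
  have f1_nonneg: "0 \<le> f1 s" for s unfolding f1_def using radial_avg_nonneg[OF f(1,2)] by simp
  have f_ge: "1 \<le> f s" if "0 \<le> s" for s
    unfolding f(3)[OF that] volterra_def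
    by (auto intro!: integral_nonneg integrable_continuous_real continuous_on_subset[OF continuous_radial_avg[OF f(1)]]
       radial_avg_nonneg[OF f(1,2)])
  have f_deriv: "(f has_real_derivative f1 s) (at s within {0..})" if s: "0 \<le> s" for s
  proof -
    have "((\<lambda>s. integral {0..s} (radial_avg f)) has_real_derivative radial_avg f s) (at s within {0..s+1})"
      using s by (intro integral_has_real_derivative continuous_on_subset[OF continuous_radial_avg[OF f(1)]]) auto
    then have "((\<lambda>s. integral {0..s} (radial_avg f)) has_real_derivative radial_avg f s) (at s within {0..})"
      using at_within_atLeast[of s "s+1"] s by simp
    then have "((\<lambda>s. 1 + integral {0..s} (radial_avg f) / 2) has_real_derivative f1 s) (at s within {0..})"
      unfolding f1_def by (auto intro!: derivative_eq_intros)
    then show ?thesis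
      by (rule has_field_derivative_transform_within[where d = 1])
         (use s f(3) in \<open>auto simp: volterra_def\<close>)
  qed
  \<comment> \<open>On [0, 1], where \<kappa> = 1, \<open>R\<close> is the derivative of the average
    of f, hence \<open>R s / 2\<close> that of \<open>f1\<close>.\<close>
  define R where "R = (\<lambda>s. integral {0..1} (\<lambda>u. u ^ Suc n * f1 (s * u)))"
  have R_cont: "continuous_on UNIV R"
  proof -
    have "continuous_on (UNIV \<times> cbox 0 1) (\<lambda>(s, u). u ^ Suc n * f1 (s * u))"
      unfolding split_beta by (intro continuous_intros continuous_on_compose2[OF f1_cont]) auto
    from integral_continuous_on_param[OF this] show ?thesis by (simp add: R_def[abs_def])
  qed
  have R_deriv: "(f1 has_real_derivative R s / 2) (at s within {0..1})" if s: "0 \<le> s" "s \<le> 1" for s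
  proof -
    have "((\<lambda>s. integral (cbox 0 1) (\<lambda>u. u ^ n * f (s * u))) has_real_derivative
        integral (cbox 0 1) (\<lambda>u. u ^ n * (f1 (s * u) * u))) (at s within {0..1})"
    proof (rule leibniz_rule_field_derivative)
      fix s u :: real assume s: "s \<in> {0..1}" and u: "u \<in> cbox 0 1"
      have "((\<lambda>s. s * u) has_real_derivative u) (at s within {0..1})"
        by (auto intro!: derivative_eq_intros)
      moreover have "(f has_real_derivative f1 (s * u)) (at (s * u) within (\<lambda>s. s * u) ` {0..1})"
        using s u by (intro DERIV_subset[OF f_deriv]) auto
      ultimately have "((\<lambda>s. f (s * u)) has_real_derivative f1 (s * u) * u) (at s within {0..1})"
        using DERIV_image_chain[of f "f1 (s * u)" "\<lambda>s. s * u" s "{0..1}" u] by (simp add: comp_def)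
      then show "((\<lambda>s. u ^ n * f (s * u)) has_real_derivative u ^ n * (f1 (s * u) * u)) (at s within {0..1})"
        by (rule DERIV_cmult)
    next
      show "(\<lambda>u. u ^ n * f (s * u)) integrable_on cbox 0 1" for s
        by (intro integrable_continuous continuous_intros continuous_on_compose2[OF f(1)]) auto
      show "continuous_on ({0..1} \<times> cbox 0 1) (\<lambda>(s, u). u ^ n * (f1 (s * u) * u))"
        unfolding split_beta by (intro continuous_intros continuous_on_compose2[OF f1_cont]) auto
    qed (use s in auto)
    then have "((\<lambda>s. integral {0..1} (\<lambda>u. u ^ n * f (s * u)) / 2) has_real_derivative R s / 2) (at s within {0..1})"
      by (auto intro!: derivative_eq_intros simp: R_def mult_ac)
    then show ?thesis
    proof (rule has_field_derivative_transform_within[where d = 1])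
      fix t :: real assume t: "t \<in> {0..1}"
      have "integral {0..1} (\<lambda>u. u ^ n * f (t * u)) = radial_avg f t"
        unfolding radial_avg_def
        by (rule Henstock_Kurzweil_Integration.integral_cong)
           (use t in \<open>auto simp: \<kappa>_eq_1 mult_le_one\<close>)
      then show "integral {0..1} (\<lambda>u. u ^ n * f (t * u)) / 2 = f1 t" by (simp add: f1_def)
    qed (use s in auto)
  qed
  define Q where "Q = (\<lambda>s. (\<kappa> s * f s / 2 - real (Suc n) * f1 s) / s)"
  have Q_deriv: "(f1 has_real_derivative Q s) (at s)" if "0 < s" for s
    using DERIV_cdivide[OF deriv_radial_avg[OF f(1) that], of 2] that
    unfolding f1_def[symmetric] by (simp add: Q_def f1_def field_simps)
  have RQ: "R s / 2 = Q s" if "0 < s" "s < 1" for s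
  proof -
    have "at s within {0..1} = at s" using that by (intro at_within_interior) auto
    then have "(f1 has_real_derivative R s / 2) (at s)" using R_deriv[of s] that by simp
    from DERIV_unique[OF this Q_deriv[OF that(1)]] show ?thesis .
  qed
  \<comment> \<open>The switching point 1/2 lies inside (0, 1), where both formulas are the
    derivative of \<open>f1\<close> and so agree; hence \<open>f2\<close> is continuous.\<close>
  define f2 where "f2 = (\<lambda>s. if s \<le> 1/2 then R s / 2 else Q s)"
  have f2_deriv: "(f1 has_real_derivative f2 s) (at s within {0..})" if s: "0 \<le> s" for s
  proof (cases "s \<le> 1/2")
    case True
    then have "at s within {0..1} = at s within {0..}" using s by (intro at_within_atLeast) auto
    then show ?thesis using R_deriv[of s] s True by (simp add: f2_def)
  next
    case False
    then have "(f1 has_real_derivative f2 s) (at s)" using Q_deriv[of s] by (simp add: f2_def)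
    then show ?thesis by (rule has_field_derivative_at_within)
  qed
  have f2_cont: "continuous_on {0..} f2"
  proof -
    have "continuous_on ({0..1/2} \<union> {1/2..}) f2"
      unfolding f2_def
    proof (rule continuous_on_If)
      show "continuous_on {0..1/2} (\<lambda>s. R s / 2)"
        by (intro continuous_intros continuous_on_subset[OF R_cont]) auto
      show "continuous_on {1/2..} Q"
        unfolding Q_def
        by (intro continuous_intros continuous_on_subset[OF \<kappa>_cont] continuous_on_subset[OF f(1)]
          continuous_on_subset[OF f1_cont]) auto
    next
      fix s :: real assume "s \<in> {1/2..}" "s \<le> 1/2"
      then show "R s / 2 = Q s" by (intro RQ) auto
    qed auto
    moreover have "{0..1/2} \<union> {1/2..} = {0::real..}" by auto
    ultimately show ?thesis by simp
  qed
  have ode: "real (Suc n) * f1 s + s * f2 s = \<kappa> s * f s / 2" if s: "0 \<le> s" for s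
  proof (cases "s = 0")
    case True
    have "integral {0..1} (\<lambda>u::real. u ^ n) = 1 / real (Suc n)"
    proof -
      have "((\<lambda>u::real. u ^ n) has_integral 1 ^ Suc n / real (Suc n) - 0 ^ Suc n / real (Suc n)) {0..1}"
        by (rule fundamental_theorem_of_calculus)
           (auto intro!: derivative_eq_intros simp: has_real_derivative_iff_has_vector_derivative[symmetric]
             simp del: power_Suc of_nat_Suc)
      then show ?thesis by (simp add: integral_unique)
    qed
    then have "radial_avg f 0 = \<kappa> 0 * f 0 / real (Suc n)"
      unfolding radial_avg_def by (simp add: mult.assoc)
    then show ?thesis using True by (simp add: f1_def del: of_nat_Suc)
  next
    case False
    then have "s * f2 s = s * Q s" using RQ[of s] s by (auto simp: f2_def)
    then show ?thesis using False by (simp add: Q_def)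
  qed
  have f0: "f 0 = 1" using f(3)[of 0] by (simp add: volterra_def)
  show thesis by (rule that[OF f0 f_ge f1_nonneg f_deriv f2_deriv f2_cont ode])
qed

end

section \<open>The two radial solutions are comparable\<close>

text \<open>The equation reads (s H')' = \<kappa> H / 2. The right side is at least 1/2 on [0, 1]
  and nonnegative beyond, so s H' stays above 1/2 and integration gives the logarithm, which later
  bounds the sublevel sets.\<close>

lemma radial_growth:
  fixes H H1 H2 \<kappa> :: "real \<Rightarrow> real"
  assumes \<kappa>: "\<And>s. 0 \<le> \<kappa> s" "\<And>s. s \<le> 1 \<Longrightarrow> \<kappa> s = 1"
    and H: "\<And>s. 0 \<le> s \<Longrightarrow> 1 \<le> H s"
      "\<And>s. 0 \<le> s \<Longrightarrow> (H has_real_derivative H1 s) (at s within {0..})"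
      "\<And>s. 0 \<le> s \<Longrightarrow> (H1 has_real_derivative H2 s) (at s within {0..})"
      "\<And>s. 0 \<le> s \<Longrightarrow> H1 s + s * H2 s = \<kappa> s * H s / 2"
    and s: "1 \<le> s"
  shows "1/2 \<le> s * H1 s" "1 + ln s / 2 \<le> H s"
proof -
  have at_pos: "at s within {0..} = at s" if "0 < s" for s :: real
    using that by (intro at_within_interior) auto
  have dH: "(H has_real_derivative H1 s) (at s)" and dH1: "(H1 has_real_derivative H2 s) (at s)" if "0 < s" for s
    using H(2,3)[of s] at_pos[OF that] that by auto
  have cont: "continuous_on {0..} H" "continuous_on {0..} H1"
    using H(2,3) by (auto intro!: DERIV_continuous_on)
  have dsH1: "((\<lambda>s. s * H1 s) has_real_derivative \<kappa> s * H s / 2) (at s)" if "0 < s" for s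
    using DERIV_mult[OF DERIV_ident dH1[OF that]] H(4)[of s] that by (simp add: mult.commute)
  have H1_1: "0 * H1 0 - 0 / 2 \<le> 1 * H1 1 - 1 / 2"
  proof (rule DERIV_nonneg_imp_increasing_open[where f = "\<lambda>s. s * H1 s - s / 2"])
    fix t :: real assume t: "0 < t" "t < 1"
    have "((\<lambda>s. s * H1 s - s / 2) has_real_derivative \<kappa> t * H t / 2 - 1 / 2) (at t)"
      by (rule DERIV_diff[OF dsH1[OF t(1)] DERIV_cdivide[OF DERIV_ident]])
    moreover have "0 \<le> \<kappa> t * H t / 2 - 1 / 2" using H(1)[of t] \<kappa>(2)[of t] t by simp
    ultimately show "\<exists>y. ((\<lambda>s. s * H1 s - s / 2) has_real_derivative y) (at t) \<and> 0 \<le> y" by blast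
  qed (auto intro!: continuous_intros continuous_on_subset[OF cont(2)])
  have mono: "1/2 \<le> s * H1 s" if s: "1 \<le> s" for s
  proof -
    have "1 * H1 1 \<le> s * H1 s"
    proof (rule DERIV_nonneg_imp_increasing_open[where f = "\<lambda>s. s * H1 s", OF s])
      fix t :: real assume "1 < t" "t < s"
      then have t: "0 < t" by simp
      moreover have "0 \<le> \<kappa> t * H t / 2" using \<kappa>(1)[of t] H(1)[of t] t by simp
      ultimately show "\<exists>y. ((\<lambda>s. s * H1 s) has_real_derivative y) (at t) \<and> 0 \<le> y"
        using dsH1 by blast
    qed (auto intro!: continuous_intros continuous_on_subset[OF cont(2)])
    then show ?thesis using H1_1 by simp
  qed
  then show "1/2 \<le> s * H1 s" using s .
  have "H 1 - ln 1 / 2 \<le> H s - ln s / 2"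
  proof (rule DERIV_nonneg_imp_increasing_open[where f = "\<lambda>s. H s - ln s / 2", OF s])
    fix t :: real assume "1 < t" "t < s"
    then have t: "0 < t" "1 \<le> t" by auto
    have "((\<lambda>s. ln s) has_real_derivative 1 / t) (at t)" using t by (auto intro!: derivative_eq_intros simp: divide_inverse)
    from DERIV_diff[OF dH[OF t(1)] DERIV_cdivide[OF this, of 2]]
    have "((\<lambda>s. H s - ln s / 2) has_real_derivative H1 t - 1 / t / 2) (at t)" .
    moreover have "0 \<le> H1 t - 1 / t / 2" using mono[OF t(2)] t(1) by (simp add: field_simps)
    ultimately show "\<exists>y. ((\<lambda>s. H s - ln s / 2) has_real_derivative y) (at t) \<and> 0 \<le> y" by blast
  qed (auto intro!: continuous_intros continuous_on_subset[OF cont(1)])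
  then show "1 + ln s / 2 \<le> H s" using H(1)[of 1] by simp
qed

text \<open>A Lyapunov argument: \<open>N\<close> is log (h1 / h) plus nonnegative corrections and
  does not increase for s >= 1. Two facts feed it: log h grows at rate at least c E in log r
  (\<open>Y_nonneg\<close>), and h1 / h is nondecreasing (\<open>D_nonneg\<close>).\<close>

lemma radial_ratio_bounded:
  fixes H H1 H2 P P1 P2 \<kappa> :: "real \<Rightarrow> real"
  assumes \<alpha>: "0 < \<alpha>" "\<alpha> < 2"
    and \<kappa>_nonneg: "\<And>s. 0 \<le> \<kappa> s"
    and \<kappa>: "\<And>s. s \<le> 1 \<Longrightarrow> \<kappa> s = 1" "\<And>s. 1 \<le> s \<Longrightarrow> \<kappa> s = s powr (- \<alpha> / 2)"
    and H: "\<And>s. 0 \<le> s \<Longrightarrow> 1 \<le> H s"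
      "\<And>s. 0 \<le> s \<Longrightarrow> (H has_real_derivative H1 s) (at s within {0..})"
      "\<And>s. 0 \<le> s \<Longrightarrow> (H1 has_real_derivative H2 s) (at s within {0..})"
      "\<And>s. 0 \<le> s \<Longrightarrow> H1 s + s * H2 s = \<kappa> s * H s / 2"
    and P: "\<And>s. 0 \<le> s \<Longrightarrow> 1 \<le> P s" "\<And>s. 0 \<le> s \<Longrightarrow> 0 \<le> P1 s"
      "\<And>s. 0 \<le> s \<Longrightarrow> (P has_real_derivative P1 s) (at s within {0..})"
      "\<And>s. 0 \<le> s \<Longrightarrow> (P1 has_real_derivative P2 s) (at s within {0..})"
      "\<And>s. 0 \<le> s \<Longrightarrow> 2 * P1 s + s * P2 s = \<kappa> s * P s / 2"
  obtains C where "0 < C" "\<And>s. 0 \<le> s \<Longrightarrow> sqrt s * P s \<le> C * H s"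
proof -
  have at_pos: "at s within {0..} = at s" if "0 < s" for s :: real
    using that by (intro at_within_interior) auto
  have dH: "(H has_real_derivative H1 s) (at s)" and dH1: "(H1 has_real_derivative H2 s) (at s)"
    and dP: "(P has_real_derivative P1 s) (at s)" and dP1: "(P1 has_real_derivative P2 s) (at s)"
    if "0 < s" for s
    using H(2,3)[of s] P(3,4)[of s] at_pos[OF that] that by auto
  have cont: "continuous_on {0..} H" "continuous_on {0..} H1" "continuous_on {0..} P" "continuous_on {0..} P1"
    using H(2,3) P(3,4) by (auto intro!: DERIV_continuous_on)
  have Hpos: "0 < H s" and Ppos: "0 < P s" if "0 \<le> s" for s
    using H(1) P(1) that by (meson less_le_trans zero_less_one)+
  define \<beta> where "\<beta> = 1 - \<alpha> / 2"
  have \<beta>: "0 < \<beta>" "\<beta> < 1" using \<alpha> by (auto simp: \<beta>_def)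
  \<comment> \<open>For s >= 1 this is r sqrt k, the WKB prediction for the size of d log h / d log
    r.\<close>
  define E where "E = (\<lambda>s::real. s powr (\<beta> / 2))"
  have E_ge: "1 \<le> E s" if "1 \<le> s" for s using that \<beta> by (simp add: E_def ge_one_powr_ge_zero)
  have E_sq: "E s * E s = s * \<kappa> s" if "1 \<le> s" for s
  proof -
    have "s * \<kappa> s = s powr 1 * s powr (- \<alpha> / 2)" using \<kappa>(2)[OF that] that by simp
    also have "\<dots> = s powr (1 + - \<alpha> / 2)" by (rule powr_add[symmetric])
    also have "1 + - \<alpha> / 2 = \<beta> / 2 + \<beta> / 2" by (simp add: \<beta>_def)
    also have "s powr (\<beta> / 2 + \<beta> / 2) = E s * E s" unfolding E_def by (rule powr_add)
    finally show ?thesis by simp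
  qed
  have dE: "(E has_real_derivative \<beta> / 2 * E s / s) (at s)" if "0 < s" for s
    unfolding E_def using that by (auto intro!: derivative_eq_intros simp: powr_diff)

  have H1_pos: "1/2 \<le> H1 1"
    using radial_growth(1)[of \<kappa> H H1 H2 1] H \<kappa> \<kappa>_nonneg by simp

  \<comment> \<open>Two demands: Y 1 >= 0, where E 1 = 1, and c <= 1, so that 1 - c^2 / 2 >= 1/2 in
    the derivative estimate.\<close>
  define c where "c = min 1 (2 * H1 1 / H 1)"
  have c: "0 < c" "c \<le> 1" using H1_pos Hpos[of 1] by (auto simp: c_def)
  define Y where "Y = (\<lambda>s. 2 * s * H1 s - c * E s * H s)"
  have Y_nonneg: "0 \<le> Y s" if s1: "1 \<le> s" for s
  proof -
    \<comment> \<open>Integrating factor: t Y' + (c / 2) E Y is nonnegative, and (c / 2) E / t is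
      the derivative of (c / \<beta>) E.\<close>
    define g where "g = (\<lambda>s. Y s * exp (c / \<beta> * E s))"
    have "g 1 \<le> g s"
    proof (rule DERIV_nonneg_imp_increasing_open[where f = g])
      fix t :: real assume t: "1 < t" "t < s"
      then have t0: "0 < t" by simp
      define y where "y = 2 * H1 t + 2 * t * H2 t - c * (\<beta> / 2 * E t / t) * H t - c * E t * H1 t"
      have "(Y has_real_derivative y) (at t)"
        unfolding Y_def y_def by (auto intro!: derivative_eq_intros dH1 dH dE t0 simp: algebra_simps)
      then have dg: "(g has_real_derivative (y + Y t * (c / \<beta> * (\<beta> / 2 * E t / t))) * exp (c / \<beta> * E t)) (at t)"
        unfolding g_def by (auto intro!: derivative_eq_intros dE t0 simp: algebra_simps)
      have "t * (y + Y t * (c / \<beta> * (\<beta> / 2 * E t / t)))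
          = 2 * t * (H1 t + t * H2 t) - c * \<beta> / 2 * E t * H t - c / 2 * E t * (c * E t * H t)"
        using t0 \<beta> unfolding y_def Y_def by (simp add: field_simps)
      also have "\<dots> = (E t * E t * (1 - c * c / 2) - c * \<beta> / 2 * E t) * H t"
        using t by (simp add: E_sq H(4) algebra_simps)
      also have "\<dots> \<ge> 0"
      proof (intro mult_nonneg_nonneg)
        have "c * c \<le> 1" using c by (simp add: mult_le_one)
        moreover have e: "E t \<le> E t * E t" "0 \<le> E t" using E_ge[of t] t by auto
        ultimately have "E t * (1/2) \<le> E t * E t * (1 - c * c / 2)"
          by (intro mult_mono) auto
        moreover have "c * \<beta> / 2 * E t \<le> 1 / 2 * E t"
          using c \<beta> e by (intro mult_right_mono) (auto simp: mult_le_one)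
        ultimately show "0 \<le> E t * E t * (1 - c * c / 2) - c * \<beta> / 2 * E t" by simp
      qed (use Hpos[of t] t0 in auto)
      finally have "0 \<le> y + Y t * (c / \<beta> * (\<beta> / 2 * E t / t))"
        using t0 by (simp add: zero_le_mult_iff)
      then show "\<exists>y. (g has_real_derivative y) (at t) \<and> 0 \<le> y"
        using dg by (meson mult_nonneg_nonneg exp_ge_zero)
    next
      show "continuous_on {1..s} g"
        unfolding g_def Y_def E_def
        by (intro continuous_intros continuous_on_subset[OF cont(1)] continuous_on_subset[OF cont(2)]) auto
    qed (use s1 in auto)
    moreover have "0 \<le> g 1"
    proof -
      have "c * H 1 \<le> 2 * H1 1" using Hpos[of 1] by (simp add: c_def min_def field_simps)
      then show ?thesis by (simp add: g_def Y_def E_def)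
    qed
    ultimately have "0 \<le> g s" by simp
    then show ?thesis by (simp add: g_def zero_le_mult_iff)
  qed

  define D where "D = (\<lambda>s. 1 + 2 * s * P1 s / P s - 2 * s * H1 s / H s)"
  have D_nonneg: "0 \<le> D s" if s0: "0 < s" for s
  proof -
    \<comment> \<open>\<open>sqrt s * V s\<close> is r times the Wronskian h h1' - h' h1 in the
      variable r. Its r-derivative is h h1 / r >= 0, because the two radial equations differ only by
      the angular term h1 / r^2.\<close>
    define V where "V = (\<lambda>s. P s * H s + 2 * s * (P1 s * H s - H1 s * P s))"
    have "sqrt 0 * V 0 \<le> sqrt s * V s"
    proof (rule DERIV_nonneg_imp_increasing_open[where f = "\<lambda>s. sqrt s * V s"])
      fix t :: real assume t: "0 < t" "t < s"
      define v where "v = P1 t * H t + P t * H1 t + 2 * (P1 t * H t - H1 t * P t)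
         + 2 * t * (P2 t * H t - H2 t * P t)"
      have dV: "(V has_real_derivative v) (at t)"
        unfolding V_def v_def by (auto intro!: derivative_eq_intros dH dP dH1 dP1 t(1) simp: algebra_simps)
      have tH2: "t * H2 t = \<kappa> t * H t / 2 - H1 t" and tP2: "t * P2 t = \<kappa> t * P t / 2 - 2 * P1 t"
        using H(4)[of t] P(5)[of t] t by auto
      have "v = P1 t * H t + P t * H1 t + 2 * (P1 t * H t - H1 t * P t)
         + 2 * ((t * P2 t) * H t - (t * H2 t) * P t)"
        unfolding v_def by (simp add: algebra_simps)
      also have "\<dots> = P t * H1 t - P1 t * H t"
        unfolding tH2 tP2 by (simp add: algebra_simps)
      finally have v: "v = P t * H1 t - P1 t * H t" .
      have "((\<lambda>s. sqrt s * V s) has_real_derivative inverse (sqrt t) / 2 * V t + sqrt t * v) (at t)"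
        by (rule derivative_eq_intros dV refl | use t in simp)+
      moreover have "0 \<le> inverse (sqrt t) / 2 * V t + sqrt t * v"
      proof -
        have "sqrt t * (inverse (sqrt t) / 2 * V t + sqrt t * v) = V t / 2 + t * v"
          using t by (simp add: field_simps)
        also have "\<dots> = P t * H t / 2" unfolding v V_def by (simp add: field_simps)
        also have "\<dots> \<ge> 0" using Hpos[of t] Ppos[of t] t by simp
        finally show ?thesis using t by (simp add: zero_le_mult_iff)
      qed
      ultimately show "\<exists>y. ((\<lambda>s. sqrt s * V s) has_real_derivative y) (at t) \<and> 0 \<le> y" by blast
    next
      show "continuous_on {0..s} (\<lambda>s. sqrt s * V s)"
        unfolding V_def
        by (intro continuous_intros continuous_on_subset[OF cont(1)] continuous_on_subset[OF cont(2)]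
          continuous_on_subset[OF cont(3)] continuous_on_subset[OF cont(4)]) auto
    qed (use s0 in auto)
    then have "0 \<le> V s" using s0 by (simp add: zero_le_mult_iff)
    moreover have "D s = V s / (P s * H s)"
      using Hpos[of s] Ppos[of s] s0 by (simp add: D_def V_def field_simps)
    ultimately show ?thesis using Hpos[of s] Ppos[of s] s0 by simp
  qed

  define F where "F = (\<lambda>s::real. s powr (- \<beta> / 2))"
  have FE: "F s * E s = 1" if "0 < s" for s using that by (simp add: F_def E_def flip: powr_add)
  have F_pos: "0 < F s" if "0 < s" for s using that by (simp add: F_def)
  have dF: "(F has_real_derivative - \<beta> / 2 * F s / s) (at s)" if "0 < s" for s
    unfolding F_def using that by (auto intro!: derivative_eq_intros simp: powr_diff)
  \<comment> \<open>The term F / (c \<beta>) cancels the forcing 1/2 of the Riccati equation. The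
    term F D / c converts its damping into at most -D, since F x >= c F E = c; this outweighs the D
    / 2 coming from the logarithms.\<close>
  define N where "N = (\<lambda>s. ln s / 2 + ln (P s) - ln (H s) + F s / (c * \<beta>) + F s * D s / c)"
  have N_le: "N s \<le> N 1" if s1: "1 \<le> s" for s
  proof (rule DERIV_nonpos_imp_decreasing_open[where f = N, OF s1])
    fix t :: real assume t: "1 < t" "t < s"
    then have t0: "0 < t" by simp
    have pos: "0 < P t" "0 < H t" using Hpos[of t] Ppos[of t] t by auto
    define x where "x = 2 * t * H1 t / H t"
    define z where "z = 2 * t * P1 t / P t"
    have Dxz: "D t = 1 + z - x" by (simp add: D_def x_def z_def)
    define d where "d = ((2 * P1 t + 2 * t * P2 t) * P t - 2 * t * P1 t * P1 t) / (P t * P t)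
        - ((2 * H1 t + 2 * t * H2 t) * H t - 2 * t * H1 t * H1 t) / (H t * H t)"
    have "((\<lambda>s. 2 * s * P1 s) has_real_derivative 2 * P1 t + 2 * t * P2 t) (at t)"
      "((\<lambda>s. 2 * s * H1 s) has_real_derivative 2 * H1 t + 2 * t * H2 t) (at t)"
      by (auto intro!: derivative_eq_intros dP1 dH1 t0)
    from DERIV_diff[OF DERIV_add[OF DERIV_const[of 1] DERIV_divide[OF this(1) dP[OF t0]]] DERIV_divide[OF this(2) dH[OF t0]]]
    have dD: "(D has_real_derivative d) (at t)"
      unfolding D_def d_def using pos by simp
    have "t * (((2 * P1 t + 2 * t * P2 t) * P t - 2 * t * P1 t * P1 t) / (P t * P t))
        = 2 * t * (P1 t + t * P2 t) / P t - z * z / 2"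
      using pos unfolding z_def by (simp add: field_simps)
    moreover have "t * (((2 * H1 t + 2 * t * H2 t) * H t - 2 * t * H1 t * H1 t) / (H t * H t))
        = 2 * t * (H1 t + t * H2 t) / H t - x * x / 2"
      using pos unfolding x_def by (simp add: field_simps)
    ultimately have "t * d = 2 * t * (P1 t + t * P2 t) / P t - z * z / 2 - (2 * t * (H1 t + t * H2 t) / H t - x * x / 2)"
      unfolding d_def right_diff_distrib by simp
    moreover have "P1 t + t * P2 t = \<kappa> t * P t / 2 - P1 t" "H1 t + t * H2 t = \<kappa> t * H t / 2"
      using H(4)[of t] P(5)[of t] t by auto
    moreover have "2 * t * (\<kappa> t * P t / 2 - P1 t) / P t = t * \<kappa> t - z" "2 * t * (\<kappa> t * H t / 2) / H t = t * \<kappa> t"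
      using pos by (simp_all add: z_def field_simps)
    ultimately have "t * d = - z - z * z / 2 + x * x / 2" by simp
    also have "\<dots> = 1/2 - D t * D t / 2 - D t * x" unfolding Dxz by (simp add: field_simps)
    \<comment> \<open>The Riccati equation. The rate \<kappa> has cancelled and acts only through
      the lower bound on \<open>x\<close>.\<close>
    finally have td: "t * d = 1/2 - D t * D t / 2 - D t * x" .
    define \<nu> where "\<nu> = 1 / t / 2 + P1 t / P t - H1 t / H t - \<beta> / 2 * F t / t / (c * \<beta>)
        + (- \<beta> / 2 * F t / t * D t + F t * d) / c"
    have dN: "(N has_real_derivative \<nu>) (at t)"
    proof -
      have "((\<lambda>s. ln (P s)) has_real_derivative P1 t / P t) (at t)"
        "((\<lambda>s. ln (H s)) has_real_derivative H1 t / H t) (at t)"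
        "((\<lambda>s. ln s) has_real_derivative 1 / t) (at t)"
        using pos t0 by (auto intro!: derivative_eq_intros dH dP simp: divide_inverse)
      note DERIV_add[OF DERIV_add[OF DERIV_diff[OF DERIV_add[OF DERIV_cdivide[OF this(3), of 2] this(1)] this(2)]
        DERIV_cdivide[OF dF[OF t0], of "c * \<beta>"]] DERIV_cdivide[OF DERIV_mult[OF dF[OF t0] dD], of c]]
      then show ?thesis unfolding N_def \<nu>_def by (simp add: mult.commute)
    qed
    have "t * \<nu> = (1 + z - x) / 2 - F t / (2 * c) - \<beta> / 2 * F t * D t / c + F t * (t * d) / c"
      unfolding \<nu>_def x_def z_def using pos t0 c \<beta> by (simp add: field_simps)
    also have "\<dots> = D t / 2 - \<beta> / 2 * F t * D t / c - F t * (D t * D t) / (2 * c) - F t * D t * x / c"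
      unfolding td Dxz[symmetric] using c by (simp add: field_simps)
    also have "\<dots> \<le> D t / 2 - F t * D t * x / c"
    proof -
      have "0 \<le> \<beta> / 2 * F t * D t / c" "0 \<le> F t * (D t * D t) / (2 * c)"
        using F_pos[OF t0] D_nonneg[OF t0] c \<beta> by simp_all
      then show ?thesis by linarith
    qed
    also have "\<dots> \<le> D t / 2 - F t * E t * D t"
    proof -
      have "c * E t \<le> x" using Y_nonneg[of t] t pos by (simp add: Y_def x_def field_simps)
      then have "F t * D t * (c * E t) / c \<le> F t * D t * x / c"
        using F_pos[OF t0] D_nonneg[OF t0] c by (intro divide_right_mono mult_left_mono) auto
      then show ?thesis using c by (simp add: mult_ac)
    qed
    also have "\<dots> \<le> 0" using FE[OF t0] D_nonneg[OF t0] by simp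
    finally have "\<nu> \<le> 0" using t0 by (simp add: mult_le_0_iff)
    then show "\<exists>y. (N has_real_derivative y) (at t) \<and> y \<le> 0" using dN by blast
  next
    show "continuous_on {1..s} N"
      unfolding N_def F_def D_def
      by (intro continuous_intros continuous_on_subset[OF cont(1)] continuous_on_subset[OF cont(2)]
          continuous_on_subset[OF cont(3)] continuous_on_subset[OF cont(4)])
         (use Hpos Ppos c \<beta> in \<open>auto simp: less_imp_neq[symmetric]\<close>)
  qed

  define C where "C = exp (N 1) + P 1"
  have "sqrt s * P s \<le> C * H s" if s: "0 \<le> s" for s
  proof (cases "1 \<le> s")
    case True
    then have s0: "0 < s" by simp
    have pos: "0 < P s" "0 < H s" using Hpos[of s] Ppos[of s] s by auto
    have "ln (sqrt s * P s / H s) = ln s / 2 + ln (P s) - ln (H s)"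
      using pos s0 by (simp add: ln_div ln_mult ln_sqrt)
    also have "\<dots> \<le> N s"
      using F_pos[OF s0] D_nonneg[OF s0] c \<beta> by (simp add: N_def)
    also have "\<dots> \<le> N 1" using N_le[OF True] .
    finally have "exp (ln (sqrt s * P s / H s)) \<le> exp (N 1)" by simp
    then have "sqrt s * P s / H s \<le> exp (N 1)" using pos s0 by simp
    then have "sqrt s * P s \<le> exp (N 1) * H s" using pos by (simp add: field_simps)
    also have "\<dots> \<le> C * H s" using pos Ppos[of 1] by (intro mult_right_mono) (auto simp: C_def)
    finally show ?thesis .
  next
    case False
    have "P s \<le> P 1"
    proof (rule DERIV_nonneg_imp_increasing_open[where f = P])
      show "\<exists>y. (P has_real_derivative y) (at t) \<and> 0 \<le> y" if "s < t" "t < 1" for t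
        using dP[of t] P(2)[of t] s that by auto
      show "continuous_on {s..1} P" using s by (intro continuous_on_subset[OF cont(3)]) auto
    qed (use False in auto)
    then have "sqrt s * P s \<le> 1 * P 1"
      using False s Ppos[of s] by (intro mult_mono) auto
    also have "\<dots> \<le> C * 1" by (simp add: C_def)
    also have "\<dots> \<le> C * H s" using H(1)[OF s] Ppos[of 1] by (intro mult_left_mono) (auto simp: C_def add_pos_pos less_imp_le)
    finally show ?thesis .
  qed
  moreover have "0 < C" using Ppos[of 1] by (simp add: C_def add_pos_pos)
  ultimately show thesis using that by blast
qed

section \<open>Local expansion of the harmonic functions\<close>

text \<open>The mean value inequality applied twice, with \<open>f2\<close> uniformly continuous on
  a compact interval. Uniformity in s is the point: one step size must serve all starting points in
  a sublevel set.\<close>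

lemma taylor2_uniform:
  fixes f f1 f2 :: "real \<Rightarrow> real"
  assumes f: "\<And>s. 0 \<le> s \<Longrightarrow> (f has_real_derivative f1 s) (at s within {0..})"
    and f1: "\<And>s. 0 \<le> s \<Longrightarrow> (f1 has_real_derivative f2 s) (at s within {0..})"
    and f2: "continuous_on {0..} f2" and \<epsilon>: "0 < \<epsilon>"
  obtains \<delta> where "0 < \<delta>"
    "\<And>s t. 0 \<le> s \<Longrightarrow> s \<le> r \<Longrightarrow> 0 \<le> t \<Longrightarrow> \<bar>t - s\<bar> < \<delta> \<Longrightarrow>
      \<bar>f t - f s - f1 s * (t - s) - f2 s / 2 * (t - s)\<^sup>2\<bar> \<le> \<epsilon> * (t - s)\<^sup>2"
proof -
  have "uniformly_continuous_on {0..r+1} f2"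
    by (intro compact_uniformly_continuous continuous_on_subset[OF f2]) auto
  then obtain \<delta>0 where \<delta>0: "0 < \<delta>0"
    "\<And>u v. u \<in> {0..r+1} \<Longrightarrow> v \<in> {0..r+1} \<Longrightarrow> dist u v < \<delta>0 \<Longrightarrow> dist (f2 u) (f2 v) < \<epsilon>"
    using \<epsilon> unfolding uniformly_continuous_on_def by metis
  show thesis
  proof
    show "0 < min \<delta>0 1" using \<delta>0 by simp
    fix s t assume s: "0 \<le> s" "s \<le> r" and t: "0 \<le> t" and st: "\<bar>t - s\<bar> < min \<delta>0 1"
    define S where "S = closed_segment s t"
    have S: "convex S" "s \<in> S" "t \<in> S" "S \<subseteq> {0..}"
      using s t by (auto simp: S_def closed_segment_eq_real_ivl split: if_splits)
    have Su: "\<bar>u - s\<bar> \<le> \<bar>t - s\<bar>" "u \<in> {0..r+1}" if "u \<in> S" for u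
      using that s t st by (auto simp: S_def closed_segment_eq_real_ivl split: if_splits)
    have b1: "\<bar>f1 u - f1 s - f2 s * (u - s)\<bar> \<le> \<epsilon> * \<bar>t - s\<bar>" if u: "u \<in> S" for u
    proof -
      have "norm ((f1 u - f2 s * u) - (f1 s - f2 s * s)) \<le> \<epsilon> * norm (u - s)"
      proof (rule field_differentiable_bound[OF S(1), where f' = "\<lambda>x. f2 x - f2 s"])
        fix x assume x: "x \<in> S"
        show "((\<lambda>u. f1 u - f2 s * u) has_real_derivative f2 x - f2 s) (at x within S)"
          using S x by (auto intro!: derivative_eq_intros DERIV_subset[OF f1])
        show "norm (f2 x - f2 s) \<le> \<epsilon>"
          using \<delta>0(2)[of x s] Su[OF x] s st by (auto simp: dist_real_def)
      qed (use u S in auto)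
      also have "\<dots> \<le> \<epsilon> * \<bar>t - s\<bar>" using Su[OF u] \<epsilon> by simp
      finally show ?thesis by (simp add: algebra_simps)
    qed
    define g where "g = (\<lambda>u. f u - f1 s * (u - s) - f2 s / 2 * (u - s)\<^sup>2)"
    have "norm (g t - g s) \<le> (\<epsilon> * \<bar>t - s\<bar>) * norm (t - s)"
    proof (rule field_differentiable_bound[OF S(1)])
      fix x assume x: "x \<in> S"
      show "(g has_real_derivative f1 x - f1 s - f2 s * (x - s)) (at x within S)"
        unfolding g_def using S x by (auto intro!: derivative_eq_intros DERIV_subset[OF f])
      show "norm (f1 x - f1 s - f2 s * (x - s)) \<le> \<epsilon> * \<bar>t - s\<bar>" using b1[OF x] by simp
    qed (use S in auto)
    then show "\<bar>f t - f s - f1 s * (t - s) - f2 s / 2 * (t - s)\<^sup>2\<bar> \<le> \<epsilon> * (t - s)\<^sup>2"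
      by (simp add: g_def power2_eq_square algebra_simps)
  qed
qed

text \<open>With p = z \<bullet> y, m = |y| and d = 2 p + m^2 the increment of |z|^2, one has d^2 =
  4 p^2 + (4 p + m^2) m^2. The last summand is cubic in |y|, so only 4 p^2 survives to second
  order.\<close>

lemma radial_expansion:
  fixes f f1 f2 :: "real \<Rightarrow> real"
  assumes f: "\<And>s. 0 \<le> s \<Longrightarrow> (f has_real_derivative f1 s) (at s within {0..})"
    and f1: "\<And>s. 0 \<le> s \<Longrightarrow> (f1 has_real_derivative f2 s) (at s within {0..})"
    and f2: "continuous_on {0..} f2" and \<epsilon>: "0 < \<epsilon>" and r: "0 \<le> r"
  obtains \<delta> where "0 < \<delta>"
    "\<And>z y :: 'a :: real_inner. norm z \<le> r \<Longrightarrow> norm y < \<delta> \<Longrightarrow>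
      \<bar>f ((z + y) \<bullet> (z + y)) - f (z \<bullet> z) - f1 (z \<bullet> z) * (2 * (z \<bullet> y) + y \<bullet> y) - 2 * f2 (z \<bullet> z) * (z \<bullet> y)\<^sup>2\<bar>
        \<le> \<epsilon> * (norm y)\<^sup>2"
proof -
  define \<epsilon>' where "\<epsilon>' = \<epsilon> / (2 * (2 * r + 1)\<^sup>2)"
  have \<epsilon>': "0 < \<epsilon>'" "\<epsilon>' * (2 * r + 1)\<^sup>2 = \<epsilon> / 2" using \<epsilon> r by (simp_all add: \<epsilon>'_def)
  obtain \<delta>0 where \<delta>0: "0 < \<delta>0"
    "\<And>s t. 0 \<le> s \<Longrightarrow> s \<le> r\<^sup>2 \<Longrightarrow> 0 \<le> t \<Longrightarrow> \<bar>t - s\<bar> < \<delta>0 \<Longrightarrow>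
      \<bar>f t - f s - f1 s * (t - s) - f2 s / 2 * (t - s)\<^sup>2\<bar> \<le> \<epsilon>' * (t - s)\<^sup>2"
    using taylor2_uniform[OF f f1 f2 \<epsilon>'(1)] by blast
  have "compact (f2 ` {0..r\<^sup>2})"
    by (intro compact_continuous_image continuous_on_subset[OF f2]) auto
  then obtain K where K: "0 < K" "\<And>s. 0 \<le> s \<Longrightarrow> s \<le> r\<^sup>2 \<Longrightarrow> \<bar>f2 s\<bar> \<le> K"
    using compact_imp_bounded[of "f2 ` {0..r\<^sup>2}"] by (auto simp: bounded_pos)
  \<comment> \<open>The three bounds give m < 1, then |d| <= (2 r + 1) m < \<delta>0, and a cubic
    remainder below \<epsilon> / 2 * m^2.\<close>
  define \<delta> where "\<delta> = min 1 (min (\<delta>0 / (2 * r + 1)) (\<epsilon> / (K * (4 * r + 1))))"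
  have \<delta>: "0 < \<delta>" using \<delta>0 K \<epsilon> r by (simp add: \<delta>_def)
  show thesis
  proof (rule that[OF \<delta>])
    fix z y :: 'a assume z: "norm z \<le> r" and y: "norm y < \<delta>"
    define s where "s = z \<bullet> z"
    define m where "m = norm y"
    define p where "p = z \<bullet> y"
    define d where "d = 2 * p + m\<^sup>2"
    have "0 < K * (4 * r + 1)" using K r by simp
    then have m: "0 \<le> m" "m < 1" "m * (2 * r + 1) < \<delta>0" "K * (4 * r + 1) * m < \<epsilon>"
      using y r by (auto simp: m_def \<delta>_def pos_less_divide_eq mult.commute)
    have yy: "y \<bullet> y = m\<^sup>2" by (simp add: m_def power2_norm_eq_inner)
    have p: "\<bar>p\<bar> \<le> r * m"
      unfolding p_def m_def by (rule order_trans[OF Cauchy_Schwarz_ineq2]) (intro mult_right_mono z norm_ge_zero)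
    have mm: "m\<^sup>2 \<le> m" using m by (simp add: power2_eq_square mult_left_le)
    have d: "\<bar>d\<bar> \<le> (2 * r + 1) * m" 
    proof -
      have "\<bar>d\<bar> \<le> 2 * \<bar>p\<bar> + m\<^sup>2" unfolding d_def using zero_le_power2[of m] by linarith
      also have "\<dots> \<le> 2 * (r * m) + m" using p mm by linarith
      finally show ?thesis by (simp add: algebra_simps)
    qed
    have s: "0 \<le> s" "s \<le> r\<^sup>2" using z by (auto simp: s_def power2_norm_eq_inner[symmetric] power_mono)
    have e: "(z + y) \<bullet> (z + y) = s + d"
      by (simp add: s_def d_def p_def yy inner_add inner_commute)
    have sd: "0 \<le> s + d" unfolding e[symmetric] by simp
    have T: "\<bar>f (s + d) - f s - f1 s * d - f2 s / 2 * d\<^sup>2\<bar> \<le> \<epsilon>' * d\<^sup>2"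
      using \<delta>0(2)[OF s sd] d m by (simp add: mult.commute)
    have d2: "\<epsilon>' * d\<^sup>2 \<le> \<epsilon> / 2 * m\<^sup>2"
    proof -
      have "d\<^sup>2 \<le> ((2 * r + 1) * m)\<^sup>2" using d by (metis abs_ge_zero power2_abs power_mono)
      then have "\<epsilon>' * d\<^sup>2 \<le> \<epsilon>' * ((2 * r + 1) * m)\<^sup>2" using \<epsilon>' by simp
      also have "\<dots> = \<epsilon> / 2 * m\<^sup>2" using \<epsilon>'(2) by (simp add: power_mult_distrib)
      finally show ?thesis .
    qed
    have pm: "\<bar>4 * p + m\<^sup>2\<bar> \<le> (4 * r + 1) * m"
    proof -
      have "\<bar>4 * p + m\<^sup>2\<bar> \<le> 4 * \<bar>p\<bar> + m\<^sup>2" using zero_le_power2[of m] by linarith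
      also have "\<dots> \<le> 4 * (r * m) + m" using p mm by linarith
      finally show ?thesis by (simp add: algebra_simps)
    qed
    have q: "\<bar>f2 s / 2 * d\<^sup>2 - 2 * f2 s * p\<^sup>2\<bar> \<le> \<epsilon> / 2 * m\<^sup>2"
    proof -
      have "f2 s / 2 * d\<^sup>2 - 2 * f2 s * p\<^sup>2 = f2 s / 2 * ((4 * p + m\<^sup>2) * m\<^sup>2)"
        unfolding d_def by (simp add: power2_eq_square algebra_simps)
      also have "\<bar>\<dots>\<bar> \<le> K / 2 * (((4 * r + 1) * m) * m\<^sup>2)"
        unfolding abs_mult[of _ "(4 * p + m\<^sup>2) * m\<^sup>2"] abs_mult[of _ "m\<^sup>2"]
        using K(2)[OF s] pm K(1) m(1) r by (intro mult_mono) auto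
      also have "\<dots> = (K * (4 * r + 1) * m) / 2 * m\<^sup>2" by simp
      also have "\<dots> \<le> \<epsilon> / 2 * m\<^sup>2" using m by (intro mult_right_mono) auto
      finally show ?thesis .
    qed
    have "\<bar>f (s + d) - f s - f1 s * d - 2 * f2 s * p\<^sup>2\<bar> \<le> \<epsilon> * m\<^sup>2"
      using T d2 q by linarith
    then show "\<bar>f ((z + y) \<bullet> (z + y)) - f (z \<bullet> z) - f1 (z \<bullet> z) * (2 * (z \<bullet> y) + y \<bullet> y) - 2 * f2 (z \<bullet> z) * (z \<bullet> y)\<^sup>2\<bar>
        \<le> \<epsilon> * (norm y)\<^sup>2"
      by (simp add: e yy d_def p_def s_def m_def)
  qed
qed

text \<open>\<open>u\<close>, \<open>v\<close> stand for half the pure second derivatives, so \<open>u + v\<close> is half the Laplacian.\<close>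

definition generator_eq :: "(real ^ 2 \<Rightarrow> real) \<Rightarrow> (real ^ 2 \<Rightarrow> real) \<Rightarrow> bool"
  where "generator_eq k G \<longleftrightarrow> (\<exists>a b u v w. continuous_on UNIV a \<and> continuous_on UNIV b \<and>
    continuous_on UNIV u \<and> continuous_on UNIV v \<and> continuous_on UNIV w \<and>
    (\<forall>z. u z + v z = k z * G z) \<and>
    (\<forall>r \<epsilon>. 0 < \<epsilon> \<longrightarrow> (\<exists>\<delta>>0. \<forall>z y. norm z \<le> r \<longrightarrow> norm y < \<delta> \<longrightarrow>
      \<bar>G (z + y) - (G z + a z * y$1 + b z * y$2 + u z * (y$1)\<^sup>2 + v z * (y$2)\<^sup>2 + w z * (y$1 * y$2))\<bar>
        \<le> \<epsilon> * (norm y)\<^sup>2)))"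

lemma inner_real_2: "(x :: real ^ 2) \<bullet> y = x$1 * y$1 + x$2 * y$2"
  by (simp add: inner_vec_def sum_2)

text \<open>Multiply the expansion of P by e (z1 + y1). Apart from e P y1, the only product with y1
  of order at most two is 2 e P1 y1 (z \<bullet> y). It feeds \<open>u\<close> and \<open>w\<close>
  and accounts for the factor 2 of \<open>P1\<close> in the equation for \<open>P\<close>.\<close>

lemma generator_eq_radial:
  fixes H H1 H2 P P1 P2 \<kappa> :: "real \<Rightarrow> real"
  assumes H: "\<And>s. 0 \<le> s \<Longrightarrow> (H has_real_derivative H1 s) (at s within {0..})"
      "\<And>s. 0 \<le> s \<Longrightarrow> (H1 has_real_derivative H2 s) (at s within {0..})"
      "continuous_on {0..} H2"
      "\<And>s. 0 \<le> s \<Longrightarrow> H1 s + s * H2 s = \<kappa> s * H s / 2"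
    and P: "\<And>s. 0 \<le> s \<Longrightarrow> (P has_real_derivative P1 s) (at s within {0..})"
      "\<And>s. 0 \<le> s \<Longrightarrow> (P1 has_real_derivative P2 s) (at s within {0..})"
      "continuous_on {0..} P2"
      "\<And>s. 0 \<le> s \<Longrightarrow> 2 * P1 s + s * P2 s = \<kappa> s * P s / 2"
  shows "generator_eq (\<lambda>z. \<kappa> (z \<bullet> z)) (\<lambda>z. H (z \<bullet> z) + e * z$1 * P (z \<bullet> z))"
proof -
  have cont: "continuous_on {0..} H" "continuous_on {0..} H1" "continuous_on {0..} P" "continuous_on {0..} P1"
    using H(1,2) P(1,2) by (auto intro!: DERIV_continuous_on)
  have cc: "continuous_on UNIV (\<lambda>z::real^2. f (z \<bullet> z))" if "continuous_on {0..} f" for f :: "real \<Rightarrow> real"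
    by (rule continuous_on_compose2[OF that]) (auto intro!: continuous_intros)
  note cci = cc[OF cont(1)] cc[OF cont(2)] cc[OF cont(3)] cc[OF cont(4)] cc[OF H(3)] cc[OF P(3)]
  define q where "q = (\<lambda>z::real^2. z \<bullet> z)"
  define a where "a = (\<lambda>z::real^2. 2 * H1 (q z) * z$1 + 2 * e * z$1 * P1 (q z) * z$1 + e * P (q z))"
  define b where "b = (\<lambda>z::real^2. 2 * H1 (q z) * z$2 + 2 * e * z$1 * P1 (q z) * z$2)"
  define u where "u = (\<lambda>z::real^2. H1 (q z) + 2 * H2 (q z) * (z$1)\<^sup>2 + e * z$1 * (P1 (q z) + 2 * P2 (q z) * (z$1)\<^sup>2)
      + 2 * e * P1 (q z) * z$1)"
  define v where "v = (\<lambda>z::real^2. H1 (q z) + 2 * H2 (q z) * (z$2)\<^sup>2 + e * z$1 * (P1 (q z) + 2 * P2 (q z) * (z$2)\<^sup>2))"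
  define w where "w = (\<lambda>z::real^2. 4 * H2 (q z) * (z$1 * z$2) + 4 * e * z$1 * P2 (q z) * (z$1 * z$2)
      + 2 * e * P1 (q z) * z$2)"
  have cont_coeffs: "continuous_on UNIV a" "continuous_on UNIV b" "continuous_on UNIV u" "continuous_on UNIV v" "continuous_on UNIV w"
    unfolding a_def b_def u_def v_def w_def q_def by (intro continuous_intros cci)+
  have lap: "u z + v z = \<kappa> (z \<bullet> z) * (H (z \<bullet> z) + e * z$1 * P (z \<bullet> z))" for z
  proof -
    have q: "q z = (z$1)\<^sup>2 + (z$2)\<^sup>2" "0 \<le> q z" by (simp_all add: q_def inner_real_2 power2_eq_square)
    have "u z + v z = 2 * (H1 (q z) + q z * H2 (q z)) + 2 * (e * z$1) * (2 * P1 (q z) + q z * P2 (q z))"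
      unfolding u_def v_def q(1)[symmetric] by (simp add: q(1) algebra_simps)
    also have "\<dots> = \<kappa> (q z) * (H (q z) + e * z$1 * P (q z))"
      unfolding H(4)[OF q(2)] P(4)[OF q(2)] by (simp add: algebra_simps)
    finally show ?thesis by (simp add: q_def)
  qed
  have "\<exists>\<delta>>0. \<forall>z y. norm z \<le> r \<longrightarrow> norm y < \<delta> \<longrightarrow>
      \<bar>H ((z + y) \<bullet> (z + y)) + e * (z + y)$1 * P ((z + y) \<bullet> (z + y))
        - ((H (z \<bullet> z) + e * z$1 * P (z \<bullet> z)) + a z * y$1 + b z * y$2 + u z * (y$1)\<^sup>2 + v z * (y$2)\<^sup>2 + w z * (y$1 * y$2))\<bar>
        \<le> \<epsilon> * (norm y)\<^sup>2" if \<epsilon>: "0 < \<epsilon>" for r \<epsilon>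
  proof (cases "0 \<le> r")
    case False
    have "norm z \<le> r \<longleftrightarrow> False" for z :: "real^2" using False by (meson norm_ge_zero order_trans)
    then show ?thesis by (auto intro!: exI[of _ 1])
  next
    case r: True
    define \<epsilon>1 where "\<epsilon>1 = \<epsilon> / 3 / (\<bar>e\<bar> * r + 1)"
    have \<epsilon>1: "0 < \<epsilon>1" "\<bar>e\<bar> * r * \<epsilon>1 \<le> \<epsilon> / 3"
    proof -
      have pos: "0 < \<bar>e\<bar> * r + 1" using r by (simp add: add_nonneg_pos)
      then show "0 < \<epsilon>1" using \<epsilon> by (simp add: \<epsilon>1_def)
      have "(\<bar>e\<bar> * r + 1) * \<epsilon>1 = \<epsilon> / 3"
        unfolding \<epsilon>1_def using pos by (metis less_irrefl nonzero_mult_div_cancel_left times_divide_eq_right)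
      then show "\<bar>e\<bar> * r * \<epsilon>1 \<le> \<epsilon> / 3" using \<open>0 < \<epsilon>1\<close> by (simp add: algebra_simps)
    qed
    obtain \<delta>1 where \<delta>1: "0 < \<delta>1" "\<And>z y :: real^2. norm z \<le> r \<Longrightarrow> norm y < \<delta>1 \<Longrightarrow>
      \<bar>H ((z + y) \<bullet> (z + y)) - H (z \<bullet> z) - H1 (z \<bullet> z) * (2 * (z \<bullet> y) + y \<bullet> y) - 2 * H2 (z \<bullet> z) * (z \<bullet> y)\<^sup>2\<bar>
        \<le> \<epsilon> / 3 * (norm y)\<^sup>2"
      using radial_expansion[OF H(1,2,3) _ r, of "\<epsilon> / 3"] \<epsilon> by auto
    obtain \<delta>2 where \<delta>2: "0 < \<delta>2" "\<And>z y :: real^2. norm z \<le> r \<Longrightarrow> norm y < \<delta>2 \<Longrightarrow>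
      \<bar>P ((z + y) \<bullet> (z + y)) - P (z \<bullet> z) - P1 (z \<bullet> z) * (2 * (z \<bullet> y) + y \<bullet> y) - 2 * P2 (z \<bullet> z) * (z \<bullet> y)\<^sup>2\<bar>
        \<le> \<epsilon>1 * (norm y)\<^sup>2"
      using radial_expansion[OF P(1,2,3) \<epsilon>1(1) r] by auto
    have "continuous_on UNIV (\<lambda>z::real^2. (P1 (z \<bullet> z), P2 (z \<bullet> z)))"
      by (intro continuous_intros cci)
    then have "compact ((\<lambda>z::real^2. (P1 (z \<bullet> z), P2 (z \<bullet> z))) ` cball 0 r)"
      by (intro compact_continuous_image continuous_on_subset[of UNIV _ "cball 0 r"]) auto
    then obtain K where K: "0 < K" "\<And>z::real^2. norm z \<le> r \<Longrightarrow> norm (P1 (z \<bullet> z), P2 (z \<bullet> z)) \<le> K"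
      using compact_imp_bounded by (force simp: bounded_pos)
    have K1: "\<bar>P1 (z \<bullet> z)\<bar> \<le> K" and K2: "\<bar>P2 (z \<bullet> z)\<bar> \<le> K" if "norm z \<le> r" for z :: "real^2"
      using K(2)[OF that] norm_fst_le[of "P1 (z \<bullet> z)" "P2 (z \<bullet> z)"] norm_snd_le[of "P2 (z \<bullet> z)" "P1 (z \<bullet> z)"] by auto
    \<comment> \<open>\<open>L * m\<close> dominates the cubic summand of the identity
      \<open>split\<close> relative to m^2; the + 1 keeps it positive also for e = 0.\<close>
    define L where "L = \<bar>e\<bar> * (K + 2 * K * r\<^sup>2 + \<epsilon>1) + 1"
    have L: "0 < L" using K \<epsilon>1 by (simp add: L_def add_nonneg_pos)
    define \<delta> where "\<delta> = min (min \<delta>1 \<delta>2) (\<epsilon> / 3 / L)"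
    show ?thesis
    proof (intro exI conjI allI impI)
      show "0 < \<delta>" using \<delta>1 \<delta>2 L \<epsilon> by (simp add: \<delta>_def)
      fix z y :: "real^2" assume z: "norm z \<le> r" and y: "norm y < \<delta>"
      define m where "m = norm y"
      define p where "p = z \<bullet> y"
      define EH where "EH = H ((z + y) \<bullet> (z + y)) - H (q z) - H1 (q z) * (2 * p + y \<bullet> y) - 2 * H2 (q z) * p\<^sup>2"
      define EP where "EP = P ((z + y) \<bullet> (z + y)) - P (q z) - P1 (q z) * (2 * p + y \<bullet> y) - 2 * P2 (q z) * p\<^sup>2"
      have yy: "y \<bullet> y = m\<^sup>2" by (simp add: m_def power2_norm_eq_inner)
      have bH: "\<bar>EH\<bar> \<le> \<epsilon> / 3 * m\<^sup>2" and bP: "\<bar>EP\<bar> \<le> \<epsilon>1 * m\<^sup>2"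
        using \<delta>1(2)[OF z, of y] \<delta>2(2)[OF z, of y] y by (auto simp: EH_def EP_def q_def p_def m_def \<delta>_def)
      have z1: "\<bar>z$1\<bar> \<le> r" and y1: "\<bar>y$1\<bar> \<le> m"
        using component_le_norm_cart[of z 1] component_le_norm_cart[of y 1] z by (auto simp: m_def)
      have p: "\<bar>p\<bar> \<le> r * m"
        unfolding p_def m_def by (rule order_trans[OF Cauchy_Schwarz_ineq2]) (intro mult_right_mono z norm_ge_zero)
      have fold_q: "z \<bullet> z = q z" by (simp add: q_def)
      have split: "H ((z + y) \<bullet> (z + y)) + e * (z + y)$1 * P ((z + y) \<bullet> (z + y))
        - ((H (z \<bullet> z) + e * z$1 * P (z \<bullet> z)) + a z * y$1 + b z * y$2 + u z * (y$1)\<^sup>2 + v z * (y$2)\<^sup>2 + w z * (y$1 * y$2))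
        = EH + e * z$1 * EP + e * y$1 * (P1 (q z) * (y \<bullet> y) + 2 * P2 (q z) * p\<^sup>2 + EP)"
        unfolding EH_def EP_def p_def a_def b_def u_def v_def w_def
        by (simp add: fold_q inner_real_2[of z y] inner_real_2[of y y] power2_eq_square algebra_simps)
      have "\<bar>e * z$1 * EP\<bar> \<le> \<epsilon> / 3 * m\<^sup>2"
      proof -
        have "\<bar>e * z$1 * EP\<bar> \<le> \<bar>e\<bar> * r * (\<epsilon>1 * m\<^sup>2)"
          unfolding abs_mult using z1 bP r by (intro mult_mono mult_nonneg_nonneg) auto
        also have "\<dots> = (\<bar>e\<bar> * r * \<epsilon>1) * m\<^sup>2" by simp
        also have "\<dots> \<le> \<epsilon> / 3 * m\<^sup>2" by (intro mult_right_mono \<epsilon>1) auto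
        finally show ?thesis .
      qed
      moreover have "\<bar>e * y$1 * (P1 (q z) * (y \<bullet> y) + 2 * P2 (q z) * p\<^sup>2 + EP)\<bar> \<le> \<epsilon> / 3 * m\<^sup>2"
      proof -
        have "\<bar>P1 (q z) * (y \<bullet> y)\<bar> \<le> K * m\<^sup>2"
          unfolding abs_mult yy q_def using K1[OF z] by (intro mult_mono) auto
        moreover have "\<bar>2 * P2 (q z) * p\<^sup>2\<bar> \<le> 2 * K * (r * m)\<^sup>2"
        proof -
          have "p\<^sup>2 \<le> (r * m)\<^sup>2" using p by (metis abs_ge_zero power2_abs power_mono)
          then show ?thesis unfolding abs_mult q_def using K2[OF z] K(1) by (intro mult_mono) auto
        qed
        ultimately have "\<bar>P1 (q z) * (y \<bullet> y) + 2 * P2 (q z) * p\<^sup>2 + EP\<bar> \<le> (K + 2 * K * r\<^sup>2 + \<epsilon>1) * m\<^sup>2"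
          using bP by (simp add: algebra_simps power_mult_distrib)
        then have "\<bar>e * y$1 * (P1 (q z) * (y \<bullet> y) + 2 * P2 (q z) * p\<^sup>2 + EP)\<bar>
            \<le> \<bar>e\<bar> * m * ((K + 2 * K * r\<^sup>2 + \<epsilon>1) * m\<^sup>2)"
          unfolding abs_mult using y1 by (intro mult_mono mult_nonneg_nonneg) (auto simp: m_def)
        also have "\<dots> = (\<bar>e\<bar> * (K + 2 * K * r\<^sup>2 + \<epsilon>1)) * m * m\<^sup>2" by simp
        also have "\<dots> \<le> L * m * m\<^sup>2" by (intro mult_right_mono) (auto simp: L_def m_def)
        also have "\<dots> \<le> \<epsilon> / 3 * m\<^sup>2"
        proof (rule mult_right_mono)
          have "m \<le> \<epsilon> / 3 / L" using y by (simp add: \<delta>_def m_def)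
          then show "L * m \<le> \<epsilon> / 3" using L by (simp add: field_simps)
        qed auto
        finally show ?thesis .
      qed
      ultimately have "\<bar>EH + e * z$1 * EP + e * y$1 * (P1 (q z) * (y \<bullet> y) + 2 * P2 (q z) * p\<^sup>2 + EP)\<bar> \<le> \<epsilon> * m\<^sup>2"
        using bH by linarith
      then show "\<bar>H ((z + y) \<bullet> (z + y)) + e * (z + y)$1 * P ((z + y) \<bullet> (z + y))
        - ((H (z \<bullet> z) + e * z$1 * P (z \<bullet> z)) + a z * y$1 + b z * y$2 + u z * (y$1)\<^sup>2 + v z * (y$2)\<^sup>2 + w z * (y$1 * y$2))\<bar>
        \<le> \<epsilon> * (norm y)\<^sup>2"
        unfolding split m_def .
    qed
  qed
  then show ?thesis
    unfolding generator_eq_def using cont_coeffs lap by blast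
qed

section \<open>Moments of the planar Gaussian\<close>

lemma has_bochner_integral_lborel_prod:
  fixes f :: "'a::euclidean_space \<Rightarrow> real \<Rightarrow> real"
  assumes "\<And>b. b \<in> Basis \<Longrightarrow> integrable lborel (f b)"
  shows "has_bochner_integral lborel (\<lambda>z::'a. \<Prod>b\<in>Basis. f b (z \<bullet> b)) (\<Prod>b\<in>Basis. \<integral>x. f b x \<partial>lborel)"
proof -
  interpret product_sigma_finite "\<lambda>_::'a. lborel :: real measure" by standard
  have [measurable]: "f b \<in> borel_measurable borel" if "b \<in> Basis" for b
    using borel_measurable_integrable[OF assms[OF that]] by simp
  have m: "(\<lambda>z::'a. \<Prod>b\<in>Basis. f b (z \<bullet> b)) \<in> borel_measurable borel" by measurable
  have m': "(\<lambda>g. \<Sum>b\<in>Basis. g b *\<^sub>R b) \<in> measurable (\<Pi>\<^sub>M b\<in>(Basis::'a set). lborel) borel" by measurable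
  have *: "(\<Prod>b\<in>Basis. f b ((\<Sum>b\<in>Basis. g b *\<^sub>R b) \<bullet> b)) = (\<Prod>b\<in>Basis. f b (g b))" for g :: "'a \<Rightarrow> real"
    by (intro prod.cong refl) simp
  show ?thesis
    unfolding has_bochner_integral_iff
    by (subst (1 2) lborel_eq)
       (simp add: integrable_distr_eq[OF m' m] integral_distr[OF m' m] * product_integrable_prod
         product_integral_prod assms)
qed

definition gauss :: "real \<Rightarrow> (real ^ 2) measure"
  where "gauss h = density lborel (\<lambda>z. ennreal (\<Prod>b\<in>Basis. normal_density 0 (sqrt h) (z \<bullet> b)))"

lemma sets_gauss [simp, measurable_cong]: "sets (gauss h) = sets borel"
  and space_gauss [simp]: "space (gauss h) = UNIV"
  by (simp_all add: gauss_def)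

lemma prod_Basis_real_2: "(\<Prod>b\<in>(Basis :: (real ^ 2) set). f b) = f (axis 1 1) * f (axis 2 1)"
proof -
  have basis: "(Basis :: (real ^ 2) set) = {axis 1 1, axis 2 1}"
    by (auto simp: Basis_vec_def UNIV_2)
  have "axis 1 (1::real) \<noteq> (axis 2 1 :: real ^ 2)" by (simp add: axis_eq_axis)
  then show ?thesis unfolding basis by (subst prod.insert) auto
qed

lemma gauss_monomial:
  assumes h: "0 < h"
  shows "has_bochner_integral (gauss h) (\<lambda>y. y$1 ^ i * y$2 ^ j)
    ((\<integral>x. normal_density 0 (sqrt h) x * x ^ i \<partial>lborel) * (\<integral>x. normal_density 0 (sqrt h) x * x ^ j \<partial>lborel))"
proof -
  define p where "p = (\<lambda>b::real^2. if b = axis 1 1 then i else j)"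
  have ax: "axis 2 (1::real) \<noteq> (axis 1 1 :: real ^ 2)" by (simp add: axis_eq_axis)
  have int: "integrable lborel (\<lambda>x. normal_density 0 (sqrt h) x * x ^ n)" for n
    using integrable_normal_moment[of "sqrt h" 0 n] h by simp
  have "has_bochner_integral lborel
     (\<lambda>z::real^2. (\<Prod>b\<in>Basis. normal_density 0 (sqrt h) (z \<bullet> b)) *\<^sub>R (z$1 ^ i * z$2 ^ j))
     ((\<integral>x. normal_density 0 (sqrt h) x * x ^ i \<partial>lborel) * (\<integral>x. normal_density 0 (sqrt h) x * x ^ j \<partial>lborel))"
    using has_bochner_integral_lborel_prod[of "\<lambda>b x. normal_density 0 (sqrt h) x * x ^ p b"] int ax
    by (simp add: prod_Basis_real_2 p_def inner_axis mult_ac)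
  then show ?thesis
    unfolding gauss_def
    by (rule has_bochner_integral_density[rotated 3]) (auto intro!: AE_I2 prod_nonneg)
qed

text \<open>In the local expansion the odd and mixed moments remove the terms with \<open>a\<close>,
  \<open>b\<close>, \<open>w\<close>, the second moments produce h (u + v), and the fourth, of order
  h^2, controls large jumps.\<close>

lemma gauss_moments:
  assumes h: "0 < h"
  shows "has_bochner_integral (gauss h) (\<lambda>y. 1::real) 1"
    "has_bochner_integral (gauss h) (\<lambda>y. y$1) 0"
    "has_bochner_integral (gauss h) (\<lambda>y. y$2) 0"
    "has_bochner_integral (gauss h) (\<lambda>y. (y$1)\<^sup>2) h"
    "has_bochner_integral (gauss h) (\<lambda>y. (y$2)\<^sup>2) h"
    "has_bochner_integral (gauss h) (\<lambda>y. y$1 * y$2) 0"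
    "has_bochner_integral (gauss h) (\<lambda>y. (norm y) ^ 4) (8 * h\<^sup>2)"
proof -
  have s: "0 < sqrt h" using h by simp
  have m0: "(\<integral>x. normal_density 0 (sqrt h) x \<partial>lborel) = 1"
    and m1: "(\<integral>x. normal_density 0 (sqrt h) x * x \<partial>lborel) = 0"
    and m2: "(\<integral>x. normal_density 0 (sqrt h) x * x\<^sup>2 \<partial>lborel) = h"
    and m4: "(\<integral>x. normal_density 0 (sqrt h) x * x ^ 4 \<partial>lborel) = 3 * h\<^sup>2"
    using integral_normal_moment_even[OF s, of 0 0] integral_normal_moment_odd[OF s, of 0 0]
      integral_normal_moment_even[OF s, of 0 1] integral_normal_moment_even[OF s, of 0 2] h
    by (simp_all add: fact_numeral power2_eq_square)
  note g = gauss_monomial[OF h]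
  show "has_bochner_integral (gauss h) (\<lambda>y. 1::real) 1" using g[of 0 0] by (simp add: m0)
  show "has_bochner_integral (gauss h) (\<lambda>y. y$1) 0" using g[of 1 0] by (simp add: m1)
  show "has_bochner_integral (gauss h) (\<lambda>y. y$2) 0" using g[of 0 1] by (simp add: m1)
  show "has_bochner_integral (gauss h) (\<lambda>y. (y$1)\<^sup>2) h" using g[of 2 0] by (simp add: m0 m2)
  show "has_bochner_integral (gauss h) (\<lambda>y. (y$2)\<^sup>2) h" using g[of 0 2] by (simp add: m0 m2)
  show "has_bochner_integral (gauss h) (\<lambda>y. y$1 * y$2) 0" using g[of 1 1] by (simp add: m1)
  have "has_bochner_integral (gauss h) (\<lambda>y. y$1 ^ 4 + (2 * ((y$1)\<^sup>2 * (y$2)\<^sup>2) + y$2 ^ 4)) (3 * h\<^sup>2 + (2 * (h * h) + 3 * h\<^sup>2))"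
    using g[of 4 0] g[of 0 4] g[of 2 2]
    by (intro has_bochner_integral_add has_bochner_integral_mult_right) (simp_all add: m0 m2 m4)
  moreover have "y$1 ^ 4 + (2 * ((y$1)\<^sup>2 * (y$2)\<^sup>2) + y$2 ^ 4) = (norm y) ^ 4" for y :: "real^2"
  proof -
    have "(norm y) ^ 4 = ((norm y)\<^sup>2)\<^sup>2" by simp
    also have "(norm y)\<^sup>2 = (y$1)\<^sup>2 + (y$2)\<^sup>2"
      by (subst power2_norm_eq_inner) (simp add: inner_vec_def sum_2 power2_eq_square)
    finally show ?thesis by (simp add: power2_eq_square power4_eq_xxxx algebra_simps)
  qed
  ultimately show "has_bochner_integral (gauss h) (\<lambda>y. (norm y) ^ 4) (8 * h\<^sup>2)"
    by (simp add: power2_eq_square)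
qed

lemma prob_space_gauss: "0 < h \<Longrightarrow> prob_space (gauss h)"
proof
  assume h: "0 < h"
  have "(\<integral>\<^sup>+y. ennreal 1 \<partial>gauss h) = ennreal 1"
    using gauss_moments(1)[OF h] by (subst nn_integral_eq_integral) (auto simp: has_bochner_integral_iff)
  then show "emeasure (gauss h) (space (gauss h)) = 1" by simp
qed

section \<open>One step of the walk\<close>

locale killed_harmonic =
  fixes k G :: "real ^ 2 \<Rightarrow> real"
  assumes gen: "generator_eq k G"
    and G_cont: "continuous_on UNIV G"
    and G_pos: "\<And>z. 0 < G z"
    and sublevel_bounded: "\<And>c. bounded {z. G z \<le> c}"
    and k_cont: "continuous_on UNIV k"
    and k_pos: "\<And>z. 0 < k z"
    and k_le_1: "\<And>z. k z \<le> 1"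
begin

lemma G_measurable [measurable]: "G \<in> borel_measurable borel"
  and k_measurable [measurable]: "k \<in> borel_measurable borel"
  using G_cont k_cont by (auto intro: borel_measurable_continuous_onI)

lemma compact_sublevel: "compact {z. G z \<le> c}"
  using sublevel_bounded closed_Collect_le[OF G_cont continuous_on_const] by (simp add: compact_eq_bounded_closed)

text \<open>The cutoff keeps the integrand bounded however fast G grows. For |y| < \<delta> it is
  invisible by uniform continuity of G; for larger y everything is dominated by B |y|^4, whose mean
  is O(h^2).\<close>

lemma truncated_expansion:
  assumes c: "0 < c" and d: "0 < d" and \<epsilon>: "0 < \<epsilon>"
  obtains h0 where "0 < h0"
    "\<And>h z. 0 < h \<Longrightarrow> h < h0 \<Longrightarrow> G z < c \<Longrightarrow>
      \<bar>(\<integral>y. min (G (z + y)) (c + d) \<partial>gauss h) - (G z + h * (k z * G z))\<bar> \<le> \<epsilon> * h"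
proof -
  obtain r where r: "0 < r" "\<And>z. G z \<le> c \<Longrightarrow> norm z \<le> r"
    using sublevel_bounded[of c] by (auto simp: bounded_pos)
  obtain a b u v w where coeffs: "continuous_on UNIV a" "continuous_on UNIV b" "continuous_on UNIV u"
      "continuous_on UNIV v" "continuous_on UNIV w" and lap: "\<forall>z. u z + v z = k z * G z"
    and expansion: "\<forall>r \<epsilon>. 0 < \<epsilon> \<longrightarrow> (\<exists>\<delta>>0. \<forall>z y. norm z \<le> r \<longrightarrow> norm y < \<delta> \<longrightarrow>
      \<bar>G (z + y) - (G z + a z * y$1 + b z * y$2 + u z * (y$1)\<^sup>2 + v z * (y$2)\<^sup>2 + w z * (y$1 * y$2))\<bar>
        \<le> \<epsilon> * (norm y)\<^sup>2)"
    using gen unfolding generator_eq_def by (elim exE conjE)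
  have "0 < \<epsilon> / 4" using \<epsilon> by simp
  from expansion[rule_format, OF this, of r] obtain \<delta>1 where \<delta>1: "\<delta>1 > 0 \<and> (\<forall>z y. norm z \<le> r \<longrightarrow> norm y < \<delta>1 \<longrightarrow>
      \<bar>G (z + y) - (G z + a z * y$1 + b z * y$2 + u z * (y$1)\<^sup>2 + v z * (y$2)\<^sup>2 + w z * (y$1 * y$2))\<bar>
        \<le> \<epsilon> / 4 * (norm y)\<^sup>2)"
    by (elim exE)
  note \<delta>1 = \<delta>1[THEN conjunct1] \<delta>1[THEN conjunct2, rule_format]
  have "uniformly_continuous_on (cball 0 (r+1)) G"
    by (intro compact_uniformly_continuous continuous_on_subset[OF G_cont]) auto
  then obtain \<delta>2 where \<delta>2: "0 < \<delta>2"
    "\<And>z z'. z \<in> cball 0 (r+1) \<Longrightarrow> z' \<in> cball 0 (r+1) \<Longrightarrow> dist z z' < \<delta>2 \<Longrightarrow> dist (G z) (G z') < d"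
    using d unfolding uniformly_continuous_on_def by metis
  have bounded_coeff: "\<exists>K\<ge>0. \<forall>z. norm z \<le> r \<longrightarrow> \<bar>f z\<bar> \<le> K" if "continuous_on UNIV f" for f :: "real^2 \<Rightarrow> real"
  proof -
    have "compact (f ` cball 0 r)"
      by (intro compact_continuous_image continuous_on_subset[OF that]) auto
    from compact_imp_bounded[OF this] obtain K where "0 < K \<and> (\<forall>x\<in>f ` cball 0 r. norm x \<le> K)"
      unfolding bounded_pos by (elim exE)
    then have "0 \<le> K \<and> (\<forall>z. norm z \<le> r \<longrightarrow> \<bar>f z\<bar> \<le> K)" by auto
    then show ?thesis by (rule exI)
  qed
  obtain Ka where Ka: "0 \<le> Ka" "\<forall>z. norm z \<le> r \<longrightarrow> \<bar>a z\<bar> \<le> Ka"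
    using bounded_coeff[OF coeffs(1)] by (elim exE conjE)
  obtain Kb where Kb: "0 \<le> Kb" "\<forall>z. norm z \<le> r \<longrightarrow> \<bar>b z\<bar> \<le> Kb"
    using bounded_coeff[OF coeffs(2)] by (elim exE conjE)
  obtain Ku where Ku: "0 \<le> Ku" "\<forall>z. norm z \<le> r \<longrightarrow> \<bar>u z\<bar> \<le> Ku"
    using bounded_coeff[OF coeffs(3)] by (elim exE conjE)
  obtain Kv where Kv: "0 \<le> Kv" "\<forall>z. norm z \<le> r \<longrightarrow> \<bar>v z\<bar> \<le> Kv"
    using bounded_coeff[OF coeffs(4)] by (elim exE conjE)
  obtain Kw where Kw: "0 \<le> Kw" "\<forall>z. norm z \<le> r \<longrightarrow> \<bar>w z\<bar> \<le> Kw"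
    using bounded_coeff[OF coeffs(5)] by (elim exE conjE)
  define A where "A = Ka + Kb + Ku + Kv + Kw"
  have A: "\<bar>a z\<bar> \<le> A" "\<bar>b z\<bar> \<le> A" "\<bar>u z\<bar> \<le> A" "\<bar>v z\<bar> \<le> A" "\<bar>w z\<bar> \<le> A" if "norm z \<le> r" for z
    using Ka(1) Kb(1) Ku(1) Kv(1) Kw(1)
      Ka(2)[rule_format, OF that] Kb(2)[rule_format, OF that] Ku(2)[rule_format, OF that]
      Kv(2)[rule_format, OF that] Kw(2)[rule_format, OF that]
    by (simp_all add: A_def)
  have A0: "0 \<le> A" using Ka(1) Kb(1) Ku(1) Kv(1) Kw(1) by (simp add: A_def)
  define \<delta> where "\<delta> = min 1 (min \<delta>1 \<delta>2)"
  have \<delta>: "0 < \<delta>" "\<delta> \<le> 1" using \<delta>1 \<delta>2 by (auto simp: \<delta>_def)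
  \<comment> \<open>For |y| >= \<delta> put m = |y| / \<delta>, so m >= 1 and m >= |y|. The two
    values of G cost c + d and c, the five coefficients A each, all times at most m^4.\<close>
  define B where "B = (2 * c + d + 5 * A) / \<delta> ^ 4"
  have B: "0 < B" using c d A0 \<delta> by (auto simp: B_def intro!: divide_pos_pos add_pos_nonneg)
  define p where "p = (\<lambda>z (y::real^2). G z + a z * y$1 + b z * y$2 + u z * (y$1)\<^sup>2 + v z * (y$2)\<^sup>2 + w z * (y$1 * y$2))"
  have bound: "\<bar>min (G (z + y)) (c + d) - p z y\<bar> \<le> \<epsilon> / 4 * (norm y)\<^sup>2 + B * (norm y) ^ 4"
    if z: "G z < c" for z y
  proof -
    have nz: "norm z \<le> r" using r(2) z by simp
    show ?thesis
    proof (cases "norm y < \<delta>")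
      case True
      have "norm (z + y) \<le> r + 1" using norm_triangle_ineq[of z y] nz True \<delta> by linarith
      then have "z + y \<in> cball 0 (r + 1)" "z \<in> cball 0 (r + 1)"
        using nz by (auto simp only: mem_cball_0)
      moreover have "dist z (z + y) < \<delta>2" using True by (simp add: \<delta>_def dist_norm)
      ultimately have "dist (G z) (G (z + y)) < d"
        by (intro \<delta>2(2))
      then have "min (G (z + y)) (c + d) = G (z + y)" using z by (auto simp: dist_real_def)
      moreover have "\<bar>G (z + y) - p z y\<bar> \<le> \<epsilon> / 4 * (norm y)\<^sup>2"
        using \<delta>1(2)[OF nz, of y] True by (auto simp: p_def \<delta>_def)
      moreover have "0 \<le> B * (norm y) ^ 4" using B by simp
      ultimately show ?thesis by linarith
    next
      case False
      define m where "m = norm y / \<delta>"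
      have m1: "1 \<le> m" using False \<delta> by (simp add: m_def)
      have ym: "norm y \<le> m" using \<delta> mult_left_le_one_le[of "norm y" \<delta>] by (simp add: m_def pos_le_divide_eq mult.commute)
      have y: "\<bar>y$1\<bar> \<le> m" "\<bar>y$2\<bar> \<le> m"
        using component_le_norm_cart[of y 1] component_le_norm_cart[of y 2] ym by auto
      have mm: "m \<le> m ^ 4" "m\<^sup>2 \<le> m ^ 4" "1 \<le> m ^ 4"
        using m1 self_le_power[OF m1, of 4] power_increasing[OF _ m1, of 2 4] by auto
      define M where "M = min (G (z + y)) (c + d)"
      have prod: "\<bar>s * t\<bar> \<le> A * q" if "\<bar>s\<bar> \<le> A" "\<bar>t\<bar> \<le> q" for s t q
        unfolding abs_mult by (rule mult_mono[OF that A0 abs_ge_zero])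
      have yy: "\<bar>y$i * y$j\<bar> \<le> m * m" if "\<bar>y$i\<bar> \<le> m" "\<bar>y$j\<bar> \<le> m" for i j
        unfolding abs_mult using m1 by (intro mult_mono[OF that]) auto
      have "\<bar>a z * y$1\<bar> \<le> A * m" "\<bar>b z * y$2\<bar> \<le> A * m" "\<bar>u z * (y$1)\<^sup>2\<bar> \<le> A * m\<^sup>2" "\<bar>v z * (y$2)\<^sup>2\<bar> \<le> A * m\<^sup>2"
        "\<bar>w z * (y$1 * y$2)\<bar> \<le> A * m\<^sup>2"
        unfolding power2_eq_square by (intro prod yy A nz y)+
      moreover have "A * m \<le> A * m ^ 4" "A * m\<^sup>2 \<le> A * m ^ 4" using mm A0 by (auto intro: mult_left_mono)
      moreover have "2 * c + d \<le> (2 * c + d) * m ^ 4" using mm c d by simp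
      moreover have "\<bar>M\<bar> \<le> c + d" "\<bar>G z\<bar> \<le> c"
        unfolding M_def using G_pos[of "z + y"] G_pos[of z] c d z by auto
      ultimately have "\<bar>M - p z y\<bar> \<le> (2 * c + d) * m ^ 4 + 5 * (A * m ^ 4)"
        unfolding p_def abs_le_iff by linarith
      also have "\<dots> = B * (norm y) ^ 4"
        by (simp add: B_def m_def power_divide distrib_right add_divide_distrib)
      also have "\<dots> \<le> \<epsilon> / 4 * (norm y)\<^sup>2 + B * (norm y) ^ 4" using \<epsilon> by simp
      finally show ?thesis unfolding M_def .
    qed
  qed
  \<comment> \<open>Makes the quartic contribution 8 B h^2 at most \<epsilon> h / 2, the same as the
    quadratic one.\<close>
  define h0 where "h0 = \<epsilon> / (16 * B)"
  show thesis
  proof (rule that)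
    show "0 < h0" using \<epsilon> B by (simp add: h0_def)
    fix h z assume h: "0 < h" "h < h0" and z: "G z < c"
    interpret prob_space "gauss h" by (rule prob_space_gauss[OF h(1)])
    note mom = gauss_moments[OF h(1)]
    have "has_bochner_integral (gauss h)
        (\<lambda>y. G z * 1 + a z * y$1 + b z * y$2 + u z * (y$1)\<^sup>2 + v z * (y$2)\<^sup>2 + w z * (y$1 * y$2))
        (G z * 1 + a z * 0 + b z * 0 + u z * h + v z * h + w z * 0)"
      by (intro has_bochner_integral_add has_bochner_integral_mult_right mom)
    moreover have "G z * 1 + a z * 0 + b z * 0 + u z * h + v z * h + w z * 0 = G z + h * (k z * G z)"
      unfolding lap[rule_format, symmetric] by (simp add: algebra_simps)
    ultimately have p: "has_bochner_integral (gauss h) (p z) (G z + h * (k z * G z))"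
      unfolding p_def mult_1_right by metis
    have ny: "(norm y)\<^sup>2 = (y$1)\<^sup>2 + (y$2)\<^sup>2" for y :: "real^2"
      unfolding power2_norm_eq_inner inner_real_2 by (simp add: power2_eq_square)
    have "has_bochner_integral (gauss h) (\<lambda>y. \<epsilon> / 4 * ((y$1)\<^sup>2 + (y$2)\<^sup>2) + B * (norm y) ^ 4) (\<epsilon> / 4 * (h + h) + B * (8 * h\<^sup>2))"
      by (intro has_bochner_integral_add has_bochner_integral_mult_right mom)
    then have e: "has_bochner_integral (gauss h) (\<lambda>y. \<epsilon> / 4 * (norm y)\<^sup>2 + B * (norm y) ^ 4) (\<epsilon> / 4 * (h + h) + B * (8 * h\<^sup>2))"
      unfolding ny .
    have gi: "integrable (gauss h) (\<lambda>y. min (G (z + y)) (c + d))"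
    proof (rule integrable_const_bound[where B = "c + d"])
      show "AE y in gauss h. norm (min (G (z + y)) (c + d)) \<le> c + d"
        using G_pos c d by (intro AE_I2) (auto simp: less_imp_le min_def abs_of_pos)
    qed measurable
    have "norm (\<integral>y. min (G (z + y)) (c + d) - p z y \<partial>gauss h) \<le> (\<integral>y. \<epsilon> / 4 * (norm y)\<^sup>2 + B * (norm y) ^ 4 \<partial>gauss h)"
      using gi p e bound[OF z]
      by (intro Bochner_Integration.integral_norm_bound_integral) (auto simp: has_bochner_integral_iff)
    then have "\<bar>(\<integral>y. min (G (z + y)) (c + d) \<partial>gauss h) - (G z + h * (k z * G z))\<bar> \<le> \<epsilon> / 4 * (h + h) + B * (8 * h\<^sup>2)"
      using gi p e by (simp add: has_bochner_integral_iff Bochner_Integration.integral_diff)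
    also have "B * (8 * h\<^sup>2) \<le> \<epsilon> / 2 * h"
    proof -
      have "h * (16 * B) \<le> \<epsilon>" using h B by (simp add: h0_def field_simps)
      then have "h * (16 * B) * h \<le> \<epsilon> * h" using h by (intro mult_right_mono) auto
      then show ?thesis by (simp add: power2_eq_square mult_ac)
    qed
    also have "\<epsilon> / 4 * (h + h) + \<epsilon> / 2 * h = \<epsilon> * h" by (simp add: field_simps)
    finally show "\<bar>(\<integral>y. min (G (z + y)) (c + d) \<partial>gauss h) - (G z + h * (k z * G z))\<bar> \<le> \<epsilon> * h" by simp
  qed
qed

text \<open>Compactness of the sublevel set. The bound serves twice: it pays for the error of each
  step, and it makes the surviving weight decay with time.\<close>

lemma killing_lower_bound:
  obtains \<kappa> where "0 < \<kappa>" "\<And>z. G z \<le> c \<Longrightarrow> \<kappa> \<le> k z"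
proof (cases "{z. G z \<le> c} = {}")
  case True
  then show ?thesis using that[of 1] by auto
next
  case False
  have "continuous_on {z. G z \<le> c} k" using k_cont by (rule continuous_on_subset) auto
  from continuous_attains_inf[OF compact_sublevel False this] obtain z where
    "\<And>y. G y \<le> c \<Longrightarrow> k z \<le> k y" by auto
  then show ?thesis using that[of "k z"] k_pos by blast
qed

definition trunc :: "real \<Rightarrow> real \<Rightarrow> real ^ 2 \<Rightarrow> real"
  where "trunc c d z = min (G z) (c + d)"

lemma trunc_measurable [measurable]: "trunc c d \<in> borel_measurable borel"
  unfolding trunc_def[abs_def] by measurable

lemma trunc_bounds: "0 < c \<Longrightarrow> 0 < d \<Longrightarrow> 0 < trunc c d z" "trunc c d z \<le> c + d"
  using G_pos[of z] by (auto simp: trunc_def)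

lemma integrable_trunc:
  assumes "0 < h" "0 < c" "0 < d"
  shows "integrable (gauss h) (\<lambda>y. trunc c d (z + y))"
proof -
  interpret prob_space "gauss h" by (rule prob_space_gauss[OF assms(1)])
  show ?thesis
  proof (rule integrable_const_bound[where B = "c + d"])
    show "AE y in gauss h. norm (trunc c d (z + y)) \<le> c + d"
      using trunc_bounds(1)[OF assms(2,3)] trunc_bounds(2)[of c d] by (intro AE_I2) (auto simp: abs_of_pos)
  qed measurable
qed

text \<open>Adding a constant, which is strictly superharmonic for the killed motion, absorbs the \<open>o(h)\<close> error.\<close>

lemma superharmonic_step:
  assumes c: "0 < c" and d: "0 < d"
  obtains h0 where "0 < h0"
    "\<And>h z. 0 < h \<Longrightarrow> h < h0 \<Longrightarrow> G z < c \<Longrightarrow>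
      exp (- h * k z) * (\<integral>y. (trunc c d (z + y) + d) / c \<partial>gauss h) \<le> (trunc c d z + d) / c"
proof -
  obtain \<kappa> where \<kappa>: "0 < \<kappa>" "\<And>z. G z \<le> c \<Longrightarrow> \<kappa> \<le> k z" using killing_lower_bound by blast
  obtain h0 where h0: "0 < h0" "\<And>h z. 0 < h \<Longrightarrow> h < h0 \<Longrightarrow> G z < c \<Longrightarrow>
      \<bar>(\<integral>y. min (G (z + y)) (c + d) \<partial>gauss h) - (G z + h * (k z * G z))\<bar> \<le> d * \<kappa> * h"
    using truncated_expansion[OF c d, of "d * \<kappa>"] d \<kappa> by auto
  show thesis
  proof (rule that[OF h0(1)])
    fix h z assume h: "0 < h" "h < h0" and z: "G z < c"
    interpret prob_space "gauss h" by (rule prob_space_gauss[OF h(1)])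
    define t where "t = h * k z"
    have tG: "t * G z = h * (k z * G z)" by (simp add: t_def)
    have t: "1 + t \<le> exp t" by (rule exp_ge_add_one_self)
    have "h * \<kappa> \<le> t" unfolding t_def using \<kappa>(2)[of z] z h by (intro mult_left_mono) auto
    then have dt: "d * \<kappa> * h \<le> d * t" using d by (simp add: mult_ac)
    have I: "(\<integral>y. (trunc c d (z + y) + d) / c \<partial>gauss h) = ((\<integral>y. trunc c d (z + y) \<partial>gauss h) + d) / c"
      using integrable_trunc[OF h(1) c d] by (simp add: Bochner_Integration.integral_add prob_space[simplified])
    have "(\<integral>y. trunc c d (z + y) \<partial>gauss h) + d \<le> G z + t * G z + d * \<kappa> * h + d"
      using h0(2)[OF h z] unfolding trunc_def tG abs_le_iff by linarith
    also have "\<dots> \<le> (1 + t) * (G z + d)" using dt by (simp add: algebra_simps)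
    also have "\<dots> \<le> exp t * (G z + d)" using t G_pos[of z] d by (intro mult_right_mono) auto
    finally have "exp (- t) * ((\<integral>y. trunc c d (z + y) \<partial>gauss h) + d) \<le> G z + d"
      by (simp add: exp_minus field_simps)
    moreover have "trunc c d z = G z" using z d by (simp add: trunc_def)
    ultimately show "exp (- h * k z) * (\<integral>y. (trunc c d (z + y) + d) / c \<partial>gauss h) \<le> (trunc c d z + d) / c"
      unfolding I t_def using c by (simp add: divide_right_mono)
  qed
qed

text \<open>Mirror image of \<open>superharmonic_step\<close>: subtracting d leaves a surplus d t
  with t = h k z. Since exp t now has to be bounded from above, half of the surplus pays for the
  expansion error and half for the quadratic term t^2 c.\<close>

lemma subharmonic_step:
  assumes c: "0 < c" and d: "0 < d"
  obtains h0 where "0 < h0"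
    "\<And>h z. 0 < h \<Longrightarrow> h < h0 \<Longrightarrow> G z < c \<Longrightarrow>
      (trunc c d z - d) / c \<le> exp (- h * k z) * (\<integral>y. (trunc c d (z + y) - d) / c \<partial>gauss h)"
proof -
  obtain \<kappa> where \<kappa>: "0 < \<kappa>" "\<And>z. G z \<le> c \<Longrightarrow> \<kappa> \<le> k z" using killing_lower_bound by blast
  obtain h0 where h0: "0 < h0" "\<And>h z. 0 < h \<Longrightarrow> h < h0 \<Longrightarrow> G z < c \<Longrightarrow>
      \<bar>(\<integral>y. min (G (z + y)) (c + d) \<partial>gauss h) - (G z + h * (k z * G z))\<bar> \<le> d * \<kappa> / 2 * h"
    using truncated_expansion[OF c d, of "d * \<kappa> / 2"] d \<kappa> by auto
  \<comment> \<open>h <= 1 makes t <= 1 for the exponential bound; the last bound makes h^2 c at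
    most d \<kappa> h / 2.\<close>
  define h1 where "h1 = min h0 (min 1 (d * \<kappa> / (2 * c)))"
  have h1: "0 < h1" using h0(1) c d \<kappa>(1) by (simp add: h1_def)
  show thesis
  proof (rule that[OF h1])
    fix h z assume h: "0 < h" "h < h1" and z: "G z < c"
    then have h': "h < h0" "h \<le> 1" "h \<le> d * \<kappa> / (2 * c)" by (auto simp: h1_def)
    interpret prob_space "gauss h" by (rule prob_space_gauss[OF h(1)])
    define t where "t = h * k z"
    have tG: "t * G z = h * (k z * G z)" by (simp add: t_def)
    have t01: "0 \<le> t" "t \<le> 1" using h h' k_pos[of z] k_le_1[of z] by (auto simp: t_def mult_le_one less_imp_le)
    have th: "t \<le> h" using h k_le_1[of z] by (simp add: t_def mult_left_le)
    have "h * \<kappa> \<le> t" unfolding t_def using \<kappa>(2)[of z] z h by (intro mult_left_mono) auto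
    then have dt: "d * \<kappa> * h \<le> d * t" using d by (simp add: mult_ac)
    have I: "(\<integral>y. (trunc c d (z + y) - d) / c \<partial>gauss h) = ((\<integral>y. trunc c d (z + y) \<partial>gauss h) - d) / c"
      using integrable_trunc[OF h(1) c d] by (simp add: Bochner_Integration.integral_diff prob_space[simplified])
    have "exp t * (G z - d) \<le> (1 + t) * (G z - d) + t\<^sup>2 * c"
    \<comment> \<open>When G z - d is negative, 1 + t <= exp t already points in the right
      direction.\<close>
    proof (cases "d \<le> G z")
      case True
      have "exp t * (G z - d) \<le> (1 + t + t\<^sup>2) * (G z - d)"
        using exp_bound[OF t01] True by (intro mult_right_mono) auto
      also have "\<dots> = (1 + t) * (G z - d) + t\<^sup>2 * (G z - d)" by (simp add: distrib_right)
      also have "t\<^sup>2 * (G z - d) \<le> t\<^sup>2 * c" using z d by (intro mult_left_mono) auto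
      finally show ?thesis by simp
    next
      case False
      then have "exp t * (G z - d) \<le> (1 + t) * (G z - d)"
        using exp_ge_add_one_self[of t] by (intro mult_right_mono_neg) auto
      moreover have "0 \<le> t\<^sup>2 * c" using c by simp
      ultimately show ?thesis by linarith
    qed
    also have "\<dots> \<le> G z + t * G z - d * \<kappa> / 2 * h - d"
    proof -
      have "t\<^sup>2 * c \<le> h * h * c" using th t01 c unfolding power2_eq_square by (intro mult_mono mult_right_mono) auto
      also have "\<dots> \<le> (d * \<kappa> / (2 * c)) * h * c" using h' h c by (intro mult_right_mono) auto
      also have "\<dots> = d * \<kappa> / 2 * h" using c by simp
      finally show ?thesis using dt by (simp add: algebra_simps)
    qed
    also have "\<dots> \<le> (\<integral>y. trunc c d (z + y) \<partial>gauss h) - d"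
      using h0(2)[OF h(1) h'(1) z] unfolding trunc_def tG abs_le_iff by linarith
    finally have "G z - d \<le> exp (- t) * ((\<integral>y. trunc c d (z + y) \<partial>gauss h) - d)"
      by (simp add: exp_minus field_simps)
    moreover have "trunc c d z = G z" using z d by (simp add: trunc_def)
    ultimately show "(trunc c d z - d) / c \<le> exp (- h * k z) * (\<integral>y. (trunc c d (z + y) - d) / c \<partial>gauss h)"
      unfolding I t_def using c by (simp add: divide_right_mono)
  qed
qed

end

section \<open>Hitting probabilities of the killed Gaussian walk\<close>

text \<open>The killing is averaged out along a fixed sequence: \<open>alive\<close> is the weight
  of having neither been killed nor met F through step j, \<open>hit\<close> that of having met F
  before being killed. As functionals of X alone they can be evaluated on the walk and on the
  Brownian path at grid times.\<close>

primrec alive :: "real \<Rightarrow> ('b \<Rightarrow> real) \<Rightarrow> 'b set \<Rightarrow> (nat \<Rightarrow> 'b) \<Rightarrow> nat \<Rightarrow> real"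
  where
    "alive h k F X 0 = (if X 0 \<in> F then 0 else 1)"
  | "alive h k F X (Suc j) = (if X (Suc j) \<in> F then 0 else alive h k F X j * exp (- h * k (X j)))"

primrec hit :: "real \<Rightarrow> ('b \<Rightarrow> real) \<Rightarrow> 'b set \<Rightarrow> (nat \<Rightarrow> 'b) \<Rightarrow> nat \<Rightarrow> real"
  where
    "hit h k F X 0 = (if X 0 \<in> F then 1 else 0)"
  | "hit h k F X (Suc j) = hit h k F X j + (if X (Suc j) \<in> F then alive h k F X j * exp (- h * k (X j)) else 0)"

lemma alive_cong: "(\<And>i. i \<le> j \<Longrightarrow> X i = X' i) \<Longrightarrow> alive h k F X j = alive h k F X' j"
  by (induction j) auto

lemma alive_eq_0: "X j \<in> F \<Longrightarrow> alive h k F X j = 0"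
  by (cases j) auto

lemma alive_nonneg: "0 \<le> alive h k F X j"
  by (induction j) auto

lemma alive_le_exp:
  assumes "0 \<le> h" "\<And>z. z \<notin> F \<Longrightarrow> \<kappa> \<le> k z"
  shows "alive h k F X j \<le> exp (- \<kappa> * (h * real j))"
proof (induction j)
  case (Suc j)
  show ?case
  proof (cases "X j \<in> F")
    case True
    then show ?thesis by (simp add: alive_eq_0)
  next
    case False
    then have "h * \<kappa> \<le> h * k (X j)" using assms by (intro mult_left_mono) auto
    then have "alive h k F X j * exp (- h * k (X j)) \<le> exp (- \<kappa> * (h * real j)) * exp (- h * \<kappa>)"
      using Suc by (intro mult_mono) auto
    also have "\<dots> = exp (- \<kappa> * (h * real (Suc j)))"
      by (simp add: exp_add[symmetric] algebra_simps)
    finally show ?thesis by simp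
  qed
qed simp

lemma alive_le_1:
  assumes "0 \<le> h" "\<And>z. 0 \<le> k z"
  shows "alive h k F X j \<le> 1"
  using alive_le_exp[of h F 0 k X j] assms by simp

text \<open>Solves both recursions through the first entrance m into F; the exponents are left
  Riemann sums of the clock.\<close>

lemma alive_hit_cases:
  "(\<forall>i\<le>j. X i \<notin> F) \<and> alive h k F X j = exp (- h * (\<Sum>i<j. k (X i))) \<and> hit h k F X j = 0 \<or>
   (\<exists>m\<le>j. X m \<in> F \<and> (\<forall>i<m. X i \<notin> F) \<and> alive h k F X j = 0 \<and> hit h k F X j = exp (- h * (\<Sum>i<m. k (X i))))"
proof (induction j)
  case 0
  show ?case by auto
next
  case (Suc j)
  from Suc.IH show ?case
  proof (elim disjE conjE exE)
    assume a: "\<forall>i\<le>j. X i \<notin> F" "alive h k F X j = exp (- h * (\<Sum>i<j. k (X i)))" "hit h k F X j = 0"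
    have s: "exp (- h * (\<Sum>i<j. k (X i))) * exp (- h * k (X j)) = exp (- h * (\<Sum>i<Suc j. k (X i)))"
      by (simp add: exp_add[symmetric] algebra_simps)
    show ?thesis
    proof (cases "X (Suc j) \<in> F")
      case True
      have "\<forall>i<Suc j. X i \<notin> F" using a(1) by (simp add: less_Suc_eq_le)
      moreover have "alive h k F X (Suc j) = 0 \<and> hit h k F X (Suc j) = exp (- h * (\<Sum>i<Suc j. k (X i)))"
        using True a(2,3) s by (simp del: sum.lessThan_Suc)
      ultimately show ?thesis using True by blast
    next
      case False
      have "\<forall>i\<le>Suc j. X i \<notin> F" using a(1) False by (simp add: le_Suc_eq)
      moreover have "alive h k F X (Suc j) = exp (- h * (\<Sum>i<Suc j. k (X i))) \<and> hit h k F X (Suc j) = 0"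
        using False a(2,3) s by (simp del: sum.lessThan_Suc)
      ultimately show ?thesis by blast
    qed
  next
    fix m assume m: "m \<le> j" "X m \<in> F" "\<forall>i<m. X i \<notin> F" "alive h k F X j = 0"
      "hit h k F X j = exp (- h * (\<Sum>i<m. k (X i)))"
    then have "alive h k F X (Suc j) = 0 \<and> hit h k F X (Suc j) = exp (- h * (\<Sum>i<m. k (X i)))" by simp
    moreover have "m \<le> Suc j" using m by simp
    ultimately show ?thesis using m by blast
  qed
qed

lemma hit_nonneg: "0 \<le> hit h k F X j"
  using alive_hit_cases[of j X F h k] by auto

lemma hit_le_1:
  assumes "0 \<le> h" "\<And>z. 0 \<le> k z"
  shows "hit h k F X j \<le> 1"
  using alive_hit_cases[of j X F h k] assms by (auto simp: sum_nonneg)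

lemma hit_ge:
  assumes "0 \<le> h" "\<And>z. 0 \<le> k z" and j: "j \<le> N" "X j \<in> F"
  shows "exp (- h * (\<Sum>i<j. k (X i))) \<le> hit h k F X N"
proof -
  obtain m where m: "m \<le> N" "X m \<in> F" "\<forall>i<m. X i \<notin> F" "hit h k F X N = exp (- h * (\<Sum>i<m. k (X i)))"
    using alive_hit_cases[of N X F h k] j by blast
  then have "m \<le> j" using j by (meson not_le)
  then have "(\<Sum>i<m. k (X i)) \<le> (\<Sum>i<j. k (X i))" using assms by (intro sum_mono2) auto
  then show ?thesis using m assms by (simp add: mult_left_mono)
qed

lemma hit_pos_obtains:
  assumes "0 < hit h k F X N"
  obtains m where "m \<le> N" "X m \<in> F" "hit h k F X N = exp (- h * (\<Sum>i<m. k (X i)))"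
  using alive_hit_cases[of N X F h k] assms by auto

lemma measurable_alive [measurable]:
  fixes X :: "nat \<Rightarrow> 'a \<Rightarrow> 'b :: topological_space" and k :: "'b \<Rightarrow> real"
  assumes [measurable]: "\<And>i. X i \<in> measurable M borel" "k \<in> borel_measurable borel" "F \<in> sets borel"
  shows "(\<lambda>\<omega>. alive h k F (\<lambda>i. X i \<omega>) j) \<in> borel_measurable M"
  by (induction j) simp_all

lemma measurable_hit [measurable]:
  fixes X :: "nat \<Rightarrow> 'a \<Rightarrow> 'b :: topological_space" and k :: "'b \<Rightarrow> real"
  assumes [measurable]: "\<And>i. X i \<in> measurable M borel" "k \<in> borel_measurable borel" "F \<in> sets borel"
  shows "(\<lambda>\<omega>. hit h k F (\<lambda>i. X i \<omega>) j) \<in> borel_measurable M"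
  by (induction j) simp_all

text \<open>Fubini for the joint law, which independence makes a product. Both the Markov property
  of the walk and the integration over the clock take this form.\<close>

lemma (in prob_space) indep_var_expectation:
  fixes f :: "'b \<times> 'b \<Rightarrow> real"
  assumes ind: "indep_var S X T Y" and f: "f \<in> borel_measurable (S \<Otimes>\<^sub>M T)" and B: "\<And>p. \<bar>f p\<bar> \<le> B"
  shows "expectation (\<lambda>\<omega>. f (X \<omega>, Y \<omega>)) = expectation (\<lambda>\<omega>. \<integral>y. f (X \<omega>, y) \<partial>distr M T Y)"
proof -
  note rv = indep_var_rv1[OF ind] indep_var_rv2[OF ind]
  interpret X: prob_space "distr M S X" by (rule prob_space_distr[OF rv(1)])
  interpret Y: prob_space "distr M T Y" by (rule prob_space_distr[OF rv(2)])
  interpret XY: pair_prob_space "distr M S X" "distr M T Y" ..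
  have f': "f \<in> borel_measurable (distr M S X \<Otimes>\<^sub>M distr M T Y)"
    using f by (simp cong: measurable_cong_sets sets_pair_measure_cong)
  have int: "integrable (distr M S X \<Otimes>\<^sub>M distr M T Y) f"
    by (rule XY.P.integrable_const_bound[where B = B]) (use B f' in auto)
  have "expectation (\<lambda>\<omega>. f (X \<omega>, Y \<omega>)) = (\<integral>p. f p \<partial>distr M (S \<Otimes>\<^sub>M T) (\<lambda>\<omega>. (X \<omega>, Y \<omega>)))"
    using rv f by (subst integral_distr) auto
  also have "\<dots> = (\<integral>p. f p \<partial>(distr M S X \<Otimes>\<^sub>M distr M T Y))"
    using ind unfolding indep_var_distribution_eq by simp
  also have "\<dots> = (\<integral>x. \<integral>y. f (x, y) \<partial>distr M T Y \<partial>distr M S X)"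
    using XY.integral_fst'[OF int] by simp
  also have "\<dots> = expectation (\<lambda>\<omega>. \<integral>y. f (X \<omega>, y) \<partial>distr M T Y)"
    using rv f by (subst integral_distr) (auto intro!: Y.borel_measurable_lebesgue_integral simp: measurable_distr_eq1)
  finally show ?thesis .
qed

section \<open>Markov property and martingale bounds for the killed walk\<close>

locale gaussian_walk = prob_space M for M :: "'w measure" +
  fixes \<Delta> :: "nat \<Rightarrow> 'w \<Rightarrow> real ^ 2" and x :: "real ^ 2" and h :: real and N :: nat
  assumes h_pos: "0 < h"
    and indep_steps: "indep_vars (\<lambda>_. borel) \<Delta> {..<N}"
    and step_law: "\<And>j. j < N \<Longrightarrow> distr M borel (\<Delta> j) = gauss h"
    and step_measurable [measurable]: "\<And>j. \<Delta> j \<in> borel_measurable M"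
begin

definition pos :: "nat \<Rightarrow> 'w \<Rightarrow> real ^ 2"
  where "pos j \<omega> = x + (\<Sum>i<j. \<Delta> i \<omega>)"

lemma pos_measurable [measurable]: "pos j \<in> borel_measurable M"
  unfolding pos_def[abs_def] by measurable

context
  fixes k :: "real ^ 2 \<Rightarrow> real" and F :: "(real ^ 2) set" and u :: "real ^ 2 \<Rightarrow> real" and b :: real
  assumes k_meas [measurable]: "k \<in> borel_measurable borel" and k_nonneg: "\<And>z. 0 \<le> k z"
    and F_meas [measurable]: "F \<in> sets borel"
    and u_meas [measurable]: "u \<in> borel_measurable borel" and u_bound: "\<And>z. \<bar>u z\<bar> \<le> b"
begin

abbreviation "al j \<omega> \<equiv> alive h k F (\<lambda>i. pos i \<omega>) j"
abbreviation "ht j \<omega> \<equiv> hit h k F (\<lambda>i. pos i \<omega>) j"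

lemma alive_step_bounds: "0 \<le> alive h k F X j * exp (- h * k z)" "alive h k F X j * exp (- h * k z) \<le> 1"
proof -
  have "h * k z \<ge> 0" using h_pos k_nonneg by simp
  then have "alive h k F X j * exp (- h * k z) \<le> 1 * 1"
    using alive_le_1[of h k] h_pos k_nonneg by (intro mult_mono) (auto simp: alive_nonneg)
  then show "alive h k F X j * exp (- h * k z) \<le> 1" by simp
qed (simp add: alive_nonneg)

text \<open>Markov property at step j: the past is a function of the first j increments, and the
  next increment is independent of them with law \<open>gauss h\<close>.\<close>

lemma walk_step_expectation:
  assumes j: "j < N"
  shows "expectation (\<lambda>\<omega>. al j \<omega> * exp (- h * k (pos j \<omega>)) * u (pos (Suc j) \<omega>)) =
    expectation (\<lambda>\<omega>. al j \<omega> * exp (- h * k (pos j \<omega>)) * (\<integral>y. u (pos j \<omega> + y) \<partial>gauss h))"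
proof -
  define W where "W = (\<lambda>\<omega>. restrict (\<lambda>i. \<Delta> i \<omega>) {..<j})"
  \<comment> \<open>\<open>min i j\<close> makes every position, also for i > j, a measurable
    function of the first j increments.\<close>
  define Y where "Y = (\<lambda>i (w :: nat \<Rightarrow> real^2). x + (\<Sum>l<min i j. w l))"
  define V where "V = (\<lambda>w. alive h k F (\<lambda>i. Y i w) j * exp (- h * k (Y j w)))"
  define f where "f = (\<lambda>(w, w'). V w * u (Y j w + w' j))"
  define U where "U = (\<lambda>\<omega>. restrict (\<lambda>i. \<Delta> i \<omega>) {j})"
  have ind: "indep_var (PiM {..<j} (\<lambda>_. borel)) W (PiM {j} (\<lambda>_. borel)) U"
    unfolding W_def U_def using j by (intro indep_var_restrict[OF indep_steps]) auto
  have U_meas [measurable]: "U \<in> measurable M (PiM {j} (\<lambda>_. borel))"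
    by (rule indep_var_rv2[OF ind])
  have Y_meas [measurable]: "Y i \<in> borel_measurable (PiM {..<j} (\<lambda>_. borel))" for i
    unfolding Y_def by (intro borel_measurable_add borel_measurable_const borel_measurable_sum measurable_component_singleton) auto
  have V_meas [measurable]: "V \<in> borel_measurable (PiM {..<j} (\<lambda>_. borel))"
    unfolding V_def by measurable
  have [measurable]: "(\<lambda>w'. w' j) \<in> measurable (PiM {j} (\<lambda>_. borel)) (borel :: (real^2) measure)"
    by (rule measurable_component_singleton) simp
  have f_meas: "f \<in> borel_measurable (PiM {..<j} (\<lambda>_. borel) \<Otimes>\<^sub>M PiM {j} (\<lambda>_. borel))"
    unfolding f_def by measurable
  have fb: "\<bar>f p\<bar> \<le> b" for p
  proof -
    have "\<bar>V (fst p)\<bar> * \<bar>u (Y j (fst p) + snd p j)\<bar> \<le> 1 * b"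
      using alive_step_bounds u_bound unfolding V_def by (intro mult_mono) (auto simp: abs_le_iff)
    then show ?thesis by (simp add: f_def split_beta abs_mult)
  qed
  have YW: "Y i (W \<omega>) = pos i \<omega>" if "i \<le> j" for i \<omega>
    using that by (simp add: Y_def W_def pos_def min_def)
  have VW: "V (W \<omega>) = al j \<omega> * exp (- h * k (pos j \<omega>))" for \<omega>
  proof -
    have "alive h k F (\<lambda>i. Y i (W \<omega>)) j = al j \<omega>" by (intro alive_cong YW)
    then show ?thesis by (simp add: V_def YW)
  qed
  have pos_Suc: "pos (Suc j) \<omega> = pos j \<omega> + \<Delta> j \<omega>" for \<omega> by (simp add: pos_def add.assoc)
  have "(\<integral>y. f (W \<omega>, y) \<partial>distr M (PiM {j} (\<lambda>_. borel)) U) = V (W \<omega>) * (\<integral>y. u (Y j (W \<omega>) + y) \<partial>gauss h)" for \<omega>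
  proof -
    have "(\<integral>y. u (Y j (W \<omega>) + y j) \<partial>distr M (PiM {j} (\<lambda>_. borel)) U) = expectation (\<lambda>\<omega>'. u (Y j (W \<omega>) + U \<omega>' j))"
      by (subst integral_distr) auto
    also have "\<dots> = (\<integral>y. u (Y j (W \<omega>) + y) \<partial>distr M borel (\<Delta> j))"
      by (subst integral_distr) (auto simp: U_def)
    finally show ?thesis unfolding step_law[OF j] by (simp add: f_def)
  qed
  moreover have "expectation (\<lambda>\<omega>. f (W \<omega>, U \<omega>)) =
      expectation (\<lambda>\<omega>. \<integral>y. f (W \<omega>, y) \<partial>distr M (PiM {j} (\<lambda>_. borel)) U)"
    by (rule indep_var_expectation[OF ind f_meas fb])
  moreover have "f (W \<omega>, U \<omega>) = V (W \<omega>) * u (Y j (W \<omega>) + \<Delta> j \<omega>)" for \<omega>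
    by (simp add: f_def U_def)
  ultimately show ?thesis
    unfolding VW YW[OF order_refl] pos_Suc by simp
qed

lemma integrable_walk:
  "integrable M (\<lambda>\<omega>. ht j \<omega>)"
  "integrable M (\<lambda>\<omega>. al j \<omega>)"
  "integrable M (\<lambda>\<omega>. al j \<omega> * u (pos j \<omega>))"
  "integrable M (\<lambda>\<omega>. al j \<omega> * exp (- h * k (pos j \<omega>)) * u (pos (Suc j) \<omega>))"
  "integrable M (\<lambda>\<omega>. al j \<omega> * exp (- h * k (pos j \<omega>)) * (\<integral>y. u (pos j \<omega> + y) \<partial>gauss h))"
proof -
  interpret g: prob_space "gauss h" by (rule prob_space_gauss[OF h_pos])
  have b0: "0 \<le> b" by (rule order_trans[OF abs_ge_zero u_bound[of 0]])
  have a: "0 \<le> al j \<omega>" "al j \<omega> \<le> 1" for \<omega>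
    using alive_nonneg alive_le_1[of h k] h_pos k_nonneg by auto
  show "integrable M (\<lambda>\<omega>. ht j \<omega>)"
    using hit_nonneg[of h k F] hit_le_1[of h k F] h_pos k_nonneg
    by (intro integrable_const_bound[where B = 1] AE_I2) (simp_all add: abs_of_nonneg)
  show "integrable M (\<lambda>\<omega>. al j \<omega>)"
    using a by (intro integrable_const_bound[where B = 1]) auto
  have "\<bar>al j \<omega> * u (pos j \<omega>)\<bar> \<le> 1 * b" for \<omega>
    unfolding abs_mult using a u_bound b0 by (intro mult_mono) (auto simp: abs_le_iff)
  then show "integrable M (\<lambda>\<omega>. al j \<omega> * u (pos j \<omega>))"
    by (intro integrable_const_bound[where B = b]) auto
  have "\<bar>al j \<omega> * exp (- h * k (pos j \<omega>)) * u (pos (Suc j) \<omega>)\<bar> \<le> 1 * b" for \<omega>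
    unfolding abs_mult[of _ "u _"] using alive_step_bounds u_bound b0 by (intro mult_mono) (auto simp: abs_le_iff)
  then show "integrable M (\<lambda>\<omega>. al j \<omega> * exp (- h * k (pos j \<omega>)) * u (pos (Suc j) \<omega>))"
    by (intro integrable_const_bound[where B = b]) auto
  have "\<bar>\<integral>y. u (z + y) \<partial>gauss h\<bar> \<le> b" for z
  proof -
    have "norm (\<integral>y. u (z + y) \<partial>gauss h) \<le> (\<integral>y. b \<partial>gauss h)"
      using u_bound b0
      by (intro Bochner_Integration.integral_norm_bound_integral g.integrable_const_bound[where B = b]) auto
    then show ?thesis by (simp add: g.prob_space[simplified])
  qed
  then have "\<bar>al j \<omega> * exp (- h * k (pos j \<omega>)) * (\<integral>y. u (pos j \<omega> + y) \<partial>gauss h)\<bar> \<le> 1 * b" for \<omega>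
    unfolding abs_mult[of _ "integral\<^sup>L _ _"] using alive_step_bounds b0 by (intro mult_mono) (auto simp: abs_le_iff)
  moreover have "(\<lambda>z. \<integral>y. u (z + y) \<partial>gauss h) \<in> borel_measurable borel"
    by (rule g.borel_measurable_lebesgue_integral) measurable
  then have "(\<lambda>\<omega>. \<integral>y. u (pos j \<omega> + y) \<partial>gauss h) \<in> borel_measurable M"
    using measurable_compose[OF pos_measurable] by auto
  ultimately show "integrable M (\<lambda>\<omega>. al j \<omega> * exp (- h * k (pos j \<omega>)) * (\<integral>y. u (pos j \<omega> + y) \<partial>gauss h))"
    by (intro integrable_const_bound[where B = b]) auto
qed

text \<open>The mean of ht j + al j * u (pos j) does not increase: off F by superharmonicity, and on
  entering F because the collected weight is multiplied by 1 <= u. It starts at u x, and its second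
  summand is nonnegative at the horizon.\<close>

lemma walk_hit_upper:
  assumes super: "\<And>z. z \<notin> F \<Longrightarrow> exp (- h * k z) * (\<integral>y. u (z + y) \<partial>gauss h) \<le> u z"
    and u_ge: "\<And>z. z \<in> F \<Longrightarrow> 1 \<le> u z" and u_nonneg: "\<And>z. 0 \<le> u z" and x: "x \<notin> F"
  shows "expectation (ht N) \<le> u x"
proof -
  have "expectation (\<lambda>\<omega>. ht j \<omega> + al j \<omega> * u (pos j \<omega>)) \<le> u x" if "j \<le> N" for j
    using that
  proof (induction j)
    case 0
    show ?case using x by (simp add: pos_def prob_space)
  next
    case (Suc j)
    have "expectation (\<lambda>\<omega>. ht (Suc j) \<omega> + al (Suc j) \<omega> * u (pos (Suc j) \<omega>))
        \<le> expectation (\<lambda>\<omega>. ht j \<omega> + al j \<omega> * exp (- h * k (pos j \<omega>)) * u (pos (Suc j) \<omega>))"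
    proof (rule integral_mono)
      fix \<omega>
      have "al j \<omega> * exp (- h * k (pos j \<omega>)) * 1 \<le> al j \<omega> * exp (- h * k (pos j \<omega>)) * u (pos (Suc j) \<omega>)"
        if "pos (Suc j) \<omega> \<in> F"
        using u_ge[OF that] alive_step_bounds by (intro mult_left_mono) auto
      then show "ht (Suc j) \<omega> + al (Suc j) \<omega> * u (pos (Suc j) \<omega>)
          \<le> ht j \<omega> + al j \<omega> * exp (- h * k (pos j \<omega>)) * u (pos (Suc j) \<omega>)"
        by simp
    qed (intro Bochner_Integration.integrable_add integrable_walk)+
    also have "\<dots> = expectation (\<lambda>\<omega>. ht j \<omega>) + expectation (\<lambda>\<omega>. al j \<omega> * exp (- h * k (pos j \<omega>)) * u (pos (Suc j) \<omega>))"
      by (intro Bochner_Integration.integral_add integrable_walk)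
    also have "expectation (\<lambda>\<omega>. al j \<omega> * exp (- h * k (pos j \<omega>)) * u (pos (Suc j) \<omega>))
       = expectation (\<lambda>\<omega>. al j \<omega> * exp (- h * k (pos j \<omega>)) * (\<integral>y. u (pos j \<omega> + y) \<partial>gauss h))"
      using Suc.prems by (intro walk_step_expectation) auto
    also have "expectation (\<lambda>\<omega>. ht j \<omega>) + \<dots> \<le> expectation (\<lambda>\<omega>. ht j \<omega>) + expectation (\<lambda>\<omega>. al j \<omega> * u (pos j \<omega>))"
    proof (rule add_left_mono, rule integral_mono)
      fix \<omega>
      show "al j \<omega> * exp (- h * k (pos j \<omega>)) * (\<integral>y. u (pos j \<omega> + y) \<partial>gauss h) \<le> al j \<omega> * u (pos j \<omega>)"
      proof (cases "pos j \<omega> \<in> F")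
        case True
        then show ?thesis by (simp add: alive_eq_0)
      next
        case False
        from mult_left_mono[OF super[OF this] alive_nonneg[of h k F "\<lambda>i. pos i \<omega>" j]]
        show ?thesis by (simp add: mult.assoc)
      qed
    qed (intro integrable_walk)+
    also have "\<dots> = expectation (\<lambda>\<omega>. ht j \<omega> + al j \<omega> * u (pos j \<omega>))"
      by (intro Bochner_Integration.integral_add[symmetric] integrable_walk)
    also have "\<dots> \<le> u x" using Suc by simp
    finally show ?case by simp
  qed
  moreover have "expectation (ht N) \<le> expectation (\<lambda>\<omega>. ht N \<omega> + al N \<omega> * u (pos N \<omega>))"
    by (intro integral_mono Bochner_Integration.integrable_add integrable_walk)
       (auto simp: alive_nonneg u_nonneg)
  ultimately show ?thesis by force
qed

text \<open>The same functional has nondecreasing mean. Discarding the part still alive at the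
  horizon costs at most the exponential term, since u <= 1 and the weight decays at rate \<kappa>
  outside F.\<close>

lemma walk_hit_lower:
  assumes sub: "\<And>z. z \<notin> F \<Longrightarrow> u z \<le> exp (- h * k z) * (\<integral>y. u (z + y) \<partial>gauss h)"
    and u_le: "\<And>z. u z \<le> 1" and x: "x \<notin> F" and \<kappa>: "\<And>z. z \<notin> F \<Longrightarrow> \<kappa> \<le> k z"
  shows "u x - exp (- \<kappa> * (h * real N)) \<le> expectation (ht N)"
proof -
  have "u x \<le> expectation (\<lambda>\<omega>. ht j \<omega> + al j \<omega> * u (pos j \<omega>))" if "j \<le> N" for j
    using that
  proof (induction j)
    case 0
    show ?case using x by (simp add: pos_def prob_space)
  next
    case (Suc j)
    then have "u x \<le> expectation (\<lambda>\<omega>. ht j \<omega> + al j \<omega> * u (pos j \<omega>))" by simp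
    also have "\<dots> = expectation (\<lambda>\<omega>. ht j \<omega>) + expectation (\<lambda>\<omega>. al j \<omega> * u (pos j \<omega>))"
      by (intro Bochner_Integration.integral_add integrable_walk)
    also have "\<dots> \<le> expectation (\<lambda>\<omega>. ht j \<omega>) + expectation (\<lambda>\<omega>. al j \<omega> * exp (- h * k (pos j \<omega>)) * (\<integral>y. u (pos j \<omega> + y) \<partial>gauss h))"
    proof (rule add_left_mono, rule integral_mono)
      fix \<omega>
      show "al j \<omega> * u (pos j \<omega>) \<le> al j \<omega> * exp (- h * k (pos j \<omega>)) * (\<integral>y. u (pos j \<omega> + y) \<partial>gauss h)"
      proof (cases "pos j \<omega> \<in> F")
        case True
        then show ?thesis by (simp add: alive_eq_0)
      next
        case False
        from mult_left_mono[OF sub[OF this] alive_nonneg[of h k F "\<lambda>i. pos i \<omega>" j]]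
        show ?thesis by (simp add: mult.assoc)
      qed
    qed (intro integrable_walk)+
    also have "expectation (\<lambda>\<omega>. al j \<omega> * exp (- h * k (pos j \<omega>)) * (\<integral>y. u (pos j \<omega> + y) \<partial>gauss h))
       = expectation (\<lambda>\<omega>. al j \<omega> * exp (- h * k (pos j \<omega>)) * u (pos (Suc j) \<omega>))"
      using Suc.prems by (intro walk_step_expectation[symmetric]) auto
    also have "expectation (\<lambda>\<omega>. ht j \<omega>) + expectation (\<lambda>\<omega>. al j \<omega> * exp (- h * k (pos j \<omega>)) * u (pos (Suc j) \<omega>))
       = expectation (\<lambda>\<omega>. ht j \<omega> + al j \<omega> * exp (- h * k (pos j \<omega>)) * u (pos (Suc j) \<omega>))"
      by (intro Bochner_Integration.integral_add[symmetric] integrable_walk)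
    also have "\<dots> \<le> expectation (\<lambda>\<omega>. ht (Suc j) \<omega> + al (Suc j) \<omega> * u (pos (Suc j) \<omega>))"
    proof (rule integral_mono)
      fix \<omega>
      have "al j \<omega> * exp (- h * k (pos j \<omega>)) * u (pos (Suc j) \<omega>) \<le> al j \<omega> * exp (- h * k (pos j \<omega>)) * 1"
        using u_le alive_step_bounds by (intro mult_left_mono) auto
      then show "ht j \<omega> + al j \<omega> * exp (- h * k (pos j \<omega>)) * u (pos (Suc j) \<omega>)
          \<le> ht (Suc j) \<omega> + al (Suc j) \<omega> * u (pos (Suc j) \<omega>)"
        by simp
    qed (intro Bochner_Integration.integrable_add integrable_walk)+
    finally show ?case .
  qed
  then have "u x \<le> expectation (\<lambda>\<omega>. ht N \<omega> + al N \<omega> * u (pos N \<omega>))" by simp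
  also have "\<dots> \<le> expectation (\<lambda>\<omega>. ht N \<omega> + exp (- \<kappa> * (h * real N)))"
  proof (rule integral_mono)
    fix \<omega>
    have "al N \<omega> * u (pos N \<omega>) \<le> al N \<omega> * 1" using u_le by (intro mult_left_mono) (auto simp: alive_nonneg)
    also have "\<dots> \<le> exp (- \<kappa> * (h * real N))" using alive_le_exp[of h F \<kappa> k] \<kappa> h_pos by simp
    finally show "ht N \<omega> + al N \<omega> * u (pos N \<omega>) \<le> ht N \<omega> + exp (- \<kappa> * (h * real N))" by simp
  qed (intro Bochner_Integration.integrable_add integrable_walk integrable_const)+
  also have "\<dots> = expectation (ht N) + exp (- \<kappa> * (h * real N))"
    by (subst Bochner_Integration.integral_add) (auto simp: integrable_walk prob_space)
  finally show ?thesis by simp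
qed

end
end

section \<open>The additive functional along a path\<close>

text \<open>Uniformity in the endpoint j / n matters because the step at which the target is entered
  varies with n. The error is at most e per unit of time, whence e = \<eta> / (|T| + 1).\<close>

lemma riemann_sum_uniform:
  fixes g :: "real \<Rightarrow> real"
  assumes g: "continuous_on {0..T} g" and \<eta>: "0 < \<eta>"
  obtains n0 where "\<And>n j. n0 \<le> n \<Longrightarrow> 0 < n \<Longrightarrow> real j / real n \<le> T \<Longrightarrow>
    \<bar>1 / real n * (\<Sum>i<j. g (real i / real n)) - integral {0..real j / real n} g\<bar> \<le> \<eta>"
proof -
  define e where "e = \<eta> / (\<bar>T\<bar> + 1)"
  have e: "0 < e" "e * (\<bar>T\<bar> + 1) = \<eta>" using \<eta> by (simp_all add: e_def add_nonneg_pos)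
  have "uniformly_continuous_on {0..T} g" by (intro compact_uniformly_continuous g) auto
  then obtain d where d: "0 < d" "\<And>s t. s \<in> {0..T} \<Longrightarrow> t \<in> {0..T} \<Longrightarrow> dist s t < d \<Longrightarrow> dist (g s) (g t) < e"
    using e(1) unfolding uniformly_continuous_on_def by metis
  obtain n0 where n0: "1 / d < real n0" using reals_Archimedean2 by blast
  show thesis
  proof (rule that[of n0])
    fix n j :: nat assume n: "n0 \<le> n" "0 < n" and j: "real j / real n \<le> T"
    define h where "h = 1 / real n"
    have h: "0 < h" using n by (simp add: h_def)
    have hd: "h < d"
    proof -
      have "1 / d < real n" using n0 n by linarith
      then show ?thesis using d n by (simp add: h_def field_simps)
    qed
    have "\<bar>h * (\<Sum>i<j. g (real i * h)) - integral {0..real j * h} g\<bar> \<le> e * (real j * h)" if "real j * h \<le> T"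
      using that
    proof (induction j)
      case 0
      then show ?case by simp
    next
      case (Suc j)
      define a where "a = real j * h"
      define b where "b = real (Suc j) * h"
      have ab: "0 \<le> a" "a \<le> b" "b \<le> T" "b - a = h" using h Suc.prems by (auto simp: a_def b_def algebra_simps)
      have gc: "continuous_on {0..b} g" using ab by (intro continuous_on_subset[OF g]) auto
      have gi: "g integrable_on {0..b}" by (rule integrable_continuous_real[OF gc])
      have split: "integral {0..a} g + integral {a..b} g = integral {0..b} g"
        by (rule Henstock_Kurzweil_Integration.integral_combine[OF ab(1,2) gi])
      have gab: "continuous_on {a..b} g" using ab by (intro continuous_on_subset[OF gc]) auto
      have "norm (integral {a..b} (\<lambda>t. g t - g a)) \<le> e * (b - a)"
      proof (rule integral_bound[OF ab(2)])
        show "continuous_on {a..b} (\<lambda>t. g t - g a)" by (intro continuous_intros gab)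
        fix t assume t: "t \<in> {a..b}"
        then have "dist (g t) (g a) < e" using ab hd by (intro d(2)) (auto simp: dist_real_def)
        then show "norm (g t - g a) \<le> e" by (simp add: dist_norm)
      qed
      moreover have "integral {a..b} (\<lambda>t. g t - g a) = integral {a..b} g - h * g a"
        using Henstock_Kurzweil_Integration.integral_diff[OF integrable_continuous_real[OF gab]
            integrable_continuous_real[OF continuous_on_const[of _ "g a"]]] ab by simp
      ultimately have "\<bar>h * g a - integral {a..b} g\<bar> \<le> e * h" using ab by (simp add: abs_minus_commute)
      moreover have "\<bar>h * (\<Sum>i<j. g (real i * h)) - integral {0..a} g\<bar> \<le> e * a"
        using Suc ab unfolding a_def by simp
      ultimately have "\<bar>h * (\<Sum>i<j. g (real i * h)) + h * g a - integral {0..b} g\<bar> \<le> e * a + e * h"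
        unfolding split[symmetric] by linarith
      moreover have "e * a + e * h = e * b" unfolding distrib_left[symmetric] using ab by (simp add: algebra_simps)
      ultimately show ?case by (simp add: a_def b_def distrib_left)
    qed
    moreover have jh: "real j * h = real j / real n" by (simp add: h_def)
    ultimately have "\<bar>h * (\<Sum>i<j. g (real i * h)) - integral {0..real j / real n} g\<bar> \<le> e * (real j / real n)"
      using j by simp
    also have "\<dots> \<le> e * (\<bar>T\<bar> + 1)" using j e by (intro mult_left_mono) auto
    also have "\<dots> = \<eta>" by (rule e(2))
    finally show "\<bar>1 / real n * (\<Sum>i<j. g (real i / real n)) - integral {0..real j / real n} g\<bar> \<le> \<eta>"
      by (simp add: h_def)
  qed
qed

definition clock :: "('b \<Rightarrow> real) \<Rightarrow> (real \<Rightarrow> 'w \<Rightarrow> 'b) \<Rightarrow> 'w \<Rightarrow> real \<Rightarrow> real"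
  where "clock k B \<omega> t = (LINT s:{0..t}|lborel. k (B s \<omega>))"

context
  fixes k :: "'b::topological_space \<Rightarrow> real" and B :: "real \<Rightarrow> 'w \<Rightarrow> 'b" and \<omega> :: 'w
  assumes k_cont: "continuous_on UNIV k" and k_nonneg: "\<And>z. 0 \<le> k z" and k_le_1: "\<And>z. k z \<le> 1"
    and path_cont: "continuous_on {0..} (\<lambda>t. B t \<omega>)"
begin

lemma rate_along_path_continuous: "continuous_on {0..} (\<lambda>s. k (B s \<omega>))"
  by (rule continuous_on_compose2[OF k_cont path_cont]) auto

lemma clock_eq_integral: "clock k B \<omega> t = integral {0..t} (\<lambda>s. k (B s \<omega>))"
proof -
  have "continuous_on {0..t} (\<lambda>s. k (B s \<omega>))"
    by (rule continuous_on_subset[OF rate_along_path_continuous]) auto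
  then show ?thesis
    unfolding clock_def by (intro set_borel_integral_eq_integral borel_integrable_atLeastAtMost')
qed

lemma clock_increment:
  assumes "0 \<le> s" "s \<le> t"
  shows "clock k B \<omega> s \<le> clock k B \<omega> t" "clock k B \<omega> t \<le> clock k B \<omega> s + (t - s)"
proof -
  have c: "continuous_on {0..t} (\<lambda>s. k (B s \<omega>))" "continuous_on {s..t} (\<lambda>s. k (B s \<omega>))"
    using assms by (auto intro: continuous_on_subset[OF rate_along_path_continuous])
  have split: "clock k B \<omega> t = clock k B \<omega> s + integral {s..t} (\<lambda>s. k (B s \<omega>))"
    unfolding clock_eq_integral
    by (rule Henstock_Kurzweil_Integration.integral_combine[OF assms integrable_continuous_real[OF c(1)], symmetric])
  have "0 \<le> integral {s..t} (\<lambda>s. k (B s \<omega>))"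
    by (intro Henstock_Kurzweil_Integration.integral_nonneg integrable_continuous_real c k_nonneg)
  moreover have "integral {s..t} (\<lambda>s. k (B s \<omega>)) \<le> integral {s..t} (\<lambda>s. 1)"
    by (intro Henstock_Kurzweil_Integration.integral_le integrable_continuous_real c k_le_1 continuous_intros)
  ultimately show "clock k B \<omega> s \<le> clock k B \<omega> t" "clock k B \<omega> t \<le> clock k B \<omega> s + (t - s)"
    using assms split by auto
qed

lemma clock_riemann:
  assumes "0 < \<eta>"
  obtains n0 where "\<And>n j. n0 \<le> n \<Longrightarrow> 0 < n \<Longrightarrow> real j / real n \<le> T \<Longrightarrow>
    \<bar>1 / real n * (\<Sum>i<j. k (B (real i / real n) \<omega>)) - clock k B \<omega> (real j / real n)\<bar> \<le> \<eta>"
proof -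
  have "continuous_on {0..T} (\<lambda>s. k (B s \<omega>))"
    by (rule continuous_on_subset[OF rate_along_path_continuous]) auto
  from riemann_sum_uniform[OF this assms] that show thesis
    unfolding clock_eq_integral by metis
qed

text \<open>The strict inequality in the converse comes from the Lipschitz bound: the clock runs at
  speed at most 1, so after t it takes at least \<xi> - clock t > 0 further time to reach
  \<xi>.\<close>

lemma hitting_before_killing_iff:
  "hitting_time B F \<omega> < killing_time k B \<xi> \<omega> \<longleftrightarrow> (\<exists>t\<ge>0. B t \<omega> \<in> F \<and> clock k B \<omega> t < \<xi> \<omega>)"
proof
  assume "hitting_time B F \<omega> < killing_time k B \<xi> \<omega>"
  then obtain t where t: "0 \<le> t" "B t \<omega> \<in> F" "ereal t < killing_time k B \<xi> \<omega>"
    unfolding hitting_time_def Inf_less_iff by auto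
  have "clock k B \<omega> t < \<xi> \<omega>"
  proof (rule ccontr)
    assume "\<not> clock k B \<omega> t < \<xi> \<omega>"
    then have "killing_time k B \<xi> \<omega> \<le> ereal t"
      unfolding killing_time_def clock_def using t(1) by (intro Inf_lower) auto
    then show False using t(3) by simp
  qed
  then show "\<exists>t\<ge>0. B t \<omega> \<in> F \<and> clock k B \<omega> t < \<xi> \<omega>" using t by blast
next
  assume "\<exists>t\<ge>0. B t \<omega> \<in> F \<and> clock k B \<omega> t < \<xi> \<omega>"
  then obtain t where t: "0 \<le> t" "B t \<omega> \<in> F" "clock k B \<omega> t < \<xi> \<omega>" by blast
  have "hitting_time B F \<omega> \<le> ereal t"
    unfolding hitting_time_def using t by (intro Inf_lower) auto
  also have "ereal t < ereal (t + (\<xi> \<omega> - clock k B \<omega> t))" using t by simp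
  also have "\<dots> \<le> killing_time k B \<xi> \<omega>"
    unfolding killing_time_def
  proof (rule Inf_greatest)
    fix e assume "e \<in> ereal ` {t. 0 \<le> t \<and> (LINT s:{0..t}|lborel. k (B s \<omega>)) \<ge> \<xi> \<omega>}"
    then obtain s where s: "e = ereal s" "0 \<le> s" "\<xi> \<omega> \<le> clock k B \<omega> s" by (auto simp: clock_def)
    have "t < s"
    proof (rule ccontr)
      assume "\<not> t < s"
      then show False using clock_increment(1)[of s t] s t by simp
    qed
    then have "clock k B \<omega> s \<le> clock k B \<omega> t + (s - t)" using clock_increment(2)[of t s] t by simp
    then show "ereal (t + (\<xi> \<omega> - clock k B \<omega> t)) \<le> e" using s by simp
  qed
  finally show "hitting_time B F \<omega> < killing_time k B \<xi> \<omega>" .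
qed

text \<open>A countable description for measurability. The strict bound clock < \<xi> leaves room
  for a rational q after the hitting time; conversely, near hits in the compact [0, q] force a true
  hit where G is maximal along the path.\<close>

lemma hitting_before_killing_rational:
  fixes G :: "'b \<Rightarrow> real"
  assumes G: "continuous_on UNIV G"
  shows "hitting_time B (- {z. G z < c}) \<omega> < killing_time k B \<xi> \<omega> \<longleftrightarrow>
    (\<exists>q\<in>\<rat> \<inter> {0..}. clock k B \<omega> q < \<xi> \<omega> \<and> (\<forall>n. \<exists>t\<in>\<rat> \<inter> {0..q}. c - 1 / real (Suc n) < G (B t \<omega>)))"
    (is "?L \<longleftrightarrow> ?R")
proof -
  have gc: "continuous_on {0..} (\<lambda>t. G (B t \<omega>))" by (rule continuous_on_compose2[OF G path_cont]) auto
  show ?thesis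
  proof
    assume ?L
    then obtain t where t: "0 \<le> t" "c \<le> G (B t \<omega>)" "clock k B \<omega> t < \<xi> \<omega>"
      unfolding hitting_before_killing_iff by (auto simp: not_less)
    obtain q where q: "q \<in> \<rat>" "t < q" "q < t + (\<xi> \<omega> - clock k B \<omega> t)"
      using Rats_dense_in_real[of t "t + (\<xi> \<omega> - clock k B \<omega> t)"] t by auto
    have "clock k B \<omega> q < \<xi> \<omega>" using clock_increment(2)[of t q] t q by simp
    moreover have "\<exists>s\<in>\<rat> \<inter> {0..q}. c - 1 / real (Suc n) < G (B s \<omega>)" for n
    proof -
      have "0 < 1 / real (Suc n)" by simp
      then obtain d where d: "0 < d" "\<And>s. s \<in> {0..} \<Longrightarrow> dist s t < d \<Longrightarrow> dist (G (B s \<omega>)) (G (B t \<omega>)) < 1 / real (Suc n)"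
        using gc t(1) unfolding continuous_on_iff by (metis atLeast_iff)
      obtain s where s: "s \<in> \<rat>" "t < s" "s < min q (t + d)"
        using Rats_dense_in_real[of t "min q (t + d)"] q d by auto
      have "dist (G (B s \<omega>)) (G (B t \<omega>)) < 1 / real (Suc n)" using d(2)[of s] s t by (auto simp: dist_real_def)
      then have "c - 1 / real (Suc n) < G (B s \<omega>)" using t unfolding dist_real_def by linarith
      then show ?thesis using s t by auto
    qed
    ultimately show ?R using q t by auto
  next
    assume ?R
    then obtain q where q: "0 \<le> q" "clock k B \<omega> q < \<xi> \<omega>"
      "\<And>n. \<exists>t\<in>\<rat> \<inter> {0..q}. c - 1 / real (Suc n) < G (B t \<omega>)" by auto
    have "continuous_on {0..q} (\<lambda>t. G (B t \<omega>))" by (rule continuous_on_subset[OF gc]) auto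
    from continuous_attains_sup[OF compact_Icc _ this] obtain t where t: "t \<in> {0..q}"
      "\<And>s. s \<in> {0..q} \<Longrightarrow> G (B s \<omega>) \<le> G (B t \<omega>)"
      using q(1) by auto
    have "c \<le> G (B t \<omega>)"
    proof (rule ccontr)
      assume "\<not> c \<le> G (B t \<omega>)"
      then obtain n where n: "1 / real (Suc n) < c - G (B t \<omega>)"
        using nat_approx_posE[of "c - G (B t \<omega>)"] by auto
      obtain s where "s \<in> {0..q}" "c - 1 / real (Suc n) < G (B s \<omega>)" using q(3)[of n] by auto
      then show False using t(2)[of s] n by simp
    qed
    moreover have "clock k B \<omega> t < \<xi> \<omega>" using clock_increment(1)[of t q] t q by simp
    ultimately show ?L unfolding hitting_before_killing_iff using t by (auto simp: not_less)
  qed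
qed

end

section \<open>Exit probabilities of the killed motion\<close>

lemma grid_floor:
  fixes t :: real
  assumes "0 \<le> t" "0 < n"
  shows "real (nat \<lfloor>t * real n\<rfloor>) \<le> t * real n" "real (nat \<lfloor>t * real n\<rfloor>) / real n \<le> t"
    "t - real (nat \<lfloor>t * real n\<rfloor>) / real n < 1 / real n"
proof -
  show j: "real (nat \<lfloor>t * real n\<rfloor>) \<le> t * real n" using assms by simp
  then show "real (nat \<lfloor>t * real n\<rfloor>) / real n \<le> t" using assms by (simp add: pos_divide_le_eq)
  have "t * real n - real (nat \<lfloor>t * real n\<rfloor>) < 1" using assms by simp linarith
  then have "(t * real n - real (nat \<lfloor>t * real n\<rfloor>)) / real n < 1 / real n"
    using assms by (intro divide_strict_right_mono) auto
  then show "t - real (nat \<lfloor>t * real n\<rfloor>) / real n < 1 / real n" using assms by (simp add: diff_divide_distrib)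
qed

section \<open>Integrating out the independent exponential clock\<close>

context brownian_motion_with_clock
begin

text \<open>The \<sigma>-algebra of \<open>clock_independent\<close>. Independence of \<xi> applies
  to functionals measurable for it, so the grid weights are proved measurable here and not merely in
  \<open>M\<close>.\<close>

definition path_algebra :: "'w measure"
  where "path_algebra = vimage_algebra (space M) (\<lambda>\<omega>. \<lambda>t\<in>{0..}. B t \<omega>) (\<Pi>\<^sub>M t\<in>{0..}. borel)"

lemma position_path_measurable: "0 \<le> t \<Longrightarrow> B t \<in> measurable path_algebra borel"
proof -
  assume t: "0 \<le> t"
  have "(\<lambda>\<omega>. \<lambda>t\<in>{0..}. B t \<omega>) \<in> measurable path_algebra (\<Pi>\<^sub>M t\<in>{0..}. borel)"
    unfolding path_algebra_def by (rule measurable_vimage_algebra1) (auto simp: space_PiM)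
  then have "(\<lambda>\<omega>. (\<lambda>t\<in>{0..}. B t \<omega>) t) \<in> measurable path_algebra borel"
    by (rule measurable_compose) (use t in \<open>auto intro!: measurable_component_singleton\<close>)
  then show ?thesis using t by simp
qed

lemma path_measurable_imp_measurable:
  assumes "f \<in> measurable path_algebra N"
  shows "f \<in> measurable M N"
proof -
  have "(\<lambda>\<omega>. \<lambda>t\<in>{0..}. B t \<omega>) \<in> measurable M (\<Pi>\<^sub>M t\<in>{0..}. borel)"
    using measurable_position by (intro measurable_restrict) auto
  then have "sets path_algebra \<subseteq> sets M"
    unfolding path_algebra_def sets_vimage_algebra
    by (intro sets.sigma_sets_subset) (auto dest: measurable_sets)
  then show ?thesis using assms by (auto simp: measurable_def path_algebra_def subset_iff)
qed

lemma clock_tail: "0 \<le> a \<Longrightarrow> prob {\<omega> \<in> space M. a < \<xi> \<omega>} = exp (- a)"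
  using exponential_distributedD_gt[OF exponential_clock, of a] by simp

lemma clock_measurable [measurable]: "\<xi> \<in> borel_measurable M"
  using exponential_clock by (simp add: distributed_def)

text \<open>\<open>exp (- \<xi>)\<close> is uniform on \<open>[0, 1]\<close> and independent of the path.\<close>

lemma prob_clock_less:
  assumes V: "V \<in> measurable path_algebra borel" and V01: "\<And>\<omega>. 0 \<le> V \<omega>" "\<And>\<omega>. V \<omega> \<le> (1::real)"
  shows "prob {\<omega> \<in> space M. exp (- \<xi> \<omega>) < V \<omega>} = expectation V"
proof -
  have V_meas [measurable]: "V \<in> borel_measurable M" by (rule path_measurable_imp_measurable[OF V])
  have "indep_set (sigma_sets (space M) {V -` A \<inter> space M | A. A \<in> sets borel})
     (sigma_sets (space M) {\<xi> -` A \<inter> space M | A. A \<in> sets borel})"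
    unfolding indep_set_def
  proof (rule indep_sets_mono_sets[OF clock_independent[unfolded indep_set_def]])
    fix b :: bool
    have "sigma_sets (space M) {V -` A \<inter> space M | A. A \<in> sets borel} \<subseteq> sets path_algebra"
    proof -
      have sp: "space path_algebra = space M" by (simp add: path_algebra_def)
      have "{V -` A \<inter> space M | A. A \<in> sets borel} \<subseteq> sets path_algebra"
        using measurable_sets[OF V] by (auto simp: sp)
      from sets.sigma_sets_subset[OF this] show ?thesis unfolding sp .
    qed
    then show "case_bool (sigma_sets (space M) {V -` A \<inter> space M | A. A \<in> sets borel})
        (sigma_sets (space M) {\<xi> -` A \<inter> space M | A. A \<in> sets borel}) b
      \<subseteq> case_bool (sets (vimage_algebra (space M) (\<lambda>\<omega>. \<lambda>t\<in>{0..}. B t \<omega>) (\<Pi>\<^sub>M t\<in>{0..}. borel)))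
        (sets (vimage_algebra (space M) \<xi> borel)) b"
      by (auto simp: path_algebra_def sets_vimage_algebra split: bool.split)
  qed
  then have ind: "indep_var borel V borel \<xi>" unfolding indep_var_eq by simp
  define f where "f = (\<lambda>(v, s). indicator {p::real \<times> real. exp (- snd p) < fst p} (v, s) :: real)"
  have f_meas: "f \<in> borel_measurable (borel \<Otimes>\<^sub>M borel)"
    unfolding f_def by measurable
  have inner: "(\<integral>s. f (V \<omega>, s) \<partial>distr M borel \<xi>) = V \<omega>" for \<omega>
  proof -
    have [measurable]: "(\<lambda>s. f (V \<omega>, s)) \<in> borel_measurable borel"
      using f_meas by measurable
    have "(\<integral>s. f (V \<omega>, s) \<partial>distr M borel \<xi>) = expectation (\<lambda>\<omega>'. f (V \<omega>, \<xi> \<omega>'))"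
      by (subst integral_distr) auto
    also have "\<dots> = expectation (indicator {\<omega>' \<in> space M. exp (- \<xi> \<omega>') < V \<omega>})"
      by (intro Bochner_Integration.integral_cong) (auto simp: f_def indicator_def)
    also have "\<dots> = prob {\<omega>' \<in> space M. exp (- \<xi> \<omega>') < V \<omega>}" by simp
    also have "\<dots> = V \<omega>"
    proof (cases "V \<omega> = 0")
      case False
      then have v: "0 < V \<omega>" using V01(1)[of \<omega>] by simp
      have "exp (- s) < V \<omega> \<longleftrightarrow> - ln (V \<omega>) < s" for s
      proof -
        have "exp (- s) < V \<omega> \<longleftrightarrow> exp (- s) < exp (ln (V \<omega>))" using v by simp
        also have "\<dots> \<longleftrightarrow> - ln (V \<omega>) < s" by (simp only: exp_less_cancel_iff minus_less_iff)
        finally show ?thesis .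
      qed
      then show ?thesis using clock_tail[of "- ln (V \<omega>)"] v V01(2)[of \<omega>] by simp
    qed simp
    finally show ?thesis .
  qed
  have "prob {\<omega> \<in> space M. exp (- \<xi> \<omega>) < V \<omega>} = expectation (\<lambda>\<omega>. f (V \<omega>, \<xi> \<omega>))"
  proof -
    have "expectation (\<lambda>\<omega>. f (V \<omega>, \<xi> \<omega>)) = expectation (indicator {\<omega> \<in> space M. exp (- \<xi> \<omega>) < V \<omega>})"
      by (intro Bochner_Integration.integral_cong) (auto simp: f_def indicator_def)
    then show ?thesis by simp
  qed
  also have "\<dots> = expectation (\<lambda>\<omega>. \<integral>s. f (V \<omega>, s) \<partial>distr M borel \<xi>)"
    by (rule indep_var_expectation[OF ind f_meas, of 1]) (auto simp: f_def indicator_def)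
  also have "\<dots> = expectation V" by (simp add: inner)
  finally show ?thesis .
qed

end

section \<open>Enclosing the exit event between grid events\<close>

locale killed_planar_motion =
  brownian_motion_with_clock M B x \<xi> + killed_harmonic k G
  for M :: "'w measure" and B :: "real \<Rightarrow> 'w \<Rightarrow> real ^ 2" and x \<xi> k G
begin

definition grid_hit :: "real \<Rightarrow> nat \<Rightarrow> nat \<Rightarrow> 'w \<Rightarrow> real"
  where "grid_hit c n N \<omega> = hit (1 / real n) k {z. c \<le> G z} (\<lambda>i. B (real i / real n) \<omega>) N"

lemma superlevel_measurable [measurable]: "{z. c \<le> G z} \<in> sets borel"
  by measurable

lemma grid_hit_bounds: "0 \<le> grid_hit c n N \<omega>" "grid_hit c n N \<omega> \<le> 1"
  unfolding grid_hit_def using k_pos by (auto intro!: hit_nonneg hit_le_1 simp: less_imp_le)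

lemma grid_hit_path_measurable: "grid_hit c n N \<in> measurable path_algebra borel"
  unfolding grid_hit_def by (intro measurable_hit position_path_measurable) auto

lemma walk_of_path:
  assumes n: "0 < n"
  shows "gaussian_walk M (\<lambda>i \<omega>. B (real (Suc i) / real n) \<omega> - B (real i / real n) \<omega>) (1 / real n) N"
proof
  show "0 < 1 / real n" using n by simp
  show "indep_vars (\<lambda>_. borel) (\<lambda>i \<omega>. B (real (Suc i) / real n) \<omega> - B (real i / real n) \<omega>) {..<N}"
    by (rule independent_increments) (auto intro!: monoI divide_right_mono)
  show "(\<lambda>\<omega>. B (real (Suc j) / real n) \<omega> - B (real j / real n) \<omega>) \<in> borel_measurable M" for j
    by (intro borel_measurable_diff measurable_position) auto
  fix j
  have "distributed M lborel (\<lambda>\<omega>. B (real (Suc j) / real n) \<omega> - B (real j / real n) \<omega>)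
      (\<lambda>z. ennreal (\<Prod>b\<in>Basis. normal_density 0 (sqrt (real (Suc j) / real n - real j / real n)) (z \<bullet> b)))"
    using n by (intro gaussian_increments) (auto simp: divide_strict_right_mono)
  moreover have "real (Suc j) / real n - real j / real n = 1 / real n"
    by (simp add: diff_divide_distrib[symmetric])
  ultimately have "distr M lborel (\<lambda>\<omega>. B (real (Suc j) / real n) \<omega> - B (real j / real n) \<omega>) = gauss (1 / real n)"
    by (simp add: distributed_def gauss_def)
  moreover have "distr M lborel (\<lambda>\<omega>. B (real (Suc j) / real n) \<omega> - B (real j / real n) \<omega>)
    = distr M borel (\<lambda>\<omega>. B (real (Suc j) / real n) \<omega> - B (real j / real n) \<omega>)"
    by (rule distr_cong) auto
  ultimately show "distr M borel (\<lambda>\<omega>. B (real (Suc j) / real n) \<omega> - B (real j / real n) \<omega>) = gauss (1 / real n)"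
    by simp
qed

text \<open>The increments telescope to the path, but the walk starts exactly at x and the path only
  almost surely, so the identification holds up to a null set.\<close>

lemma expectation_grid_hit:
  assumes n: "0 < n"
  defines "\<Delta> \<equiv> \<lambda>i \<omega>. B (real (Suc i) / real n) \<omega> - B (real i / real n) \<omega>"
  shows "expectation (grid_hit c n N) =
    expectation (\<lambda>\<omega>. hit (1 / real n) k {z. c \<le> G z} (\<lambda>i. gaussian_walk.pos \<Delta> x i \<omega>) N)"
proof -
  interpret w: gaussian_walk M \<Delta> x "1 / real n" N unfolding \<Delta>_def by (rule walk_of_path[OF n])
  have pos: "w.pos i \<omega> = B (real i / real n) \<omega>" if "B 0 \<omega> = x" for i \<omega>
  proof -
    have "(\<Sum>j<i. \<Delta> j \<omega>) = B (real i / real n) \<omega> - B (real 0 / real n) \<omega>"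
      unfolding \<Delta>_def by (rule sum_lessThan_telescope)
    then show ?thesis using that by (simp add: w.pos_def)
  qed
  show ?thesis
  proof (rule integral_cong_AE)
    show "grid_hit c n N \<in> borel_measurable M"
      by (rule path_measurable_imp_measurable[OF grid_hit_path_measurable])
    show "(\<lambda>\<omega>. hit (1 / real n) k {z. c \<le> G z} (\<lambda>i. w.pos i \<omega>) N) \<in> borel_measurable M"
      by measurable
    show "AE \<omega> in M. grid_hit c n N \<omega> = hit (1 / real n) k {z. c \<le> G z} (\<lambda>i. w.pos i \<omega>) N"
      using start by eventually_elim (simp add: grid_hit_def pos)
  qed
qed

text \<open>The test function (trunc c d + d) / c is at least 1 on the target and equals (G x + d) /
  c at x. The bound is uniform in the number of steps, so the horizon may later grow with n.\<close>

lemma grid_hit_upper: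
  assumes c: "0 < c" and d: "0 < d" and x: "G x < c"
  obtains n0 where "\<And>n N. n0 \<le> n \<Longrightarrow> 0 < n \<Longrightarrow> expectation (grid_hit c n N) \<le> (G x + d) / c"
proof -
  obtain h0 where h0: "0 < h0" "\<And>h z. 0 < h \<Longrightarrow> h < h0 \<Longrightarrow> G z < c \<Longrightarrow>
      exp (- h * k z) * (\<integral>y. (trunc c d (z + y) + d) / c \<partial>gauss h) \<le> (trunc c d z + d) / c"
    using superharmonic_step[OF c d] by blast
  obtain n0 where n0: "1 / h0 < real n0" using reals_Archimedean2 by blast
  show thesis
  proof (rule that[of n0])
    fix n N :: nat assume n: "n0 \<le> n" "0 < n"
    have h: "0 < 1 / real n" "1 / real n < h0"
    proof -
      have "1 / h0 < real n" using n n0 by linarith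
      then show "1 / real n < h0" using n h0(1) by (simp add: field_simps)
    qed (use n in simp)
    let ?\<Delta> = "\<lambda>i \<omega>. B (real (Suc i) / real n) \<omega> - B (real i / real n) \<omega>"
    interpret w: gaussian_walk M ?\<Delta> x "1 / real n" N by (rule walk_of_path[OF n(2)])
    have "expectation (\<lambda>\<omega>. hit (1 / real n) k {z. c \<le> G z} (\<lambda>i. w.pos i \<omega>) N) \<le> (trunc c d x + d) / c"
    proof (rule w.walk_hit_upper[where b = "(c + d + d) / c"])
      show "\<bar>(trunc c d z + d) / c\<bar> \<le> (c + d + d) / c" for z
        using trunc_bounds(1)[OF c d, of z] trunc_bounds(2)[of c d z] c d by (simp add: divide_right_mono)
      show "exp (- (1 / real n) * k z) * (\<integral>y. (trunc c d (z + y) + d) / c \<partial>gauss (1 / real n)) \<le> (trunc c d z + d) / c"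
        if "z \<notin> {z. c \<le> G z}" for z
        using h0(2)[OF h, of z] that by (simp add: not_le)
      show "1 \<le> (trunc c d z + d) / c" if "z \<in> {z. c \<le> G z}" for z
        using that c d by (simp add: trunc_def)
      show "0 \<le> (trunc c d z + d) / c" for z
        using trunc_bounds(1)[OF c d, of z] c d by simp
    qed (use k_pos x in \<open>auto simp: less_imp_le\<close>)
    moreover have "trunc c d x = G x" using x d by (simp add: trunc_def)
    ultimately show "expectation (grid_hit c n N) \<le> (G x + d) / c"
      by (simp add: expectation_grid_hit[OF n(2)])
  qed
qed

text \<open>Here cutoff and shift match: \<open>trunc c d - d\<close> never exceeds c, so the test
  function stays below 1 even after an overshoot. The n * T steps span time T for every n.\<close>

lemma grid_hit_lower:
  assumes c: "0 < c" and d: "0 < d" and x: "G x < c" and \<kappa>: "\<And>z. G z < c \<Longrightarrow> \<kappa> \<le> k z"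
  obtains n0 where "\<And>n T. n0 \<le> n \<Longrightarrow> 0 < n \<Longrightarrow> (G x - d) / c - exp (- \<kappa> * real T) \<le> expectation (grid_hit c n (n * T))"
proof -
  obtain h0 where h0: "0 < h0" "\<And>h z. 0 < h \<Longrightarrow> h < h0 \<Longrightarrow> G z < c \<Longrightarrow>
      (trunc c d z - d) / c \<le> exp (- h * k z) * (\<integral>y. (trunc c d (z + y) - d) / c \<partial>gauss h)"
    using subharmonic_step[OF c d] by blast
  obtain n0 where n0: "1 / h0 < real n0" using reals_Archimedean2 by blast
  show thesis
  proof (rule that[of n0])
    fix n T :: nat assume n: "n0 \<le> n" "0 < n"
    have h: "0 < 1 / real n" "1 / real n < h0"
    proof -
      have "1 / h0 < real n" using n n0 by linarith
      then show "1 / real n < h0" using n h0(1) by (simp add: field_simps)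
    qed (use n in simp)
    let ?\<Delta> = "\<lambda>i \<omega>. B (real (Suc i) / real n) \<omega> - B (real i / real n) \<omega>"
    interpret w: gaussian_walk M ?\<Delta> x "1 / real n" "n * T" by (rule walk_of_path[OF n(2)])
    have "(trunc c d x - d) / c - exp (- \<kappa> * (1 / real n * real (n * T)))
        \<le> expectation (\<lambda>\<omega>. hit (1 / real n) k {z. c \<le> G z} (\<lambda>i. w.pos i \<omega>) (n * T))"
    proof (rule w.walk_hit_lower[where b = "(c + d + d) / c"])
      show "\<bar>(trunc c d z - d) / c\<bar> \<le> (c + d + d) / c" for z
      proof -
        have "\<bar>trunc c d z - d\<bar> \<le> c + d + d"
          using trunc_bounds(1)[OF c d, of z] trunc_bounds(2)[of c d z] c d by (auto simp: abs_le_iff)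
        then show ?thesis using c by (simp add: abs_divide divide_right_mono)
      qed
      show "(trunc c d z - d) / c \<le> exp (- (1 / real n) * k z) * (\<integral>y. (trunc c d (z + y) - d) / c \<partial>gauss (1 / real n))"
        if "z \<notin> {z. c \<le> G z}" for z
        using h0(2)[OF h, of z] that by (simp add: not_le)
      show "(trunc c d z - d) / c \<le> 1" for z
        using trunc_bounds(2)[of c d z] c by simp
      show "\<kappa> \<le> k z" if "z \<notin> {z. c \<le> G z}" for z using \<kappa> that by (simp add: not_le)
    qed (use k_pos x in \<open>auto simp: less_imp_le\<close>)
    moreover have "trunc c d x = G x" using x d by (simp add: trunc_def)
    moreover have "1 / real n * real (n * T) = real T" using n by simp
    ultimately show "(G x - d) / c - exp (- \<kappa> * real T) \<le> expectation (grid_hit c n (n * T))"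
      by (simp add: expectation_grid_hit[OF n(2)])
  qed
qed

lemma path_continuous: "\<omega> \<in> space M \<Longrightarrow> continuous_on {0..} (\<lambda>t. B t \<omega>)"
  by (rule continuous_paths)

lemmas path_rate = k_cont less_imp_le[OF k_pos] k_le_1
lemmas path_riemann = clock_riemann[where k = k and B = B, OF path_rate path_continuous]
lemmas path_increment = clock_increment[where k = k and B = B, OF path_rate path_continuous]
lemmas path_exit_iff = hitting_before_killing_iff[where k = k and B = B, OF path_rate path_continuous]
lemmas path_exit_rational = hitting_before_killing_rational[where k = k and B = B, OF path_rate path_continuous G_cont]

lemma clock_path_measurable: "0 \<le> q \<Longrightarrow> (\<lambda>\<omega>. clock k B \<omega> q) \<in> borel_measurable M"
proof -
  assume q: "0 \<le> q"
  define R where "R = (\<lambda>n \<omega>. 1 / real n * (\<Sum>i<nat \<lfloor>q * real n\<rfloor>. k (B (real i / real n) \<omega>)))"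
  show ?thesis
  proof (rule borel_measurable_LIMSEQ_real)
    show "R n \<in> borel_measurable M" for n
      unfolding R_def
      by (intro borel_measurable_times borel_measurable_const borel_measurable_sum
        measurable_compose[OF measurable_position k_measurable]) auto
    fix \<omega> assume \<omega>: "\<omega> \<in> space M"
    show "(\<lambda>n. R n \<omega>) \<longlonglongrightarrow> clock k B \<omega> q"
    proof (rule LIMSEQ_I)
      fix r :: real assume r: "0 < r"
      then have r2: "0 < r / 2" by simp
      obtain n0 where n0: "\<And>n j. n0 \<le> n \<Longrightarrow> 0 < n \<Longrightarrow> real j / real n \<le> q \<Longrightarrow>
        \<bar>1 / real n * (\<Sum>i<j. k (B (real i / real n) \<omega>)) - clock k B \<omega> (real j / real n)\<bar> \<le> r / 2"
        using path_riemann[OF \<omega> r2, of q] by blast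
      obtain n1 where n1: "2 / r < real n1" using reals_Archimedean2 by blast
      have "norm (R n \<omega> - clock k B \<omega> q) < r" if n: "max n0 (max n1 1) \<le> n" for n
      proof -
        have n': "n0 \<le> n" "0 < n" "real n1 \<le> real n" using n by auto
        define j where "j = nat \<lfloor>q * real n\<rfloor>"
        have j: "real j \<le> q * real n" and jn: "real j / real n \<le> q" "q - real j / real n < 1 / real n"
      unfolding j_def using grid_floor[OF q n'(2)] by auto
        have "1 / real n < r / 2"
        proof -
          have "2 / r < real n" using n1 n' by linarith
          then show ?thesis using r n'(2) by (simp add: field_simps)
        qed
        moreover have "\<bar>R n \<omega> - clock k B \<omega> (real j / real n)\<bar> \<le> r / 2"
          using n0[OF n'(1,2) jn(1)] by (simp add: R_def j_def)
        moreover have "clock k B \<omega> (real j / real n) \<le> clock k B \<omega> q"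
          "clock k B \<omega> q \<le> clock k B \<omega> (real j / real n) + (q - real j / real n)"
          using path_increment[OF \<omega>, of "real j / real n" q] jn by auto
        ultimately show ?thesis using jn(2) unfolding real_norm_def by linarith
      qed
      then show "\<exists>no. \<forall>n\<ge>no. norm (R n \<omega> - clock k B \<omega> q) < r" by blast
    qed
  qed
qed

lemma exit_event_iff:
  "\<omega> \<in> exit_before_killing M k B \<xi> {z. G z < c} \<longleftrightarrow>
    \<omega> \<in> space M \<and> (\<exists>t\<ge>0. c \<le> G (B t \<omega>) \<and> clock k B \<omega> t < \<xi> \<omega>)"
  unfolding exit_before_killing_def
  using path_exit_iff[of \<omega> "- {z. G z < c}" \<xi>] by (auto simp: not_less)

lemma exit_event_measurable: "exit_before_killing M k B \<xi> {z. G z < c} \<in> sets M"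
proof -
  have "exit_before_killing M k B \<xi> {z. G z < c} =
    {\<omega> \<in> space M. \<exists>q\<in>\<rat> \<inter> {0..}. clock k B \<omega> q < \<xi> \<omega> \<and>
      (\<forall>n. \<exists>t\<in>\<rat> \<inter> {0..q}. c - 1 / real (Suc n) < G (B t \<omega>))}"
    unfolding exit_before_killing_def
    using path_exit_rational[of _ c \<xi>] by (intro Collect_cong conj_cong refl)
  also have "\<dots> = (\<Union>q\<in>\<rat> \<inter> {0..}. {\<omega> \<in> space M. clock k B \<omega> q < \<xi> \<omega>} \<inter>
      (\<Inter>n. \<Union>t\<in>\<rat> \<inter> {0..q}. {\<omega> \<in> space M. c - 1 / real (Suc n) < G (B t \<omega>)}))"
    by auto
  also have "\<dots> \<in> sets M"
  proof (intro sets.countable_UN'' sets.Int sets.countable_INT' countable_Int1 countable_rat)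
    fix q :: real assume q: "q \<in> \<rat> \<inter> {0..}"
    then have [measurable]: "(\<lambda>\<omega>. clock k B \<omega> q) \<in> borel_measurable M" by (intro clock_path_measurable) auto
    show "{\<omega> \<in> space M. clock k B \<omega> q < \<xi> \<omega>} \<in> sets M" by measurable
    fix n :: nat
    show "(\<lambda>n. \<Union>t\<in>\<rat> \<inter> {0..q}. {\<omega> \<in> space M. c - 1 / real (Suc n) < G (B t \<omega>)}) ` UNIV \<subseteq> sets M"
    proof (intro image_subsetI sets.countable_UN'' countable_Int1 countable_rat)
      fix n and t :: real assume "t \<in> \<rat> \<inter> {0..q}"
      then have [measurable]: "B t \<in> borel_measurable M" by (intro measurable_position) auto
      show "{\<omega> \<in> space M. c - 1 / real (Suc n) < G (B t \<omega>)} \<in> sets M" by measurable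
    qed
  qed auto
  finally show ?thesis .
qed

text \<open>\<open>grid_hit\<close> is exp of minus the discretised clock at the first grid hit, and
  0 if there is none. So the event says that the grid meets the target within N steps while the
  discretised clock plus \<eta> is still below \<xi>.\<close>

definition grid_exit :: "real \<Rightarrow> real \<Rightarrow> nat \<Rightarrow> nat \<Rightarrow> 'w set"
  where "grid_exit \<eta> c n N = {\<omega> \<in> space M. exp (- \<xi> \<omega>) < exp (- \<eta>) * grid_hit c n N \<omega>}"

lemma prob_grid_exit:
  assumes "0 \<le> \<eta>"
  shows "grid_exit \<eta> c n N \<in> events" "prob (grid_exit \<eta> c n N) = exp (- \<eta>) * expectation (grid_hit c n N)"
proof -
  have V: "(\<lambda>\<omega>. exp (- \<eta>) * grid_hit c n N \<omega>) \<in> measurable path_algebra borel"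
    by (intro borel_measurable_times borel_measurable_const grid_hit_path_measurable)
  then have [measurable]: "(\<lambda>\<omega>. exp (- \<eta>) * grid_hit c n N \<omega>) \<in> borel_measurable M"
    by (rule path_measurable_imp_measurable)
  show "grid_exit \<eta> c n N \<in> events" unfolding grid_exit_def by measurable
  have "exp (- \<eta>) * grid_hit c n N \<omega> \<le> 1" for \<omega>
    using grid_hit_bounds[of c n N \<omega>] assms by (intro mult_le_one) auto
  then show "prob (grid_exit \<eta> c n N) = exp (- \<eta>) * expectation (grid_hit c n N)"
    unfolding grid_exit_def
    using prob_clock_less[OF V] grid_hit_bounds by simp
qed

text \<open>A true exit shows on all fine grids at the lower level c', since a grid point near the
  hitting time only nearly attains c. With n * n steps the horizon is time n and eventually covers
  the hitting time.\<close>

lemma exit_subset_grid_exit: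
  assumes c': "c' < c"
  shows "exit_before_killing M k B \<xi> {z. G z < c} \<subseteq> (\<Union>m. \<Inter>n\<in>{m..}. grid_exit 0 c' n (n * n))"
proof
  fix \<omega> assume "\<omega> \<in> exit_before_killing M k B \<xi> {z. G z < c}"
  then obtain t where \<omega>: "\<omega> \<in> space M" and t: "0 \<le> t" "c \<le> G (B t \<omega>)" "clock k B \<omega> t < \<xi> \<omega>"
    unfolding exit_event_iff by blast
  \<comment> \<open>Half of the gap between clock and \<xi> is reserved for the Riemann
    error.\<close>
  define \<eta> where "\<eta> = (\<xi> \<omega> - clock k B \<omega> t) / 2"
  have \<eta>: "0 < \<eta>" using t by (simp add: \<eta>_def)
  obtain n0 where n0: "\<And>n j. n0 \<le> n \<Longrightarrow> 0 < n \<Longrightarrow> real j / real n \<le> t \<Longrightarrow>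
      \<bar>1 / real n * (\<Sum>i<j. k (B (real i / real n) \<omega>)) - clock k B \<omega> (real j / real n)\<bar> \<le> \<eta>"
    using path_riemann[OF \<omega> \<eta>, of t] by blast
  have "continuous_on {0..} (\<lambda>t. G (B t \<omega>))"
    by (rule continuous_on_compose2[OF G_cont path_continuous[OF \<omega>]]) auto
  moreover have "0 < c - c'" using c' by simp
  ultimately obtain d where d: "0 < d" "\<And>s. s \<in> {0..} \<Longrightarrow> dist s t < d \<Longrightarrow> dist (G (B s \<omega>)) (G (B t \<omega>)) < c - c'"
    using t(1) unfolding continuous_on_iff by (metis atLeast_iff)
  obtain n1 where n1: "1 / d < real n1" using reals_Archimedean2 by blast
  obtain n2 where n2: "t < real n2" using reals_Archimedean2 by blast
  have "\<omega> \<in> grid_exit 0 c' n (n * n)" if n: "max n0 (max n1 (max n2 1)) \<le> n" for n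
  proof -
    have n': "n0 \<le> n" "0 < n" "real n1 \<le> real n" "real n2 \<le> real n" using n by auto
    define j where "j = nat \<lfloor>t * real n\<rfloor>"
    have j: "real j \<le> t * real n" and jn: "real j / real n \<le> t" "t - real j / real n < 1 / real n"
      unfolding j_def using grid_floor[OF t(1) n'(2)] by auto
    have "1 / real n < d"
    proof -
      have "1 / d < real n" using n1 n' by linarith
      then show ?thesis using d n'(2) by (simp add: field_simps)
    qed
    then have "dist (real j / real n) t < d" using jn by (simp add: dist_real_def)
    then have "dist (G (B (real j / real n) \<omega>)) (G (B t \<omega>)) < c - c'" by (intro d(2)) auto
    then have hitF: "c' \<le> G (B (real j / real n) \<omega>)" using t(2) unfolding dist_real_def by linarith
    have jN: "j \<le> n * n"
    proof -
      have "t \<le> real n" using n2 n'(4) by linarith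
      then have "t * real n \<le> real n * real n" by (intro mult_right_mono) auto
      then have "real j \<le> real n * real n" using j by linarith
      then have "real j \<le> real (n * n)" by simp
      then show ?thesis by (simp only: of_nat_le_iff)
    qed
    have "1 / real n * (\<Sum>i<j. k (B (real i / real n) \<omega>)) \<le> clock k B \<omega> (real j / real n) + \<eta>"
      using n0[OF n'(1,2) jn(1)] by linarith
    also have "\<dots> \<le> clock k B \<omega> t + \<eta>" using path_increment(1)[OF \<omega>, of "real j / real n" t] jn by simp
    also have "\<dots> < \<xi> \<omega>" using t by (simp add: \<eta>_def field_simps)
    finally have "exp (- \<xi> \<omega>) < exp (- (1 / real n) * (\<Sum>i<j. k (B (real i / real n) \<omega>)))" by simp
    also have "\<dots> \<le> grid_hit c' n (n * n) \<omega>"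
      unfolding grid_hit_def
      using hit_ge[of "1 / real n" k j "n * n" "\<lambda>i. B (real i / real n) \<omega>" "{z. c' \<le> G z}"] jN hitF k_pos
      by (simp add: less_imp_le)
    finally show ?thesis using \<omega> by (simp add: grid_exit_def)
  qed
  then show "\<omega> \<in> (\<Union>m. \<Inter>n\<in>{m..}. grid_exit 0 c' n (n * n))" by blast
qed

text \<open>A grid hit is a true visit to {G >= c}; only the clock needs room, and \<eta> provides
  it. The fixed time horizon T makes the Riemann error along the path uniform over all possible grid
  hits.\<close>

lemma grid_exit_subset_exit:
  assumes \<eta>: "0 < \<eta>"
  shows "(\<Inter>m. \<Union>n\<in>{m..}. grid_exit \<eta> c n (n * T)) \<subseteq> exit_before_killing M k B \<xi> {z. G z < c}"
proof
  fix \<omega> assume A: "\<omega> \<in> (\<Inter>m. \<Union>n\<in>{m..}. grid_exit \<eta> c n (n * T))"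
  then have \<omega>: "\<omega> \<in> space M" by (auto simp: grid_exit_def)
  obtain n0 where n0: "\<And>n j. n0 \<le> n \<Longrightarrow> 0 < n \<Longrightarrow> real j / real n \<le> real T \<Longrightarrow>
      \<bar>1 / real n * (\<Sum>i<j. k (B (real i / real n) \<omega>)) - clock k B \<omega> (real j / real n)\<bar> \<le> \<eta>"
    using path_riemann[OF \<omega> \<eta>, of "real T"] by blast
  obtain n where n: "max n0 1 \<le> n" "\<omega> \<in> grid_exit \<eta> c n (n * T)" using A by blast
  then have g: "exp (- \<xi> \<omega>) < exp (- \<eta>) * grid_hit c n (n * T) \<omega>" by (simp add: grid_exit_def)
  have "0 < exp (- \<eta>) * grid_hit c n (n * T) \<omega>" using g by (meson exp_gt_zero less_trans)
  then have "0 < grid_hit c n (n * T) \<omega>" by (simp add: zero_less_mult_iff)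
  then obtain m where m: "m \<le> n * T" "c \<le> G (B (real m / real n) \<omega>)"
    "grid_hit c n (n * T) \<omega> = exp (- (1 / real n) * (\<Sum>i<m. k (B (real i / real n) \<omega>)))"
    unfolding grid_hit_def by (rule hit_pos_obtains) simp
  have mT: "real m / real n \<le> real T"
  proof -
    have "real m \<le> real (n * T)" using m(1) by (simp only: of_nat_le_iff)
    then show ?thesis using n(1) by (simp add: field_simps)
  qed
  have "exp (- \<xi> \<omega>) < exp (- \<eta> + - (1 / real n) * (\<Sum>i<m. k (B (real i / real n) \<omega>)))"
    using g unfolding m(3) exp_add .
  then have "\<eta> + 1 / real n * (\<Sum>i<m. k (B (real i / real n) \<omega>)) < \<xi> \<omega>" by simp
  moreover have "clock k B \<omega> (real m / real n) \<le> 1 / real n * (\<Sum>i<m. k (B (real i / real n) \<omega>)) + \<eta>"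
    using n0[OF _ _ mT] n(1) by (simp add: abs_le_iff)
  ultimately have "clock k B \<omega> (real m / real n) < \<xi> \<omega>" by linarith
  then show "\<omega> \<in> exit_before_killing M k B \<xi> {z. G z < c}"
    unfolding exit_event_iff using \<omega> m(2) by (intro conjI exI[of _ "real m / real n"]) auto
qed

text \<open>The liminf of the grid events is an increasing union, and each of its members lies
  inside one grid event of controlled probability.\<close>

lemma prob_exit_upper:
  assumes c': "0 < c'" "G x < c'" "c' < c" and d: "0 < d"
  shows "prob (exit_before_killing M k B \<xi> {z. G z < c}) \<le> (G x + d) / c'"
proof -
  obtain n0 where n0: "\<And>n N. n0 \<le> n \<Longrightarrow> 0 < n \<Longrightarrow> expectation (grid_hit c' n N) \<le> (G x + d) / c'"
    using grid_hit_upper[OF c'(1) d c'(2)] by blast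
  define D where "D = (\<lambda>m. \<Inter>n\<in>{m..}. grid_exit 0 c' n (n * n))"
  have D_events: "D m \<in> events" for m
    unfolding D_def by (intro sets.countable_INT') (auto simp: prob_grid_exit)
  have "prob (D m) \<le> (G x + d) / c'" for m
  proof -
    define n where "n = max m (max n0 1)"
    have "prob (D m) \<le> prob (grid_exit 0 c' n (n * n))"
      by (intro finite_measure_mono prob_grid_exit) (auto simp: D_def n_def)
    also have "\<dots> \<le> (G x + d) / c'" using n0[of n] by (simp add: prob_grid_exit n_def)
    finally show ?thesis .
  qed
  moreover have "(\<lambda>m. prob (D m)) \<longlonglongrightarrow> prob (\<Union>m. D m)"
    using D_events by (intro finite_Lim_measure_incseq) (auto simp: incseq_def D_def)
  ultimately have "prob (\<Union>m. D m) \<le> (G x + d) / c'" by (intro LIMSEQ_le_const2) auto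
  moreover have "prob (exit_before_killing M k B \<xi> {z. G z < c}) \<le> prob (\<Union>m. D m)"
    using exit_subset_grid_exit[OF c'(3)] D_events
    by (intro finite_measure_mono) (auto simp: D_def)
  ultimately show ?thesis by simp
qed

text \<open>Dually, the limsup is a decreasing intersection, each member of which contains one grid
  event of sufficient probability.\<close>

lemma prob_exit_lower:
  assumes c: "0 < c" "G x < c" and d: "0 < d" and \<eta>: "0 < \<eta>" and \<kappa>: "\<And>z. G z < c \<Longrightarrow> \<kappa> \<le> k z"
  shows "exp (- \<eta>) * ((G x - d) / c - exp (- \<kappa> * real T)) \<le> prob (exit_before_killing M k B \<xi> {z. G z < c})"
    (is "?b \<le> _")
proof -
  obtain n0 where n0: "\<And>n T. n0 \<le> n \<Longrightarrow> 0 < n \<Longrightarrow>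
      (G x - d) / c - exp (- \<kappa> * real T) \<le> expectation (grid_hit c n (n * T))"
    using grid_hit_lower[OF c(1) d c(2) \<kappa>] by blast
  define D where "D = (\<lambda>m. \<Union>n\<in>{m..}. grid_exit \<eta> c n (n * T))"
  have D_events: "D m \<in> events" for m
    unfolding D_def using \<eta> by (intro sets.countable_UN'') (auto simp: prob_grid_exit)
  have "?b \<le> prob (D m)" for m
  proof -
    define n where "n = max m (max n0 1)"
    have "?b \<le> exp (- \<eta>) * expectation (grid_hit c n (n * T))"
      using n0[of n] by (intro mult_left_mono) (auto simp: n_def)
    also have "\<dots> = prob (grid_exit \<eta> c n (n * T))" using \<eta> by (simp add: prob_grid_exit)
    also have "\<dots> \<le> prob (D m)"
    proof (rule finite_measure_mono[OF _ D_events])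
      show "grid_exit \<eta> c n (n * T) \<subseteq> D m" unfolding D_def by (rule UN_upper) (simp add: n_def)
    qed
    finally show ?thesis .
  qed
  moreover have "(\<lambda>m. prob (D m)) \<longlonglongrightarrow> prob (\<Inter>m. D m)"
  proof (rule finite_Lim_measure_decseq)
    show "decseq D" unfolding decseq_def D_def by (intro allI impI UN_mono) auto
  qed (use D_events in auto)
  ultimately have "?b \<le> prob (\<Inter>m. D m)" by (intro LIMSEQ_le_const) auto
  also have "\<dots> \<le> prob (exit_before_killing M k B \<xi> {z. G z < c})"
    using grid_exit_subset_exit[OF \<eta>, of c T]
    by (intro finite_measure_mono exit_event_measurable) (auto simp: D_def)
  finally show ?thesis .
qed

theorem prob_exit_before_killing:
  assumes x: "G x < c"
  shows "prob (exit_before_killing M k B \<xi> {z. G z < c}) = G x / c"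
proof -
  define p where "p = prob (exit_before_killing M k B \<xi> {z. G z < c})"
  have c: "0 < c" using x G_pos[of x] by linarith
  have p01: "0 \<le> p" "p \<le> 1" by (auto simp: p_def)
  have "p * c \<le> G x"
  proof (rule field_le_epsilon)
    fix e :: real assume e: "0 < e"
    \<comment> \<open>c' stays above G x and within e / 2 of c; as p <= 1, replacing c by c' costs
      at most e / 2.\<close>
    define c' where "c' = max ((G x + c) / 2) (c - e / 2)"
    have c': "0 < c'" "G x < c'" "c' < c" "c - e / 2 \<le> c'"
      using x e G_pos[of x] c by (auto simp: c'_def less_max_iff_disj)
    have "p \<le> (G x + e / 2) / c'" unfolding p_def using e by (intro prob_exit_upper c') auto
    then have "p * c' \<le> G x + e / 2" using c' by (simp add: field_simps)
    moreover have "p * (c - c') \<le> 1 * (e / 2)" using p01 c' by (intro mult_mono) auto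
    ultimately show "p * c \<le> G x + e" by (simp add: algebra_simps)
  qed
  moreover have "G x / c \<le> p"
  proof (rule ccontr)
    assume "\<not> G x / c \<le> p"
    then have lt: "p < G x / c" by simp
    \<comment> \<open>Budget: y is midway between p and G x / c. The shift d = r c / 2 and the
      finite horizon T cost r / 2 each, and \<eta> is chosen so that (1 - \<eta>) y is the midpoint
      of p and y, still above p.\<close>
    define r where "r = (G x / c - p) / 2"
    define y where "y = G x / c - r"
    have r: "0 < r" and y: "p < y" "0 < y" using lt p01 by (auto simp: r_def y_def field_simps)
    define \<eta> where "\<eta> = (y - p) / (2 * y)"
    have \<eta>: "0 < \<eta>" using y by (simp add: \<eta>_def)
    obtain \<kappa> where \<kappa>: "0 < \<kappa>" "\<And>z. G z \<le> c \<Longrightarrow> \<kappa> \<le> k z" using killing_lower_bound by blast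
    obtain T :: nat where T: "- ln (r / 2) / \<kappa> < real T" using reals_Archimedean2 by blast
    have "exp (- \<kappa> * real T) \<le> exp (ln (r / 2))"
      using T \<kappa>(1) by (simp add: field_simps)
    then have eT: "exp (- \<kappa> * real T) \<le> r / 2" using r by simp
    define Z where "Z = (G x - r / 2 * c) / c - exp (- \<kappa> * real T)"
    have "y \<le> Z" using eT c by (simp add: Z_def y_def diff_divide_distrib)
    have "(y + p) / 2 = (1 - \<eta>) * y" using y by (simp add: \<eta>_def field_simps)
    also have "\<dots> \<le> exp (- \<eta>) * y"
      using exp_ge_add_one_self[of "- \<eta>"] y by (intro mult_right_mono) auto
    also have "\<dots> \<le> exp (- \<eta>) * Z" using \<open>y \<le> Z\<close> by (intro mult_left_mono) auto
    also have "\<dots> \<le> p"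
      unfolding p_def Z_def using r c \<eta> \<kappa> x by (intro prob_exit_lower) auto
    finally show False using y by simp
  qed
  ultimately show ?thesis using c unfolding p_def[symmetric] by (simp add: field_simps order_antisym)
qed

end

section \<open>Two exhaustions\<close>

context killed_harmonic
begin

lemma exhaustion_sublevels: "exhaustion (\<lambda>R. {z. G z < real R + 1})"
proof -
  have b: "bounded {z. G z < c}" for c
    by (rule bounded_subset[OF sublevel_bounded[of c]]) auto
  have "{z. G z < c} \<subset> UNIV" for c
    using b[of c] not_bounded_UNIV by (metis psubsetI subset_UNIV)
  moreover have "\<exists>R. ball 0 r \<subseteq> {z. G z < real R + 1}" for r :: real
  proof -
    have "compact (G ` cball 0 r)"
      by (intro compact_continuous_image continuous_on_subset[OF G_cont]) auto
    from compact_imp_bounded[OF this] obtain K where K: "\<forall>x\<in>G ` cball 0 r. norm x \<le> K"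
      unfolding bounded_iff by (elim exE)
    obtain R :: nat where R: "K < real R" using reals_Archimedean2 by blast
    have "G z < real R + 1" if "z \<in> ball 0 r" for z
    proof -
      have "norm (G z) \<le> K" using K that by auto
      then show ?thesis using R by simp
    qed
    then show ?thesis by blast
  qed
  ultimately show ?thesis
    unfolding exhaustion_def using b by (auto simp: incseq_def intro: less_le_trans)
qed

end

text \<open>Once R + 1 exceeds both G x and G y, the level cancels from the quotient of the exact
  exit probabilities.\<close>

lemma exit_ratio_sublevels:
  assumes "\<And>z. killed_planar_motion (P z) B z \<xi> k G"
  shows "exits_measurable (P z) k B \<xi> (\<lambda>R. {z. G z < real R + 1})"
    and "exit_ratio P k B \<xi> (\<lambda>R. {z. G z < real R + 1}) x y \<longlonglongrightarrow> G x / G y"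
proof -
  show "exits_measurable (P z) k B \<xi> (\<lambda>R. {z. G z < real R + 1})"
    unfolding exits_measurable_def using killed_planar_motion.exit_event_measurable[OF assms] by blast
  obtain R0 :: nat where R0: "max (G x) (G y) < real R0" using reals_Archimedean2 by blast
  have "exit_ratio P k B \<xi> (\<lambda>R. {z. G z < real R + 1}) x y R = G x / G y" if "R0 \<le> R" for R
  proof -
    have "G x < real R + 1" "G y < real R + 1" using R0 that by auto
    then show ?thesis
      unfolding exit_ratio_def by (simp add: killed_planar_motion.prob_exit_before_killing[OF assms])
  qed
  then show "exit_ratio P k B \<xi> (\<lambda>R. {z. G z < real R + 1}) x y \<longlonglongrightarrow> G x / G y"
    by (intro tendsto_eventually eventually_sequentiallyI)
qed

text \<open>The rate in the variable s = |z|^2, continued by 1 to negative s because the radial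
  construction works with \<kappa> continuous on the whole line.\<close>

definition radial_rate :: "real \<Rightarrow> real \<Rightarrow> real"
  where "radial_rate \<alpha> s = (if s \<le> 1 then 1 else s powr (- \<alpha> / 2))"

lemma radial_rate_bounds:
  assumes "0 < \<alpha>"
  shows "0 < radial_rate \<alpha> s" "radial_rate \<alpha> s \<le> 1"
  using assms powr_mono[of "- \<alpha> / 2" 0 s] by (auto simp: radial_rate_def)

lemma continuous_radial_rate: "continuous_on UNIV (radial_rate \<alpha>)"
proof -
  have "continuous_on ({..1} \<union> {1..}) (radial_rate \<alpha>)"
    unfolding radial_rate_def by (intro continuous_on_If continuous_intros) auto
  moreover have "{..1} \<union> {1..} = (UNIV :: real set)" by auto
  ultimately show ?thesis by simp
qed

lemma polynomial_killing_rate_eq: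
  assumes "0 < \<alpha>"
  shows "polynomial_killing_rate \<alpha> z = radial_rate \<alpha> (z \<bullet> z)"
proof (cases "norm z \<le> 1")
  case True
  then have "norm z powr \<alpha> \<le> 1" if "z \<noteq> 0" using powr_mono2[of \<alpha> "norm z" 1] assms by simp
  then have "1 \<le> 1 / norm z powr \<alpha>" if "z \<noteq> 0" using that by simp
  moreover have "z \<bullet> z \<le> 1" using True by (simp add: power2_norm_eq_inner[symmetric] power_le_one)
  ultimately show ?thesis by (simp add: polynomial_killing_rate_def radial_rate_def)
next
  case False
  then have z: "1 < norm z" "z \<noteq> 0" by auto
  have "1 \<le> norm z powr \<alpha>" using z assms by (intro ge_one_powr_ge_zero) auto
  then have "polynomial_killing_rate \<alpha> z = norm z powr (- \<alpha>)"
    using z by (simp add: polynomial_killing_rate_def powr_minus divide_inverse inverse_le_1_iff)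
  also have "- \<alpha> = 2 * (- \<alpha> / 2)" by simp
  also have "norm z powr \<dots> = (norm z powr 2) powr (- \<alpha> / 2)" by (rule powr_powr[symmetric])
  also have "norm z powr 2 = z \<bullet> z" using z by (simp add: power2_norm_eq_inner)
  finally show ?thesis
    using z by (simp add: radial_rate_def power2_norm_eq_inner[symmetric] power_le_one_iff not_le)
qed

text \<open>Keeping |e| <= 1 / (2 C) holds the angular part below half of the radial solution, so
  positivity and growth of H pass to the sum. The case e = 0 is the radial function itself.\<close>

lemma positive_harmonic_family:
  assumes \<alpha>: "0 < \<alpha>" "\<alpha> < 2"
  obtains H P \<epsilon> where "0 < \<epsilon>" "0 < P 1" "H 0 = 1"
    "killed_harmonic (polynomial_killing_rate \<alpha>) (\<lambda>z. H (z \<bullet> z))"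
    "killed_harmonic (polynomial_killing_rate \<alpha>) (\<lambda>z. H (z \<bullet> z) + \<epsilon> * z$1 * P (z \<bullet> z))"
proof -
  define \<kappa> where "\<kappa> = radial_rate \<alpha>"
  have \<kappa>: "continuous_on UNIV \<kappa>" "\<And>s. 0 \<le> \<kappa> s" "\<And>s. \<kappa> s \<le> 1" "\<And>s. s \<le> 1 \<Longrightarrow> \<kappa> s = 1"
    "\<And>s. 1 \<le> s \<Longrightarrow> \<kappa> s = s powr (- \<alpha> / 2)"
    using continuous_radial_rate radial_rate_bounds[OF \<alpha>(1)]
    by (auto simp: \<kappa>_def less_imp_le) (auto simp: radial_rate_def)
  obtain H H1 H2 where H: "H 0 = 1" "\<And>s. 0 \<le> s \<Longrightarrow> 1 \<le> H s" "\<And>s. 0 \<le> s \<Longrightarrow> 0 \<le> H1 s"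
    "\<And>s. 0 \<le> s \<Longrightarrow> (H has_real_derivative H1 s) (at s within {0..})"
    "\<And>s. 0 \<le> s \<Longrightarrow> (H1 has_real_derivative H2 s) (at s within {0..})"
    "continuous_on {0..} H2"
    "\<And>s. 0 \<le> s \<Longrightarrow> real (Suc 0) * H1 s + s * H2 s = \<kappa> s * H s / 2"
    using radial_solution[where n = 0, OF \<kappa>(1-4)] by blast
  obtain P P1 P2 where P: "P 0 = 1" "\<And>s. 0 \<le> s \<Longrightarrow> 1 \<le> P s" "\<And>s. 0 \<le> s \<Longrightarrow> 0 \<le> P1 s"
    "\<And>s. 0 \<le> s \<Longrightarrow> (P has_real_derivative P1 s) (at s within {0..})"
    "\<And>s. 0 \<le> s \<Longrightarrow> (P1 has_real_derivative P2 s) (at s within {0..})"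
    "continuous_on {0..} P2"
    "\<And>s. 0 \<le> s \<Longrightarrow> real (Suc 1) * P1 s + s * P2 s = \<kappa> s * P s / 2"
    using radial_solution[where n = 1, OF \<kappa>(1-4)] by blast
  have odeH: "H1 s + s * H2 s = \<kappa> s * H s / 2" and odeP: "2 * P1 s + s * P2 s = \<kappa> s * P s / 2"
    if "0 \<le> s" for s
    using H(7)[OF that] P(7)[OF that] by simp_all
  obtain C where C: "0 < C" "\<And>s. 0 \<le> s \<Longrightarrow> sqrt s * P s \<le> C * H s"
    using radial_ratio_bounded[OF \<alpha> \<kappa>(2,4,5) H(2,4,5) odeH P(2-5) odeP] by blast
  have cont: "continuous_on {0..} H" "continuous_on {0..} P"
    using H(4) P(4) by (auto intro!: DERIV_continuous_on)
  have kh: "killed_harmonic (polynomial_killing_rate \<alpha>) (\<lambda>z. H (z \<bullet> z) + e * z$1 * P (z \<bullet> z))"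
    if e: "\<bar>e\<bar> \<le> 1 / (2 * C)" for e
  proof -
    define G where "G = (\<lambda>z::real^2. H (z \<bullet> z) + e * z$1 * P (z \<bullet> z))"
    have half: "H (z \<bullet> z) / 2 \<le> G z" for z
    proof -
      have "\<bar>e * z$1 * P (z \<bullet> z)\<bar> = \<bar>e\<bar> * (\<bar>z$1\<bar> * P (z \<bullet> z))"
        using P(2)[of "z \<bullet> z"] by (simp add: abs_mult)
      also have "\<dots> \<le> 1 / (2 * C) * (sqrt (z \<bullet> z) * P (z \<bullet> z))"
        using e C(1) P(2)[of "z \<bullet> z"] component_le_norm_cart[of z 1]
        by (intro mult_mono) (auto simp: norm_eq_sqrt_inner)
      also have "\<dots> \<le> 1 / (2 * C) * (C * H (z \<bullet> z))"
        using C by (intro mult_left_mono) auto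
      also have "\<dots> = H (z \<bullet> z) / 2" using C by simp
      finally show ?thesis unfolding G_def by linarith
    qed
    have rate: "polynomial_killing_rate \<alpha> = (\<lambda>z::real^2. \<kappa> (z \<bullet> z))"
      by (simp add: fun_eq_iff polynomial_killing_rate_eq[OF \<alpha>(1)] \<kappa>_def)
    have "killed_harmonic (\<lambda>z. \<kappa> (z \<bullet> z)) G"
    proof
      show "generator_eq (\<lambda>z. \<kappa> (z \<bullet> z)) G"
        unfolding G_def by (rule generator_eq_radial[OF H(4,5,6) odeH P(4,5,6) odeP])
      show "continuous_on UNIV G"
        unfolding G_def
        by (intro continuous_intros continuous_on_compose2[OF cont(1)] continuous_on_compose2[OF cont(2)]) auto
      show "0 < G z" for z using half[of z] H(2)[of "z \<bullet> z"] by simp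
      show "continuous_on UNIV (\<lambda>z::real^2. \<kappa> (z \<bullet> z))"
        by (intro continuous_on_compose2[OF \<kappa>(1)] continuous_intros) auto
      show "0 < \<kappa> (z \<bullet> z)" "\<kappa> (z \<bullet> z) \<le> 1" for z :: "real^2"
        using radial_rate_bounds[OF \<alpha>(1)] by (simp_all add: \<kappa>_def)
      show "bounded {z. G z \<le> c}" for c
      proof -
        \<comment> \<open>Outside the unit ball 1 + ln (|z|^2) / 2 <= H <= 2 G <= 2 c, and |z| <=
          |z|^2.\<close>
        have "norm z \<le> max 1 (exp (4 * c))" if z: "G z \<le> c" for z
        proof (cases "norm z \<le> 1")
          case False
          then have "1 \<le> (norm z)\<^sup>2" by simp
          then have zz: "1 \<le> z \<bullet> z" by (simp add: power2_norm_eq_inner)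
          have "norm z \<le> (norm z)\<^sup>2" using False by (intro self_le_power) auto
          then have nz: "norm z \<le> z \<bullet> z" by (simp add: power2_norm_eq_inner)
          have "1 + ln (z \<bullet> z) / 2 \<le> H (z \<bullet> z)"
            by (rule radial_growth(2)[OF \<kappa>(2,4) H(2,4,5) odeH zz])
          then have "ln (z \<bullet> z) \<le> 4 * c" using half[of z] z by linarith
          then have "exp (ln (z \<bullet> z)) \<le> exp (4 * c)" by (simp only: exp_le_cancel_iff)
          moreover have "exp (ln (z \<bullet> z)) = z \<bullet> z" using zz by (intro exp_ln) linarith
          ultimately show ?thesis using nz by linarith
        qed auto
        then show ?thesis unfolding bounded_iff by blast
      qed
    qed
    then show ?thesis unfolding rate G_def .
  qed
  show thesis
  proof
    show "0 < 1 / (2 * C)" using C by simp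
    show "0 < P 1" using P(2)[of 1] by simp
    show "killed_harmonic (polynomial_killing_rate \<alpha>) (\<lambda>z. H (z \<bullet> z))" using kh[of 0] C by simp
    show "killed_harmonic (polynomial_killing_rate \<alpha>) (\<lambda>z. H (z \<bullet> z) + 1 / (2 * C) * z$1 * P (z \<bullet> z))"
      using kh[of "1 / (2 * C)"] C by simp
  qed (rule H(1))
qed

theorem theorem1p19:
  fixes \<alpha> :: real
    and P :: "real ^ 2 \<Rightarrow> 'w measure"
    and B :: "real \<Rightarrow> 'w \<Rightarrow> real ^ 2"
    and \<xi> :: "'w \<Rightarrow> real"
  defines "k \<equiv> polynomial_killing_rate \<alpha>"
  assumes "0 < \<alpha>" and "\<alpha> < 2"
    and "\<And>x. brownian_motion_with_clock (P x) B x \<xi>"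
  shows "\<exists>\<Lambda>\<^sub>1 \<Lambda>\<^sub>2 :: nat \<Rightarrow> (real ^ 2) set. \<exists>x y :: real ^ 2.
    exhaustion \<Lambda>\<^sub>1 \<and> exhaustion \<Lambda>\<^sub>2 \<and>
    (\<forall>z. exits_measurable (P z) k B \<xi> \<Lambda>\<^sub>1 \<and> exits_measurable (P z) k B \<xi> \<Lambda>\<^sub>2) \<and>
    (\<not> convergent (exit_ratio P k B \<xi> \<Lambda>\<^sub>1 x y) \<or>
     \<not> convergent (exit_ratio P k B \<xi> \<Lambda>\<^sub>2 x y) \<or>
     lim (exit_ratio P k B \<xi> \<Lambda>\<^sub>1 x y) \<noteq> lim (exit_ratio P k B \<xi> \<Lambda>\<^sub>2 x y))"
proof -
  obtain H Q \<epsilon> where HQ: "0 < \<epsilon>" "0 < Q 1" "H 0 = 1"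
    and harm: "killed_harmonic k (\<lambda>z. H (z \<bullet> z))"
      "killed_harmonic k (\<lambda>z. H (z \<bullet> z) + \<epsilon> * z$1 * Q (z \<bullet> z))"
    unfolding k_def using positive_harmonic_family[OF assms(2,3)] by blast
  define G1 where "G1 = (\<lambda>z::real^2. H (z \<bullet> z))"
  define G2 where "G2 = (\<lambda>z::real^2. H (z \<bullet> z) + \<epsilon> * z$1 * Q (z \<bullet> z))"
  define \<Lambda>\<^sub>1 where "\<Lambda>\<^sub>1 = (\<lambda>R::nat. {z. G1 z < real R + 1})"
  define \<Lambda>\<^sub>2 where "\<Lambda>\<^sub>2 = (\<lambda>R::nat. {z. G2 z < real R + 1})"
  \<comment> \<open>At the origin both functions equal H 0 = 1; at this unit vector they differ by
    \<epsilon> Q 1 > 0. Hence both limits exist and differ.\<close>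
  define x where "x = (axis 1 1 :: real^2)"
  note motion = killed_planar_motion.intro[OF assms(4)]
  have m1: "killed_planar_motion (P z) B z \<xi> k G1" for z
    unfolding G1_def by (rule motion[OF harm(1)])
  have m2: "killed_planar_motion (P z) B z \<xi> k G2" for z
    unfolding G2_def by (rule motion[OF harm(2)])
  have exh: "exhaustion \<Lambda>\<^sub>1" "exhaustion \<Lambda>\<^sub>2"
    using killed_harmonic.exhaustion_sublevels[OF harm(1)] killed_harmonic.exhaustion_sublevels[OF harm(2)]
    by (simp_all add: \<Lambda>\<^sub>1_def \<Lambda>\<^sub>2_def G1_def G2_def)
  have meas: "exits_measurable (P z) k B \<xi> \<Lambda>\<^sub>1" "exits_measurable (P z) k B \<xi> \<Lambda>\<^sub>2" for z
    unfolding \<Lambda>\<^sub>1_def \<Lambda>\<^sub>2_def by (rule exit_ratio_sublevels(1)[OF m1] exit_ratio_sublevels(1)[OF m2])+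
  have "lim (exit_ratio P k B \<xi> \<Lambda>\<^sub>1 x 0) = G1 x / G1 0" "lim (exit_ratio P k B \<xi> \<Lambda>\<^sub>2 x 0) = G2 x / G2 0"
    unfolding \<Lambda>\<^sub>1_def \<Lambda>\<^sub>2_def
    by (rule limI[OF exit_ratio_sublevels(2)[OF m1]] limI[OF exit_ratio_sublevels(2)[OF m2]])+
  moreover have "G1 x / G1 0 \<noteq> G2 x / G2 0"
    using HQ by (simp add: G1_def G2_def x_def inner_axis)
  ultimately show ?thesis using exh meas by metis
qed

end
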